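(* Let $\mathrm X$ be a locally compact Hausdorff space, $\kappa$ a consistent (in particular positive definite) kernel on $\mathrm X$, $\mathbf A=(A_i)_{i\in I}$ an $(I^+,I^-)$-condenser in $\mathrm X$, $\mathbf g=(g_i)_{i\in I}$ a family of continuous functions $g_i:\mathrm X\to(0,\infty)$, and $\mathbf a=(a_i)_{i\in I}$ with all $a_i>0$. Assume $\mathrm{cap}(\mathbf A,\mathbf a,\mathbf g)>0$ and that either $I^-=\varnothing$, or both $\sum_{i\in I}a_i\,g_{i,\inf}^{-1}<\infty$ and $\sup_{x\in A^+,\,y\in A^-}\kappa(x,y)<\infty$. Then the semimetric space $\mathcal E(\mathbf A,\leqslant\mathbf a,\mathbf g)$ is complete. In more detail, if $(\mu_s)_{s\in S}$ is a strong Cauchy net in $\mathcal E(\mathbf A,\leqslant\mathbf a,\mathbf g)$, then it has an $\mathbf A$-vague cluster point, and every $\mathbf A$-vague cluster point $\mu$ of it satisfies $\mu\in\mathcal E(\mathbf A,\leqslant\mathbf a,\mathbf g)$ and $$\lim_{s\in S}\|\mu_s-\mu\|^2=0.$$ Assume, in addition, that $\kappa$ is strictly positive definite and that all $A_i$, $i\in I$, are mutually disjoint. If moreover a net $(\mu_s)_{s\in S}\subset\mathcal E(\mathbf A,\leqslant\mathbf a,\mathbf g)$ converges strongly to $\mu_0\in\mathcal E(\mathbf A)$, then actually $\mu_0\in\mathcal E(\mathbf A,\leqslant\mathbf a,\mathbf g)$ and $\mu_s\to\mu_0$ $\mathbf A$-vaguely.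
   Context: $\mathfrak M$ is the linear space of all real-valued (signed) Radon measures on the locally compact Hausdorff space $\mathrm X$, with the vague topology (pointwise convergence on the space $\mathrm C_0(\mathrm X)$ of continuous real functions with compact support). For closed $E\subset\mathrm X$, $\mathfrak M^+(E)$ is the set of nonnegative $\nu\in\mathfrak M$ supported by $E$; $\mathfrak M^+:=\mathfrak M^+(\mathrm X)$. $\Phi(\mathrm Y)$ is the set of lower semicontinuous $\psi:\mathrm Y\to(-\infty,\infty]$ with $\psi\geqslant0$ unless $\mathrm Y$ is compact. A kernel is an element $\kappa\in\Phi(\mathrm X\times\mathrm X)$; the mutual energy is $\kappa(\nu,\nu_1)=\int\kappa\,d(\nu\otimes\nu_1)$ and the energy of $\nu$ is $\kappa(\nu,\nu)$, whenever well defined (integral against a signed measure: difference of the integrals against the positive and negative parts, not both infinite). $\kappa$ is positive definite if it is symmetric and $\kappa(\nu,\nu)\geqslant0$ whenever defined. $\mathcal E$ is the set of $\nu\in\mathfrak M$ of finite energy, a pre-Hilbert space with seminorm $\|\nu\|=\sqrt{\kappa(\nu,\nu)}$ (strong topology); $\kappa$ is strictly positive definite if this seminorm is a norm. $\mathcal E^+:=\mathcal E\cap\mathfrak M^+$. A positive definite kernel is consistent if every strong Cauchy net in $\mathcal E^+$ converges strongly to each of its vague cluster points; equivalently, every strongly bounded, vaguely convergent net $(\nu_s)$ in $\mathcal E^+$ with vague limit $\nu$ satisfies $\kappa(\nu_s,\mu)\to\kappa(\nu,\mu)$ for all $\mu\in\mathcal E$. Condensers: $I^+\neq\varnothing$ and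 $I^-$ (possibly empty) are disjoint countable (finite or infinite) subsets of $\mathbb N$, $I=I^+\cup I^-$. An $(I^+,I^-)$-condenser is a family $\mathbf A=(A_i)_{i\in I}$ of nonempty closed subsets of $\mathrm X$ such that every compact set meets at most finitely many $A_i$ and $A_i\cap A_j=\varnothing$ for $i\in I^+$, $j\in I^-$. $A^\pm:=\bigcup_{i\in I^\pm}A_i$; $\alpha_i=\pm1$ for $i\in I^\pm$. $\mathfrak M(\mathbf A)$ is the set of formal combinations $\mu=\sum_{i\in I}\alpha_i\mu^i$ with $\mu^i\in\mathfrak M^+(A_i)$, identified with $\prod_{i\in I}\mathfrak M^+(A_i)$; the $\mathbf A$-vague topology is the product of the vague topologies. $R\mu\in\mathfrak M$ is the Radon measure with $R\mu(\varphi)=\sum_i\alpha_i\mu^i(\varphi)$, $\varphi\in\mathrm C_0(\mathrm X)$. The energy of $\mu$ is $\kappa(\mu,\mu):=\kappa(R\mu,R\mu)$; $\mathcal E(\mathbf A)$ is the set of $\mu\in\mathfrak M(\mathbf A)$ of finite energy, a semimetric space with $\|\mu_1-\mu_2\|:=\|R\mu_1-R\mu_2\|$ (its topology is called strong); $\|\mu\|:=\|R\mu\|$. Let $g_{i,\inf}$ be the infimum of $g_i$ over $A_i$ (with $1/0=+\infty$). $\mathcal E(\mathbf A,\leqslant\mathbf a,\mathbf g)$ is the set of $\mu\in\mathcal E(\mathbf A)$ with $\int g_i\,d\mu^i\leqslant a_i$ for all $i\in I$, with the induced semimetric. $\mathcal E(\mathbf A,\mathbf a,\mathbf g)$ is the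 set of $\mu\in\mathcal E(\mathbf A)$ with $\int g_i\,d\mu^i=a_i$ for all $i\in I$, and $\mathrm{cap}(\mathbf A,\mathbf a,\mathbf g):=1/\inf\{\|\mu\|^2:\mu\in\mathcal E(\mathbf A,\mathbf a,\mathbf g)\}$ ($\inf\varnothing=+\infty$, $1/(+\infty)=0$, $1/0=+\infty$). *)

theory Defs
  imports "HOL-Analysis.Analysis"
begin

definition Cc :: "('a::topological_space \<Rightarrow> real) set" where
  "Cc = {f. continuous_on UNIV f \<and> compact (closure {x. f x \<noteq> 0})}"

text \<open>
  Signed Radon measures in the sense of Bourbaki: linear functionals on the space of continuous
  functions with compact support that are continuous in the uniform norm on the functions
  supported by any given compact set. (A signed Radon measure need not have finite total
  variation, so in general it is not a countably additive set function.) Functionals are total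
  functions in HOL; they are normalised to vanish off \<open>Cc\<close>, so that equality of functionals is
  equality of measures, and sums and scalar multiples can be taken pointwise.
\<close>

definition radon :: "(('a::topological_space \<Rightarrow> real) \<Rightarrow> real) set" where
  "radon = {\<nu>.
     (\<forall>f. f \<notin> Cc \<longrightarrow> \<nu> f = 0) \<and>
     (\<forall>f\<in>Cc. \<forall>g\<in>Cc. \<nu> (\<lambda>x. f x + g x) = \<nu> f + \<nu> g) \<and>
     (\<forall>c. \<forall>f\<in>Cc. \<nu> (\<lambda>x. c * f x) = c * \<nu> f) \<and>
     (\<forall>K. compact K \<longrightarrow>
        (\<exists>B. \<forall>f\<in>Cc. \<forall>c. closure {x. f x \<noteq> 0} \<subseteq> K \<longrightarrow> (\<forall>x. \<bar>f x\<bar> \<le> c) \<longrightarrow> \<bar>\<nu> f\<bar> \<le> B * c))}"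

text \<open>
  Nonnegative Radon measures supported by \<open>E\<close>, for closed \<open>E\<close>: the restriction
  to the open set \<open>- E\<close> is zero.
\<close>

definition radon_nonneg :: "'a::topological_space set \<Rightarrow> (('a \<Rightarrow> real) \<Rightarrow> real) set" where
  "radon_nonneg E = {\<nu> \<in> radon.
     (\<forall>f\<in>Cc. (\<forall>x. 0 \<le> f x) \<longrightarrow> 0 \<le> \<nu> f) \<and>
     (\<forall>f\<in>Cc. closure {x. f x \<noteq> 0} \<inter> E = {} \<longrightarrow> \<nu> f = 0)}"

text \<open>
  The topology of the function type is that of pointwise convergence. As Radon measures
  vanish off \<open>Cc\<close>, on them it is pointwise convergence on \<open>Cc\<close>.
\<close>

definition vague_topology :: "(('a::topological_space \<Rightarrow> real) \<Rightarrow> real) topology" where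
  "vague_topology = top_of_set radon"

text \<open>
  Jordan decomposition in the vector lattice of Radon measures. On nonnegative \<open>h\<close>, the positive
  part of \<open>\<nu>\<close> is the supremum \<open>p h\<close> of \<open>\<nu> g\<close> over \<open>0 \<le> g \<le> h\<close>; it extends linearly to all of \<open>Cc\<close>.
\<close>

definition radon_pos :: "(('a::topological_space \<Rightarrow> real) \<Rightarrow> real) \<Rightarrow> ('a \<Rightarrow> real) \<Rightarrow> real" where
  "radon_pos \<nu> f =
     (let p = (\<lambda>h. SUP g\<in>{g \<in> Cc. \<forall>x. 0 \<le> g x \<and> g x \<le> h x}. \<nu> g)
      in if f \<in> Cc then p (\<lambda>x. max (f x) 0) - p (\<lambda>x. max (- f x) 0) else 0)"

definition radon_neg :: "(('a::topological_space \<Rightarrow> real) \<Rightarrow> real) \<Rightarrow> ('a \<Rightarrow> real) \<Rightarrow> real" where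
  "radon_neg \<nu> = radon_pos (\<lambda>f. - \<nu> f)"

definition lsc_class :: "('a::topological_space \<Rightarrow> ereal) set" where
  "lsc_class = {\<psi>.
     (\<forall>t. open {x. t < \<psi> x}) \<and> (\<forall>x. \<psi> x \<noteq> -\<infinity>) \<and> (compact (UNIV :: 'a set) \<or> (\<forall>x. 0 \<le> \<psi> x))}"

text \<open>
  Integral of a function of \<open>lsc_class\<close> against a nonnegative Radon measure. The set of
  functions over which the supremum is taken is nonempty: it contains 0 if \<open>\<psi>\<close> is
  nonnegative, and a constant if the space is compact.
\<close>

definition lsc_integral ::
  "(('a::topological_space \<Rightarrow> real) \<Rightarrow> real) \<Rightarrow> ('a \<Rightarrow> ereal) \<Rightarrow> ereal" where
  "lsc_integral \<nu> \<psi> = (SUP f\<in>{f \<in> Cc. \<forall>x. ereal (f x) \<le> \<psi> x}. ereal (\<nu> f))"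

text \<open>
  Integrals of functions of \<open>lsc_class\<close> never equal \<open>-\<infinity>\<close>, so against a signed measure the only
  undefined case is \<open>\<infinity> - \<infinity>\<close>.
\<close>

definition radon_integral_defined ::
  "(('a::topological_space \<Rightarrow> real) \<Rightarrow> real) \<Rightarrow> ('a \<Rightarrow> ereal) \<Rightarrow> bool" where
  "radon_integral_defined \<nu> \<psi> \<longleftrightarrow>
     \<not> (lsc_integral (radon_pos \<nu>) \<psi> = \<infinity> \<and> lsc_integral (radon_neg \<nu>) \<psi> = \<infinity>)"

definition radon_integral ::
  "(('a::topological_space \<Rightarrow> real) \<Rightarrow> real) \<Rightarrow> ('a \<Rightarrow> ereal) \<Rightarrow> ereal" where
  "radon_integral \<nu> \<psi> = lsc_integral (radon_pos \<nu>) \<psi> - lsc_integral (radon_neg \<nu>) \<psi>"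

text \<open>
  The product of two Radon measures is a Radon measure on the product space, given
  on \<open>Cc\<close> by iterated integration. (The product of Borel measures of the library lives on the
  product sigma-algebra, for which lower semicontinuous kernels need not be measurable.)
\<close>

definition radon_product ::
  "(('a::topological_space \<Rightarrow> real) \<Rightarrow> real) \<Rightarrow> (('b::topological_space \<Rightarrow> real) \<Rightarrow> real)
     \<Rightarrow> ('a \<times> 'b \<Rightarrow> real) \<Rightarrow> real" where
  "radon_product \<nu> \<nu>\<^sub>1 F = (if F \<in> Cc then \<nu> (\<lambda>x. \<nu>\<^sub>1 (\<lambda>y. F (x, y))) else 0)"

definition energy_defined ::
  "('a::topological_space \<times> 'a \<Rightarrow> ereal) \<Rightarrow> (('a \<Rightarrow> real) \<Rightarrow> real) \<Rightarrow> (('a \<Rightarrow> real) \<Rightarrow> real) \<Rightarrow> bool"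
  where "energy_defined \<kappa> \<nu> \<nu>\<^sub>1 \<longleftrightarrow> radon_integral_defined (radon_product \<nu> \<nu>\<^sub>1) \<kappa>"

definition energy ::
  "('a::topological_space \<times> 'a \<Rightarrow> ereal) \<Rightarrow> (('a \<Rightarrow> real) \<Rightarrow> real) \<Rightarrow> (('a \<Rightarrow> real) \<Rightarrow> real) \<Rightarrow> ereal"
  where "energy \<kappa> \<nu> \<nu>\<^sub>1 = radon_integral (radon_product \<nu> \<nu>\<^sub>1) \<kappa>"

definition finite_energy ::
  "('a::topological_space \<times> 'a \<Rightarrow> ereal) \<Rightarrow> (('a \<Rightarrow> real) \<Rightarrow> real) set" where
  "finite_energy \<kappa> = {\<nu> \<in> radon. energy_defined \<kappa> \<nu> \<nu> \<and> \<bar>energy \<kappa> \<nu> \<nu>\<bar> \<noteq> \<infinity>}"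

definition energy_norm ::
  "('a::topological_space \<times> 'a \<Rightarrow> ereal) \<Rightarrow> (('a \<Rightarrow> real) \<Rightarrow> real) \<Rightarrow> real" where
  "energy_norm \<kappa> \<nu> = sqrt (real_of_ereal (energy \<kappa> \<nu> \<nu>))"

definition energy_dist ::
  "('a::topological_space \<times> 'a \<Rightarrow> ereal) \<Rightarrow> (('a \<Rightarrow> real) \<Rightarrow> real) \<Rightarrow> (('a \<Rightarrow> real) \<Rightarrow> real) \<Rightarrow> real"
  where "energy_dist \<kappa> \<nu> \<nu>\<^sub>1 = energy_norm \<kappa> (\<lambda>f. \<nu> f - \<nu>\<^sub>1 f)"

definition positive_definite :: "('a::topological_space \<times> 'a \<Rightarrow> ereal) \<Rightarrow> bool" where
  "positive_definite \<kappa> \<longleftrightarrow>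
     (\<forall>x y. \<kappa> (x, y) = \<kappa> (y, x)) \<and>
     (\<forall>\<nu>\<in>radon. energy_defined \<kappa> \<nu> \<nu> \<longrightarrow> 0 \<le> energy \<kappa> \<nu> \<nu>)"

definition strictly_positive_definite :: "('a::topological_space \<times> 'a \<Rightarrow> ereal) \<Rightarrow> bool" where
  "strictly_positive_definite \<kappa> \<longleftrightarrow>
     positive_definite \<kappa> \<and> (\<forall>\<nu>\<in>finite_energy \<kappa>. energy_norm \<kappa> \<nu> = 0 \<longrightarrow> \<nu> = (\<lambda>_. 0))"

definition directed :: "'s set \<Rightarrow> ('s \<times> 's) set \<Rightarrow> bool" where
  "directed S r \<longleftrightarrow>
     S \<noteq> {} \<and> preorder_on S r \<and> (\<forall>s\<in>S. \<forall>t\<in>S. \<exists>u\<in>S. (s, u) \<in> r \<and> (t, u) \<in> r)"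

text \<open>
  The filter generated by the tails of the directed set \<open>S\<close>; a property holds eventually
  along this filter iff it holds for all sufficiently late \<open>s\<close>.
\<close>

definition net_filter :: "'s set \<Rightarrow> ('s \<times> 's) set \<Rightarrow> 's filter" where
  "net_filter S r = (INF s\<in>S. principal (r `` {s}))"

definition cauchy_along :: "('b \<Rightarrow> 'b \<Rightarrow> real) \<Rightarrow> ('s \<Rightarrow> 'b) \<Rightarrow> 's filter \<Rightarrow> bool" where
  "cauchy_along d x F \<longleftrightarrow> (\<forall>e>0. \<forall>\<^sub>F (s, t) in F \<times>\<^sub>F F. d (x s) (x t) < e)"

definition cluster_point_along :: "'b topology \<Rightarrow> ('s \<Rightarrow> 'b) \<Rightarrow> 's filter \<Rightarrow> 'b \<Rightarrow> bool" where
  "cluster_point_along T x F z \<longleftrightarrow>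
     z \<in> topspace T \<and> (\<forall>U. openin T U \<and> z \<in> U \<longrightarrow> (\<exists>\<^sub>F s in F. x s \<in> U))"

text \<open>
  Completeness and consistency speak about all nets, over directed sets of any type.
  A net matters only through the image of its tail filter, and every proper filter
  on a set arises in this way from a net in that set. So these two definitions quantify over proper
  filters on the space itself; a HOL definition cannot quantify over index types.
\<close>

definition semimetric_complete :: "('b \<Rightarrow> 'b \<Rightarrow> real) \<Rightarrow> 'b set \<Rightarrow> bool" where
  "semimetric_complete d M \<longleftrightarrow>
     (\<forall>F. F \<noteq> bot \<and> F \<le> principal M \<and> cauchy_along d (\<lambda>x. x) F \<longrightarrow>
        (\<exists>z\<in>M. ((\<lambda>x. d x z) \<longlongrightarrow> 0) F))"

definition consistent :: "('a::topological_space \<times> 'a \<Rightarrow> ereal) \<Rightarrow> bool" where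
  "consistent \<kappa> \<longleftrightarrow>
     positive_definite \<kappa> \<and>
     (\<forall>F. F \<noteq> bot \<and> F \<le> principal (finite_energy \<kappa> \<inter> radon_nonneg UNIV) \<and>
          cauchy_along (energy_dist \<kappa>) (\<lambda>\<nu>. \<nu>) F \<longrightarrow>
        (\<forall>\<mu>. cluster_point_along vague_topology (\<lambda>\<nu>. \<nu>) F \<mu> \<longrightarrow>
           \<mu> \<in> finite_energy \<kappa> \<and> ((\<lambda>\<nu>. energy_dist \<kappa> \<nu> \<mu>) \<longlongrightarrow> 0) F))"

text \<open>
  \<open>P\<close> and \<open>N\<close> are the index sets of the positive and of the negative plates. Families over
  \<open>P \<union> N\<close> are extensional functions, so that families of measures form the carrier of the product
  topology of the library.
\<close>

definition condenser :: "nat set \<Rightarrow> nat set \<Rightarrow> (nat \<Rightarrow> 'a::topological_space set) \<Rightarrow> bool" where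
  "condenser P N A \<longleftrightarrow>
     P \<noteq> {} \<and> P \<inter> N = {} \<and>
     (\<forall>i\<in>P \<union> N. closed (A i) \<and> A i \<noteq> {}) \<and>
     (\<forall>K. compact K \<longrightarrow> finite {i \<in> P \<union> N. A i \<inter> K \<noteq> {}}) \<and>
     (\<forall>i\<in>P. \<forall>j\<in>N. A i \<inter> A j = {})"

definition condenser_measures ::
  "nat set \<Rightarrow> nat set \<Rightarrow> (nat \<Rightarrow> 'a::topological_space set) \<Rightarrow> (nat \<Rightarrow> ('a \<Rightarrow> real) \<Rightarrow> real) set" where
  "condenser_measures P N A = (\<Pi>\<^sub>E i\<in>P \<union> N. radon_nonneg (A i))"

definition condenser_vague_topology ::
  "nat set \<Rightarrow> nat set \<Rightarrow> (nat \<Rightarrow> 'a::topological_space set)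
     \<Rightarrow> (nat \<Rightarrow> ('a \<Rightarrow> real) \<Rightarrow> real) topology" where
  "condenser_vague_topology P N A =
     product_topology (\<lambda>i. subtopology vague_topology (radon_nonneg (A i))) (P \<union> N)"

definition condenser_sign :: "nat set \<Rightarrow> nat \<Rightarrow> real" where
  "condenser_sign P i = (if i \<in> P then 1 else - 1)"

text \<open>
  The signed Radon measure \<open>R \<mu>\<close>. For a condenser only finitely many terms of the sum are nonzero,
  since the support of a function in \<open>Cc\<close> meets only finitely many of the plates \<open>A i\<close>.
\<close>

definition condenser_resultant ::
  "nat set \<Rightarrow> nat set \<Rightarrow> (nat \<Rightarrow> ('a::topological_space \<Rightarrow> real) \<Rightarrow> real) \<Rightarrow> ('a \<Rightarrow> real) \<Rightarrow> real" where
  "condenser_resultant P N \<mu> f = (\<Sum>\<^sub>\<infinity>i\<in>P \<union> N. condenser_sign P i * \<mu> i f)"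

definition condenser_norm ::
  "('a::topological_space \<times> 'a \<Rightarrow> ereal) \<Rightarrow> nat set \<Rightarrow> nat set
     \<Rightarrow> (nat \<Rightarrow> ('a \<Rightarrow> real) \<Rightarrow> real) \<Rightarrow> real" where
  "condenser_norm \<kappa> P N \<mu> = energy_norm \<kappa> (condenser_resultant P N \<mu>)"

definition condenser_dist ::
  "('a::topological_space \<times> 'a \<Rightarrow> ereal) \<Rightarrow> nat set \<Rightarrow> nat set
     \<Rightarrow> (nat \<Rightarrow> ('a \<Rightarrow> real) \<Rightarrow> real) \<Rightarrow> (nat \<Rightarrow> ('a \<Rightarrow> real) \<Rightarrow> real) \<Rightarrow> real" where
  "condenser_dist \<kappa> P N \<mu>\<^sub>1 \<mu>\<^sub>2 =
     energy_dist \<kappa> (condenser_resultant P N \<mu>\<^sub>1) (condenser_resultant P N \<mu>\<^sub>2)"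

definition condenser_finite_energy ::
  "('a::topological_space \<times> 'a \<Rightarrow> ereal) \<Rightarrow> nat set \<Rightarrow> nat set \<Rightarrow> (nat \<Rightarrow> 'a set)
     \<Rightarrow> (nat \<Rightarrow> ('a \<Rightarrow> real) \<Rightarrow> real) set" where
  "condenser_finite_energy \<kappa> P N A =
     {\<mu> \<in> condenser_measures P N A. condenser_resultant P N \<mu> \<in> finite_energy \<kappa>}"

definition condenser_energy_le ::
  "('a::topological_space \<times> 'a \<Rightarrow> ereal) \<Rightarrow> nat set \<Rightarrow> nat set \<Rightarrow> (nat \<Rightarrow> 'a set)
     \<Rightarrow> (nat \<Rightarrow> real) \<Rightarrow> (nat \<Rightarrow> 'a \<Rightarrow> real) \<Rightarrow> (nat \<Rightarrow> ('a \<Rightarrow> real) \<Rightarrow> real) set" where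
  "condenser_energy_le \<kappa> P N A a g =
     {\<mu> \<in> condenser_finite_energy \<kappa> P N A.
        \<forall>i\<in>P \<union> N. lsc_integral (\<mu> i) (\<lambda>x. ereal (g i x)) \<le> ereal (a i)}"

definition condenser_energy_eq ::
  "('a::topological_space \<times> 'a \<Rightarrow> ereal) \<Rightarrow> nat set \<Rightarrow> nat set \<Rightarrow> (nat \<Rightarrow> 'a set)
     \<Rightarrow> (nat \<Rightarrow> real) \<Rightarrow> (nat \<Rightarrow> 'a \<Rightarrow> real) \<Rightarrow> (nat \<Rightarrow> ('a \<Rightarrow> real) \<Rightarrow> real) set" where
  "condenser_energy_eq \<kappa> P N A a g =
     {\<mu> \<in> condenser_finite_energy \<kappa> P N A.
        \<forall>i\<in>P \<union> N. lsc_integral (\<mu> i) (\<lambda>x. ereal (g i x)) = ereal (a i)}"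

text \<open>In \<^typ>\<open>ennreal\<close>, the infimum of the empty set is \<open>\<infinity>\<close>, \<open>1 / \<infinity> = 0\<close> and \<open>1 / 0 = \<infinity>\<close>.\<close>

definition condenser_cap ::
  "('a::topological_space \<times> 'a \<Rightarrow> ereal) \<Rightarrow> nat set \<Rightarrow> nat set \<Rightarrow> (nat \<Rightarrow> 'a set)
     \<Rightarrow> (nat \<Rightarrow> real) \<Rightarrow> (nat \<Rightarrow> 'a \<Rightarrow> real) \<Rightarrow> ennreal" where
  "condenser_cap \<kappa> P N A a g =
     1 / (INF \<mu>\<in>condenser_energy_eq \<kappa> P N A a g. ennreal ((condenser_norm \<kappa> P N \<mu>)\<^sup>2))"

end

theory Submission
  imports Defs
begin

text \<open>
  Write \<open>R \<mu> = p - n\<close> with \<open>p\<close>, \<open>n\<close> carried by the positive and by the negative plates. The hypotheses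
  on the masses and on the kernel bound the mutual energy of \<open>p\<close> and \<open>n\<close> uniformly on the set of
  admissible families, so the two parts of a strong Cauchy net have bounded energy, while the
  constraints keep the net in a vaguely compact set. Consistency applies to Cauchy filters of positive
  measures only, and the parts of the net need not be Cauchy. But among all pairs of positive measures
  that are vaguely close to the parts of the limit and whose difference is strongly close to the tail
  of the net, those whose first component has almost minimal energy form a Cauchy filter, by the
  parallelogram law. Consistency identifies its strong limit with the vague limit of the net.
\<close>

section \<open>Positive functionals and the Jordan decomposition\<close>

text \<open>A signed Radon measure is only a functional, and its energy is a difference of two
  integrals that may both be infinite. The estimates therefore live on differences of nonnegative
  measures of finite energy: there positive definiteness makes every mutual energy finite, and the
  energy becomes a quadratic form subject to the parallelogram law. Resultants of finite energy
  belong to this space because the positive and the negative plates are disjoint, so that the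
  products of the two parts give the Jordan decomposition of the product measure.

  The minimal energy argument works because vague closeness of the components and strong closeness
  of the difference are convex conditions. The midpoint of two admissible pairs is admissible, so
  its first component cannot have much less than the minimal energy, and this forces two almost
  minimal first components to be close. The second components are close too, since the differences
  are. The energy bound on the positive parts of the net keeps the minimal energy bounded as the
  vague neighbourhoods shrink.\<close>

lemma compact_closure_subset:
  assumes "compact K" "closure A \<subseteq> K"
  shows "compact (closure A)"
proof -
  have "K \<inter> closure A = closure A"
    using assms(2) by blast
  then show ?thesis
    using compact_Int_closed[OF assms(1) closed_closure, of A] by simp
qed

lemma Cc_support:
  assumes "continuous_on UNIV f" "g \<in> Cc" "\<And>x. g x = 0 \<Longrightarrow> f x = 0"
  shows "f \<in> Cc"
proof -
  have "closure {x. f x \<noteq> 0} \<subseteq> closure {x. g x \<noteq> 0}"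
    using assms(3) by (intro closure_mono) auto
  then have "compact (closure {x. f x \<noteq> 0})"
    by (rule compact_closure_subset[rotated]) (use assms(2) in \<open>simp add: Cc_def\<close>)
  then show ?thesis
    using assms(1) by (simp add: Cc_def)
qed

lemma Cc_continuous: "f \<in> Cc \<Longrightarrow> continuous_on UNIV f"
  by (simp add: Cc_def)

lemma Cc_compact_support: "f \<in> Cc \<Longrightarrow> compact (closure {x. f x \<noteq> 0})"
  by (simp add: Cc_def)

lemma Cc_0 [simp]: "(\<lambda>_. 0) \<in> Cc"
  by (simp add: Cc_def)

lemma Cc_add [simp]:
  assumes "f \<in> Cc" "g \<in> Cc" shows "(\<lambda>x. f x + g x) \<in> Cc"
proof -
  have cont: "continuous_on UNIV (\<lambda>x. f x + g x)"
    using assms by (auto simp: Cc_def intro: continuous_intros)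
  have K: "compact (closure {x. f x \<noteq> 0} \<union> closure {x. g x \<noteq> 0})"
    using assms by (auto simp: Cc_def)
  have "closure {x. f x + g x \<noteq> 0} \<subseteq> closure ({x. f x \<noteq> 0} \<union> {x. g x \<noteq> 0})"
    by (intro closure_mono) auto
  then have "compact (closure {x. f x + g x \<noteq> 0})"
    using compact_closure_subset[OF K] by simp
  then show ?thesis
    using cont by (simp add: Cc_def)
qed

lemma Cc_times [simp]: "f \<in> Cc \<Longrightarrow> continuous_on UNIV u \<Longrightarrow> (\<lambda>x. u x * f x) \<in> Cc"
  by (rule Cc_support[of _ f]) (auto intro!: continuous_on_mult dest: Cc_continuous)

lemma Cc_cmult [simp]: "f \<in> Cc \<Longrightarrow> (\<lambda>x. c * f x) \<in> Cc"
  by (rule Cc_times) auto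

lemma Cc_uminus [simp]: "f \<in> Cc \<Longrightarrow> (\<lambda>x. - f x) \<in> Cc"
  using Cc_cmult[of f "-1"] by simp

lemma Cc_diff [simp]: "f \<in> Cc \<Longrightarrow> g \<in> Cc \<Longrightarrow> (\<lambda>x. f x - g x) \<in> Cc"
  using Cc_add[of f "\<lambda>x. - g x"] by simp

lemma Cc_max0 [simp]: "f \<in> Cc \<Longrightarrow> (\<lambda>x. max (f x) 0) \<in> Cc"
  by (rule Cc_support[of _ f]) (auto intro!: continuous_on_max dest: Cc_continuous)

lemma Cc_max [simp]: 
  assumes "f \<in> Cc" "g \<in> Cc" shows "(\<lambda>x. max (f x) (g x)) \<in> Cc"
proof -
  have "(\<lambda>x. max (f x) (g x)) = (\<lambda>x. max (f x - g x) 0 + g x)"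
    by auto
  then show ?thesis
    using assms by simp
qed

lemma Cc_min [simp]: 
  assumes "f \<in> Cc" "g \<in> Cc" shows "(\<lambda>x. min (f x) (g x)) \<in> Cc"
proof -
  have "(\<lambda>x. min (f x) (g x)) = (\<lambda>x. f x - max (f x - g x) 0)"
    by auto
  then show ?thesis
    using assms by simp
qed

lemma Cc_abs [simp]: "f \<in> Cc \<Longrightarrow> (\<lambda>x. \<bar>f x\<bar>) \<in> Cc"
  by (rule Cc_support[of _ f]) (auto intro!: continuous_on_rabs dest: Cc_continuous)

text \<open>Additivity and positivity on \<open>Cc\<close> are the common ground of nonnegative
  Radon measures, their products and the positive parts of signed measures, so what follows applies
  on the product space directly to iterated integrals.\<close>

definition pos_functional :: "(('a::topological_space \<Rightarrow> real) \<Rightarrow> real) \<Rightarrow> bool" where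
  "pos_functional m \<longleftrightarrow>
     (\<forall>f\<in>Cc. \<forall>g\<in>Cc. m (\<lambda>x. f x + g x) = m f + m g) \<and>
     (\<forall>f\<in>Cc. (\<forall>x. 0 \<le> f x) \<longrightarrow> 0 \<le> m f)"

lemma pos_functional_add:
  "pos_functional m \<Longrightarrow> f \<in> Cc \<Longrightarrow> g \<in> Cc \<Longrightarrow> m (\<lambda>x. f x + g x) = m f + m g"
  by (simp add: pos_functional_def)

lemma pos_functional_nonneg:
  "pos_functional m \<Longrightarrow> f \<in> Cc \<Longrightarrow> (\<And>x. 0 \<le> f x) \<Longrightarrow> 0 \<le> m f"
  by (simp add: pos_functional_def)

lemma pos_functional_0: "pos_functional m \<Longrightarrow> m (\<lambda>_. 0) = 0"
  using pos_functional_add[of m "\<lambda>_. 0" "\<lambda>_. 0"] by simp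

lemma pos_functional_diff:
  assumes "pos_functional m" "f \<in> Cc" "g \<in> Cc"
  shows "m (\<lambda>x. f x - g x) = m f - m g"
  using pos_functional_add[of m "\<lambda>x. f x - g x" g] assms by simp

lemma pos_functional_mono:
  assumes "pos_functional m" "f \<in> Cc" "g \<in> Cc" "\<And>x. f x \<le> g x"
  shows "m f \<le> m g"
  using pos_functional_nonneg[of m "\<lambda>x. g x - f x"] pos_functional_diff[of m g f] assms by simp

lemma pos_functional_plus:
  "pos_functional m \<Longrightarrow> pos_functional n \<Longrightarrow> pos_functional (\<lambda>f. m f + n f)"
  by (simp add: pos_functional_def)

lemma pos_functional_zero: "pos_functional (\<lambda>_. 0)"
  by (simp add: pos_functional_def)

section \<open>Integrals of lower semicontinuous functions\<close>

lemma lsc_integral_cong: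
  "(\<And>f. f \<in> Cc \<Longrightarrow> m f = n f) \<Longrightarrow> lsc_integral m \<psi> = lsc_integral n \<psi>"
  unfolding lsc_integral_def by (intro SUP_cong) auto

text \<open>On a compact space the open sets where \<open>\<psi>\<close> exceeds \<open>- n\<close>
  form a cover, so some constant lies below \<open>\<psi>\<close>; otherwise 0 does. Hence the
  supremum defining \<open>lsc_integral\<close> runs over a nonempty set.\<close>

lemma lsc_class_minorant:
  fixes \<psi> :: "'a::topological_space \<Rightarrow> ereal"
  assumes "\<psi> \<in> lsc_class"
  obtains f where "f \<in> Cc" "\<And>x. ereal (f x) \<le> \<psi> x"
proof (cases "compact (UNIV :: 'a set)")
  case True
  have op: "open {x. t < \<psi> x}" and fin: "\<psi> x \<noteq> -\<infinity>" for t x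
    using assms by (auto simp: lsc_class_def)
  have "\<exists>n::nat. - ereal (real n) < \<psi> x" for x
  proof (cases "\<psi> x")
    case (real r)
    obtain n :: nat where "- r < real n"
      using reals_Archimedean2 by blast
    then show ?thesis
      using real by (intro exI[of _ n]) auto
  qed (use fin[of x] in auto)
  then have "UNIV \<subseteq> (\<Union>n::nat\<in>UNIV. {x. - ereal (real n) < \<psi> x})"
    by blast
  then obtain T where T: "finite T" "UNIV \<subseteq> (\<Union>n::nat\<in>T. {x. - ereal (real n) < \<psi> x})"
    by (rule compactE_image[OF True op])
  let ?M = "real (Max (insert 0 T))"
  have "ereal (- ?M) \<le> \<psi> x" for x
  proof -
    obtain n where n: "n \<in> T" "- ereal (real n) < \<psi> x"
      using T by blast
    have "n \<le> Max (insert 0 T)"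
      using T(1) n(1) by simp
    then have "ereal (- ?M) \<le> - ereal (real n)"
      by simp
    also have "\<dots> \<le> \<psi> x"
      using n(2) by (rule less_imp_le)
    finally show ?thesis .
  qed
  moreover have "(\<lambda>_::'a. - ?M) \<in> Cc"
    using compact_closure_subset[OF True] by (simp add: Cc_def)
  ultimately show ?thesis
    using that by blast
next
  case False
  then show ?thesis
    using assms that[of "\<lambda>_. 0"] by (auto simp: lsc_class_def zero_ereal_def)
qed

lemma lsc_integral_neq_MInf:
  assumes "\<psi> \<in> lsc_class"
  shows "lsc_integral m \<psi> \<noteq> -\<infinity>"
proof -
  obtain f where "f \<in> Cc" "\<And>x. ereal (f x) \<le> \<psi> x"
    using lsc_class_minorant[OF assms] by blast
  then have "ereal (m f) \<le> lsc_integral m \<psi>"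
    unfolding lsc_integral_def by (intro SUP_upper) auto
  then show ?thesis
    by auto
qed

lemma lsc_integral_zero:
  assumes "\<psi> \<in> lsc_class"
  shows "lsc_integral (\<lambda>_. 0) \<psi> = 0"
proof -
  obtain f where "f \<in> Cc" "\<And>x. ereal (f x) \<le> \<psi> x"
    using lsc_class_minorant[OF assms] by blast
  then have "{f \<in> Cc. \<forall>x. ereal (f x) \<le> \<psi> x} \<noteq> {}"
    by blast
  then show ?thesis
    unfolding lsc_integral_def by (simp add: zero_ereal_def)
qed

text \<open>Minorants of \<open>\<psi>\<close> are closed under maxima, so two minorants that are
  nearly optimal for \<open>m\<close> and for \<open>n\<close> can be replaced by a common one. This
  gives the nontrivial inequality.\<close>

lemma lsc_integral_add:
  assumes "\<psi> \<in> lsc_class" "pos_functional m" "pos_functional n"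
  shows "lsc_integral (\<lambda>f. m f + n f) \<psi> = lsc_integral m \<psi> + lsc_integral n \<psi>"
proof (rule antisym)
  let ?L = "{f \<in> Cc. \<forall>x. ereal (f x) \<le> \<psi> x}"
  obtain f0 where "f0 \<in> ?L"
    using lsc_class_minorant[OF assms(1)] by blast
  then have ne: "?L \<noteq> {}"
    by blast
  show "lsc_integral (\<lambda>f. m f + n f) \<psi> \<le> lsc_integral m \<psi> + lsc_integral n \<psi>"
    unfolding lsc_integral_def
    by (intro SUP_least) (auto simp flip: plus_ereal.simps(1) intro!: add_mono SUP_upper)
  have le: "ereal (m f) + ereal (n g) \<le> lsc_integral (\<lambda>f. m f + n f) \<psi>"
    if "f \<in> ?L" "g \<in> ?L" for f g
  proof -
    let ?h = "\<lambda>x. max (f x) (g x)"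
    have "ereal (?h x) \<le> \<psi> x" for x
      using that by (simp add: max_def)
    then have h: "?h \<in> ?L"
      using that by simp
    have "m f \<le> m ?h"
      by (rule pos_functional_mono[OF assms(2)]) (use that in auto)
    moreover have "n g \<le> n ?h"
      by (rule pos_functional_mono[OF assms(3)]) (use that in auto)
    ultimately have "m f + n g \<le> m ?h + n ?h"
      by (rule add_mono)
    also have "ereal \<dots> \<le> lsc_integral (\<lambda>f. m f + n f) \<psi>"
      unfolding lsc_integral_def using h by (intro SUP_upper) auto
    finally show ?thesis
      by simp
  qed
  have "lsc_integral m \<psi> + ereal (n g) \<le> lsc_integral (\<lambda>f. m f + n f) \<psi>" if "g \<in> ?L" for g
    unfolding lsc_integral_def[of m]
    using le that ne by (subst SUP_ereal_add_left[symmetric]) (auto intro!: SUP_least)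
  then show "lsc_integral m \<psi> + lsc_integral n \<psi> \<le> lsc_integral (\<lambda>f. m f + n f) \<psi>"
    unfolding lsc_integral_def[of n]
    using ne lsc_integral_neq_MInf[OF assms(1), of m]
    by (subst SUP_ereal_add_right[symmetric]) (auto intro!: SUP_least)
qed

section \<open>Jordan decomposition compared with other decompositions\<close>

text \<open>Compared with the Jordan decomposition of \<open>m\<close>, any representation as a
  difference of positive functionals carries the same surplus in both terms. The surplus is positive
  because \<open>m1\<close> dominates \<open>m\<close> on nonnegative functions, hence also the
  supremum that defines the positive part.\<close>

lemma radon_pos_decomposition:
  fixes m :: "('a::topological_space \<Rightarrow> real) \<Rightarrow> real"
  assumes m1: "pos_functional m1" and m2: "pos_functional m2"
    and m: "\<And>f. f \<in> Cc \<Longrightarrow> m f = m1 f - m2 f"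
  shows "pos_functional (radon_pos m)" "pos_functional (\<lambda>f. m1 f - radon_pos m f)"
    and "\<And>f. f \<in> Cc \<Longrightarrow> m1 f - radon_pos m f = m2 f - radon_neg m f"
    and "\<And>f g. f \<in> Cc \<Longrightarrow> g \<in> Cc \<Longrightarrow> (\<And>x. 0 \<le> g x) \<Longrightarrow> (\<And>x. g x \<le> f x) \<Longrightarrow> m g \<le> radon_pos m f"
proof -
  let ?I = "\<lambda>h. {g \<in> Cc. \<forall>x. 0 \<le> g x \<and> g x \<le> h x}"
  define p :: "(('a \<Rightarrow> real) \<Rightarrow> real) \<Rightarrow> ('a \<Rightarrow> real) \<Rightarrow> real" where "p \<mu> h = (SUP g\<in>?I h. \<mu> g)" for \<mu> h
  have madd: "m (\<lambda>x. f x + g x) = m f + m g" if "f \<in> Cc" "g \<in> Cc" for f g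
    using that m m1 m2 by (simp add: pos_functional_add)
  have ub: "m g \<le> m1 h" if "h \<in> Cc" "g \<in> ?I h" for h g
  proof -
    have "m g \<le> m1 g"
      using that m pos_functional_nonneg[OF m2, of g] by auto
    also have "\<dots> \<le> m1 h"
      using that by (intro pos_functional_mono[OF m1]) auto
    finally show ?thesis .
  qed
  have bdd: "bdd_above (m ` ?I h)" if "h \<in> Cc" for h
    using ub[OF that] by (intro bdd_aboveI2) 
  have up: "m g \<le> p m h" if "h \<in> Cc" "g \<in> ?I h" for g h
    unfolding p_def using that bdd by (intro cSUP_upper) auto
  have least: "p m h \<le> c" if "\<And>x. 0 \<le> h x" "\<And>g. g \<in> ?I h \<Longrightarrow> m g \<le> c" for h c
    unfolding p_def using that by (intro cSUP_least) (auto intro!: exI[of _ "\<lambda>_. 0"])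
  have p_nonneg: "0 \<le> p m h" if "h \<in> Cc" "\<And>x. 0 \<le> h x" for h
    using up[OF that(1), of "\<lambda>_. 0"] that(2) m pos_functional_0[OF m1] pos_functional_0[OF m2] by simp
  have p_le: "p m h \<le> m1 h" if "h \<in> Cc" "\<And>x. 0 \<le> h x" for h
    using that ub by (intro least) auto
  have p_add: "p m (\<lambda>x. h x + k x) = p m h + p m k"
    if h: "h \<in> Cc" "\<And>x. 0 \<le> h x" and k: "k \<in> Cc" "\<And>x. 0 \<le> k x" for h k
  proof (rule antisym)
    show "p m (\<lambda>x. h x + k x) \<le> p m h + p m k"
    proof (rule least)
      fix g assume g: "g \<in> ?I (\<lambda>x. h x + k x)"
      \<comment> \<open>Riesz decomposition: a function between 0 and \<open>h + k\<close> is split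
        into a part below \<open>h\<close> and a rest below \<open>k\<close>.\<close>
      let ?a = "\<lambda>x. min (g x) (h x)" and ?b = "\<lambda>x. g x - min (g x) (h x)"
      have a: "?a \<in> ?I h"
        using g h by auto
      have "0 \<le> ?b x \<and> ?b x \<le> k x" for x
      proof -
        have "g x \<le> h x + k x"
          using g by simp
        then show ?thesis
          using k(2)[of x] by (simp add: min_def)
      qed
      then have b: "?b \<in> ?I k"
        using g h by simp
      have "m g = m ?a + m ?b"
        using madd[of ?a ?b] a b by simp
      then show "m g \<le> p m h + p m k"
        using up[OF h(1) a] up[OF k(1) b] by simp
    qed (use h k in auto)
    have "p m h \<le> p m (\<lambda>x. h x + k x) - p m k"
    proof (rule least)
      fix a assume a: "a \<in> ?I h"
      have "p m k \<le> p m (\<lambda>x. h x + k x) - m a"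
      proof (rule least)
        fix b assume b: "b \<in> ?I k"
        have "(\<lambda>x. a x + b x) \<in> ?I (\<lambda>x. h x + k x)"
          using a b by (auto intro: add_mono)
        then have "m (\<lambda>x. a x + b x) \<le> p m (\<lambda>x. h x + k x)"
          using h k by (intro up) auto
        then show "m b \<le> p m (\<lambda>x. h x + k x) - m a"
          using madd[of a b] a b by simp
      qed (use k in auto)
      then show "m a \<le> p m (\<lambda>x. h x + k x) - p m k"
        by simp
    qed (use h in auto)
    then show "p m h + p m k \<le> p m (\<lambda>x. h x + k x)"
      by simp
  qed
  have rp: "radon_pos m f = p m (\<lambda>x. max (f x) 0) - p m (\<lambda>x. max (- f x) 0)" if "f \<in> Cc" for f
    using that by (simp add: radon_pos_def Let_def p_def)
  have p0: "p m (\<lambda>_. 0) = 0"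
    using p_add[of "\<lambda>_. 0" "\<lambda>_. 0"] by simp
  have rp_nonneg: "radon_pos m f = p m f" if "f \<in> Cc" "\<And>x. 0 \<le> f x" for f
  proof -
    have "(\<lambda>x. max (f x) 0) = f" "(\<lambda>x. max (- f x) 0) = (\<lambda>_. 0)"
      using that(2) by (auto simp: max_def fun_eq_iff order_antisym)
    then show ?thesis
      using rp[OF that(1)] p0 by simp
  qed
  have rp_add: "radon_pos m (\<lambda>x. f x + g x) = radon_pos m f + radon_pos m g"
    if fg: "f \<in> Cc" "g \<in> Cc" for f g
  proof -
    let ?u = "\<lambda>f x. max (f x) (0::real)" and ?v = "\<lambda>f x. max (- f x) (0::real)"
    let ?s = "\<lambda>x. f x + g x"
    \<comment> \<open>The positive and negative parts of a sum are not the sums of the parts. Moving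
      the negative parts to the other side leaves sums of nonnegative functions only, to which
      \<open>p_add\<close> applies.\<close>
    have *: "(\<lambda>x. ?u ?s x + (?v f x + ?v g x)) = (\<lambda>x. ?v ?s x + (?u f x + ?u g x))"
      by (auto simp: max_def fun_eq_iff)
    have Cc: "?u f \<in> Cc" "?v f \<in> Cc" "?u g \<in> Cc" "?v g \<in> Cc" "?u ?s \<in> Cc" "?v ?s \<in> Cc"
      using fg Cc_max0[OF Cc_uminus, of ?s] by auto
    have "p m (?u ?s) + (p m (?v f) + p m (?v g)) = p m (?v ?s) + (p m (?u f) + p m (?u g))"
      using arg_cong[OF *, of "p m"] Cc by (simp add: p_add)
    moreover have "radon_pos m ?s = p m (?u ?s) - p m (?v ?s)"
      using rp[of ?s] fg by simp
    ultimately show ?thesis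
      using rp fg by simp
  qed
  show pos: "pos_functional (radon_pos m)"
    unfolding pos_functional_def using rp_add rp_nonneg p_nonneg by auto
  show pos': "pos_functional (\<lambda>f. m1 f - radon_pos m f)"
    unfolding pos_functional_def using rp_add rp_nonneg p_le pos_functional_add[OF m1] by auto
  show "m g \<le> radon_pos m f"
    if "f \<in> Cc" "g \<in> Cc" "\<And>x. 0 \<le> g x" "\<And>x. g x \<le> f x" for f g
  proof -
    have "0 \<le> f x" for x
      using that(3,4)[of x] by simp
    then show ?thesis
      using that up[of f g] rp_nonneg[of f] by auto
  qed
  \<comment> \<open>The substitution of \<open>h - g\<close> for \<open>g\<close> maps the interval
    between 0 and \<open>h\<close> to itself and exchanges the suprema for \<open>m\<close> and for
    its negative.\<close>
  have neg: "p (\<lambda>f. - m f) h = p m h - m h" if h: "h \<in> Cc" "\<And>x. 0 \<le> h x" for h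
  proof (rule antisym)
    have lower: "- m g \<le> p m h - m h" if "g \<in> ?I h" for g
    proof -
      have "m (\<lambda>x. h x - g x) \<le> p m h"
        using that h by (intro up) auto
      then show ?thesis
        using madd[of "\<lambda>x. h x - g x" g] that h by simp
    qed
    show "p (\<lambda>f. - m f) h \<le> p m h - m h"
      unfolding p_def[of "\<lambda>f. - m f"] using lower h
      by (intro cSUP_least) (auto intro!: exI[of _ "\<lambda>_. 0"])
    have "p m h \<le> p (\<lambda>f. - m f) h + m h"
    proof (rule least)
      fix g assume g: "g \<in> ?I h"
      have "bdd_above ((\<lambda>f. - m f) ` ?I h)"
        using lower by (intro bdd_aboveI2)
      then have "- m (\<lambda>x. h x - g x) \<le> p (\<lambda>f. - m f) h"
        unfolding p_def using g h by (intro cSUP_upper) auto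
      then show "m g \<le> p (\<lambda>f. - m f) h + m h"
        using madd[of "\<lambda>x. h x - g x" g] g h by simp
    qed (use h in auto)
    then show "p m h - m h \<le> p (\<lambda>f. - m f) h"
      by simp
  qed
  show "m1 f - radon_pos m f = m2 f - radon_neg m f" if f: "f \<in> Cc" for f
  proof -
    let ?u = "\<lambda>x. max (f x) (0::real)" and ?v = "\<lambda>x. max (- f x) (0::real)"
    have "radon_neg m f = p (\<lambda>f. - m f) ?u - p (\<lambda>f. - m f) ?v"
      using f by (simp add: radon_neg_def radon_pos_def Let_def p_def)
    also have "\<dots> = radon_pos m f - (m ?u - m ?v)"
      using f by (simp add: neg rp)
    also have "m ?u - m ?v = m f"
    proof -
      have "(\<lambda>x. f x + ?v x) = ?u"
        by (auto simp: max_def)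
      then show ?thesis
        using madd[of f ?v] f by simp
    qed
    finally show ?thesis
      using m f by simp
  qed
qed

text \<open>
  Here \<open>h\<close> is the integral against the part common to \<open>m1\<close> and \<open>m2\<close>, which cancels in \<open>m1 - m2\<close>.
\<close>

lemma radon_integral_decomposition:
  assumes \<psi>: "\<psi> \<in> lsc_class" and m1: "pos_functional m1" and m2: "pos_functional m2"
    and m: "\<And>f. f \<in> Cc \<Longrightarrow> m f = m1 f - m2 f"
  obtains h where "h \<noteq> -\<infinity>"
    "lsc_integral m1 \<psi> = lsc_integral (radon_pos m) \<psi> + h"
    "lsc_integral m2 \<psi> = lsc_integral (radon_neg m) \<psi> + h"
proof
  note dec = radon_pos_decomposition[OF m1 m2 m]
  let ?h = "\<lambda>f. m1 f - radon_pos m f"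
  show "lsc_integral ?h \<psi> \<noteq> -\<infinity>"
    by (rule lsc_integral_neq_MInf[OF \<psi>])
  show "lsc_integral m1 \<psi> = lsc_integral (radon_pos m) \<psi> + lsc_integral ?h \<psi>"
    using dec(1,2) by (subst lsc_integral_add[OF \<psi>, symmetric]) auto
  have n: "pos_functional (radon_neg m)"
    unfolding radon_neg_def using m by (intro radon_pos_decomposition(1)[OF m2 m1]) auto
  have "lsc_integral m2 \<psi> = lsc_integral (\<lambda>f. radon_neg m f + ?h f) \<psi>"
    using dec(3) by (intro lsc_integral_cong) auto
  then show "lsc_integral m2 \<psi> = lsc_integral (radon_neg m) \<psi> + lsc_integral ?h \<psi>"
    using lsc_integral_add[OF \<psi> n dec(2)] by simp
qed

text \<open>The surplus \<open>h\<close> is finite here and cancels, so the integral can be computed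
  from any decomposition with finite integrals, not just from the Jordan decomposition.\<close>

lemma radon_integral_diff:
  assumes \<psi>: "\<psi> \<in> lsc_class" and m1: "pos_functional m1" and m2: "pos_functional m2"
    and m: "\<And>f. f \<in> Cc \<Longrightarrow> m f = m1 f - m2 f"
    and fin: "lsc_integral m1 \<psi> \<noteq> \<infinity>" "lsc_integral m2 \<psi> \<noteq> \<infinity>"
  shows "radon_integral_defined m \<psi>"
    and "radon_integral m \<psi> = lsc_integral m1 \<psi> - lsc_integral m2 \<psi>"
proof -
  obtain h where h: "h \<noteq> -\<infinity>"
    "lsc_integral m1 \<psi> = lsc_integral (radon_pos m) \<psi> + h"
    "lsc_integral m2 \<psi> = lsc_integral (radon_neg m) \<psi> + h"
    using radon_integral_decomposition[OF \<psi> m1 m2 m] by blast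
  have "lsc_integral (radon_pos m) \<psi> \<noteq> -\<infinity>" "lsc_integral (radon_neg m) \<psi> \<noteq> -\<infinity>"
    using lsc_integral_neq_MInf[OF \<psi>] by auto
  with h fin show "radon_integral_defined m \<psi>"
      "radon_integral m \<psi> = lsc_integral m1 \<psi> - lsc_integral m2 \<psi>"
    unfolding radon_integral_defined_def radon_integral_def
    by (cases h; cases "lsc_integral (radon_pos m) \<psi>"; cases "lsc_integral (radon_neg m) \<psi>"; auto)+
qed

text \<open>Finiteness of the second integral makes both the surplus and the integral against the
  negative part finite; that of the whole integral settles the positive part.\<close>

lemma finite_radon_integral_imp_finite:
  assumes \<psi>: "\<psi> \<in> lsc_class" and m1: "pos_functional m1" and m2: "pos_functional m2"
    and m: "\<And>f. f \<in> Cc \<Longrightarrow> m f = m1 f - m2 f"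
    and fin: "radon_integral_defined m \<psi>" "\<bar>radon_integral m \<psi>\<bar> \<noteq> \<infinity>"
      "lsc_integral m2 \<psi> \<noteq> \<infinity>"
  shows "lsc_integral m1 \<psi> \<noteq> \<infinity>"
proof -
  obtain h where h: "h \<noteq> -\<infinity>"
    "lsc_integral m1 \<psi> = lsc_integral (radon_pos m) \<psi> + h"
    "lsc_integral m2 \<psi> = lsc_integral (radon_neg m) \<psi> + h"
    using radon_integral_decomposition[OF \<psi> m1 m2 m] by blast
  have "lsc_integral (radon_pos m) \<psi> \<noteq> -\<infinity>" "lsc_integral (radon_neg m) \<psi> \<noteq> -\<infinity>"
    using lsc_integral_neq_MInf[OF \<psi>] by auto
  with h fin show ?thesis
    unfolding radon_integral_defined_def radon_integral_def
    by (cases h; cases "lsc_integral (radon_pos m) \<psi>"; cases "lsc_integral (radon_neg m) \<psi>"; auto)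
qed

text \<open>If the integral against the negative part were infinite, the whole integral would be
  defined and equal to \<open>-\<infinity>\<close>. Applied to energies, this turns positive
  definiteness into finiteness of mutual energies.\<close>

lemma radon_integral_nonneg_imp_finite:
  assumes \<psi>: "\<psi> \<in> lsc_class" and m1: "pos_functional m1" and m2: "pos_functional m2"
    and m: "\<And>f. f \<in> Cc \<Longrightarrow> m f = m1 f - m2 f"
    and fin: "lsc_integral m1 \<psi> \<noteq> \<infinity>"
    and nonneg: "radon_integral_defined m \<psi> \<Longrightarrow> 0 \<le> radon_integral m \<psi>"
  shows "lsc_integral m2 \<psi> \<noteq> \<infinity>"
proof -
  obtain h where h: "h \<noteq> -\<infinity>"
    "lsc_integral m1 \<psi> = lsc_integral (radon_pos m) \<psi> + h"
    "lsc_integral m2 \<psi> = lsc_integral (radon_neg m) \<psi> + h"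
    using radon_integral_decomposition[OF \<psi> m1 m2 m] by blast
  have "lsc_integral (radon_pos m) \<psi> \<noteq> -\<infinity>" "lsc_integral (radon_neg m) \<psi> \<noteq> -\<infinity>"
    using lsc_integral_neq_MInf[OF \<psi>] by auto
  with h fin nonneg show ?thesis
    unfolding radon_integral_defined_def radon_integral_def
    by (cases h; cases "lsc_integral (radon_pos m) \<psi>"; cases "lsc_integral (radon_neg m) \<psi>"; auto)
qed

section \<open>Radon measures on locally compact spaces\<close>

lemma Hausdorff_space_t2: "Hausdorff_space (euclidean :: 'a::t2_space topology)"
  unfolding Hausdorff_space_def using hausdorff by (fastforce simp: disjnt_def)

lemma urysohn_compact_closed:
  fixes S T :: "'a::t2_space set"
  assumes "locally_compact_space (euclidean :: 'a topology)" "compact S" "closed T" "S \<inter> T = {}"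
  shows "\<exists>u :: 'a \<Rightarrow> real. continuous_on UNIV u \<and> (\<forall>x. 0 \<le> u x \<and> u x \<le> 1) \<and>
    (\<forall>x\<in>S. u x = 1) \<and> (\<forall>x\<in>T. u x = 0)"
proof -
  have "completely_regular_space (euclidean :: 'a topology)"
    using assms(1) Hausdorff_space_t2
    by (intro locally_compact_regular_imp_completely_regular_space disjI1)
  moreover have "compactin euclidean S" "closedin euclidean T" "disjnt T S"
    using assms by (auto simp: disjnt_def)
  ultimately obtain u :: "'a \<Rightarrow> real" where u: "continuous_map euclidean (top_of_set {0..1}) u"
      "u ` T \<subseteq> {0}" "u ` S \<subseteq> {1}"
    using Urysohn_completely_regular_compact_closed[of 0 1 euclidean S T thesis]
    by (metis Urysohn_completely_regular_compact_closed disjnt_sym zero_le_one)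
  then show ?thesis
    by (intro exI[of _ u]) (auto simp: continuous_map_in_subtopology Pi_iff image_subset_iff)
qed

lemma Cc_bump:
  fixes K :: "'a::t2_space set"
  assumes lc: "locally_compact_space (euclidean :: 'a topology)" and "compact K"
  obtains h where "h \<in> Cc" "\<And>x. 0 \<le> h x" "\<And>x. h x \<le> 1" "\<And>x. x \<in> K \<Longrightarrow> h x = 1"
proof -
  have "\<forall>K. compactin (euclidean :: 'a topology) K \<longrightarrow> (\<exists>U L. openin euclidean U \<and> compactin euclidean L
      \<and> closedin euclidean L \<and> K \<subseteq> U \<and> U \<subseteq> L)"
    using lc Hausdorff_space_t2
    by (subst locally_compact_space_compact_closed_compact[symmetric]) auto
  then obtain U L where UL: "open U" "compact L" "closed L" "K \<subseteq> U" "U \<subseteq> L"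
    using assms(2) by auto
  have "closed (- U)" "K \<inter> - U = {}"
    using UL by auto
  then obtain u :: "'a \<Rightarrow> real" where u: "continuous_on UNIV u" "\<And>x. 0 \<le> u x" "\<And>x. u x \<le> 1"
    "\<And>x. x \<in> K \<Longrightarrow> u x = 1" "\<And>x. x \<in> - U \<Longrightarrow> u x = 0"
    using urysohn_compact_closed[OF lc assms(2), of "- U"] by blast
  have "closure {x. u x \<noteq> 0} \<subseteq> L"
    using u(5) UL by (intro closure_minimal) auto
  then have "u \<in> Cc"
    using u(1) compact_closure_subset[OF UL(2)] by (simp add: Cc_def)
  then show ?thesis
    using that u by blast
qed

lemma radon_nonneg_pos_functional: "\<nu> \<in> radon_nonneg E \<Longrightarrow> pos_functional \<nu>"
  by (simp add: radon_nonneg_def radon_def pos_functional_def)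

lemma radon_cmult: "\<nu> \<in> radon \<Longrightarrow> f \<in> Cc \<Longrightarrow> \<nu> (\<lambda>x. c * f x) = c * \<nu> f"
  by (simp add: radon_def)

lemma radon_add: "\<nu> \<in> radon \<Longrightarrow> f \<in> Cc \<Longrightarrow> g \<in> Cc \<Longrightarrow> \<nu> (\<lambda>x. f x + g x) = \<nu> f + \<nu> g"
  by (simp add: radon_def)

lemma radon_outside: "\<nu> \<in> radon \<Longrightarrow> f \<notin> Cc \<Longrightarrow> \<nu> f = 0"
  by (simp add: radon_def)

lemma radon_nonneg_radon: "\<nu> \<in> radon_nonneg E \<Longrightarrow> \<nu> \<in> radon"
  by (simp add: radon_nonneg_def)

lemma radon_nonneg_mono: "\<nu> \<in> radon_nonneg E \<Longrightarrow> E \<subseteq> E' \<Longrightarrow> \<nu> \<in> radon_nonneg E'"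
  unfolding radon_nonneg_def by blast

lemma radon_bounded:
  assumes "\<nu> \<in> radon" "compact K"
  obtains B where "\<And>f c. f \<in> Cc \<Longrightarrow> closure {x. f x \<noteq> 0} \<subseteq> K \<Longrightarrow> (\<And>x. \<bar>f x\<bar> \<le> c) \<Longrightarrow> \<bar>\<nu> f\<bar> \<le> B * c"
proof -
  have "\<exists>B. \<forall>f\<in>Cc. \<forall>c. closure {x. f x \<noteq> 0} \<subseteq> K \<longrightarrow> (\<forall>x. \<bar>f x\<bar> \<le> c) \<longrightarrow> \<bar>\<nu> f\<bar> \<le> B * c"
    using assms by (simp add: radon_def)
  then show ?thesis
    using that by blast
qed

lemma radon_diff:
  assumes "\<mu> \<in> radon" "\<nu> \<in> radon"
  shows "(\<lambda>f. \<mu> f - \<nu> f) \<in> radon"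
  unfolding radon_def
proof (intro CollectI conjI allI impI ballI)
  fix K :: "'a set" assume K: "compact K"
  obtain B where B:
    "\<And>f c. f \<in> Cc \<Longrightarrow> closure {x. f x \<noteq> 0} \<subseteq> K \<Longrightarrow> (\<And>x. \<bar>f x\<bar> \<le> c) \<Longrightarrow> \<bar>\<mu> f\<bar> \<le> B * c"
    using radon_bounded[OF assms(1) K] by blast
  obtain C where C:
    "\<And>f c. f \<in> Cc \<Longrightarrow> closure {x. f x \<noteq> 0} \<subseteq> K \<Longrightarrow> (\<And>x. \<bar>f x\<bar> \<le> c) \<Longrightarrow> \<bar>\<nu> f\<bar> \<le> C * c"
    using radon_bounded[OF assms(2) K] by blast
  have "\<bar>\<mu> f - \<nu> f\<bar> \<le> (B + C) * c"
    if "f \<in> Cc" "closure {x. f x \<noteq> 0} \<subseteq> K" "\<forall>x. \<bar>f x\<bar> \<le> c" for f c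
    using B[of f c] C[of f c] that by (simp add: distrib_right)
  then show "\<exists>B. \<forall>f\<in>Cc. \<forall>c. closure {x. f x \<noteq> 0} \<subseteq> K \<longrightarrow> (\<forall>x. \<bar>f x\<bar> \<le> c) \<longrightarrow> \<bar>\<mu> f - \<nu> f\<bar> \<le> B * c"
    by blast
qed (use assms in \<open>auto simp: radon_def algebra_simps\<close>)

text \<open>Boundedness over a compact \<open>K\<close> comes for free from positivity: a function
  supported in \<open>K\<close> and bounded by \<open>c\<close> lies between \<open>- c * h\<close>
  and \<open>c * h\<close> for a bump \<open>h\<close> equal to 1 on \<open>K\<close>.\<close>

lemma radon_nonnegI:
  fixes \<nu> :: "('a::t2_space \<Rightarrow> real) \<Rightarrow> real"
  assumes lc: "locally_compact_space (euclidean :: 'a topology)"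
    and "\<And>f. f \<notin> Cc \<Longrightarrow> \<nu> f = 0" and pos: "pos_functional \<nu>"
    and cmult: "\<And>c f. f \<in> Cc \<Longrightarrow> \<nu> (\<lambda>x. c * f x) = c * \<nu> f"
    and "\<And>f. f \<in> Cc \<Longrightarrow> closure {x. f x \<noteq> 0} \<inter> E = {} \<Longrightarrow> \<nu> f = 0"
  shows "\<nu> \<in> radon_nonneg E"
proof -
  have "\<exists>B. \<forall>f\<in>Cc. \<forall>c. closure {x. f x \<noteq> 0} \<subseteq> K \<longrightarrow> (\<forall>x. \<bar>f x\<bar> \<le> c) \<longrightarrow> \<bar>\<nu> f\<bar> \<le> B * c"
    if K: "compact K" for K
  proof -
    obtain h where h: "h \<in> Cc" "\<And>x. 0 \<le> h x" "\<And>x. h x \<le> 1" "\<And>x. x \<in> K \<Longrightarrow> h x = 1"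
      using Cc_bump[OF lc K] by blast
    have "\<bar>\<nu> f\<bar> \<le> \<nu> h * c"
      if f: "f \<in> Cc" "closure {x. f x \<noteq> 0} \<subseteq> K" "\<And>x. \<bar>f x\<bar> \<le> c" for f c
    proof -
      \<comment> \<open>Types are inhabited, so the bound at any single point shows that
        \<open>c\<close> is nonnegative.\<close>
      have c: "0 \<le> c"
        using f(3)[of undefined] by linarith
      have le: "\<bar>f x\<bar> \<le> c * h x" for x
      proof (cases "f x = 0")
        case False
        then have "x \<in> K"
          using f(2) closure_subset[of "{x. f x \<noteq> 0}"] by auto
        then show ?thesis
          using h(4) f(3) by simp
      qed (use h(2) c in simp)
      have "\<nu> f \<le> \<nu> (\<lambda>x. c * h x)"
        by (rule pos_functional_mono[OF pos]) (use f h le in \<open>auto simp: abs_le_iff\<close>)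
      moreover have "\<nu> (\<lambda>x. - c * h x) \<le> \<nu> f"
      proof (rule pos_functional_mono[OF pos])
        show "- c * h x \<le> f x" for x
          using le[of x] by (simp add: abs_le_iff)
      qed (use f h Cc_cmult in auto)
      ultimately show ?thesis
        using cmult[OF h(1), of c] cmult[OF h(1), of "- c"] by (simp add: abs_le_iff mult.commute)
    qed
    then show ?thesis
      by blast
  qed
  then show ?thesis
    using assms by (auto simp: radon_nonneg_def radon_def pos_functional_add pos_functional_nonneg)
qed

text \<open>The definition of the support only speaks of functions whose closed support misses
  \<open>E\<close>, while that of \<open>f\<close> may touch \<open>E\<close>. For nonnegative
  \<open>f\<close>, the excess over a level \<open>e > 0\<close> does have closed support off
  \<open>E\<close>, and the truncation at \<open>e\<close> is uniformly small with support in a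
  fixed compact set.\<close>

lemma radon_nonneg_vanish:
  assumes \<nu>: "\<nu> \<in> radon_nonneg E" and f: "f \<in> Cc" and zero: "\<And>x. x \<in> E \<Longrightarrow> f x = 0"
  shows "\<nu> f = 0"
proof -
  have pos: "pos_functional \<nu>"
    using \<nu> by (rule radon_nonneg_pos_functional)
  have nonneg: "\<nu> f = 0"
    if f: "f \<in> Cc" and f0: "\<And>x. 0 \<le> f x" and zero: "\<And>x. x \<in> E \<Longrightarrow> f x = 0" for f
  proof -
    obtain B where B: "\<And>g c. g \<in> Cc \<Longrightarrow> closure {x. g x \<noteq> 0} \<subseteq> closure {x. f x \<noteq> 0} \<Longrightarrow>
        (\<And>x. \<bar>g x\<bar> \<le> c) \<Longrightarrow> \<bar>\<nu> g\<bar> \<le> B * c"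
      using radon_bounded[OF radon_nonneg_radon[OF \<nu>] Cc_compact_support[OF f]] by blast
    have "\<bar>\<nu> f\<bar> \<le> B * e" if e: "0 < e" for e :: real
    proof -
      let ?a = "\<lambda>x. max (f x - e) 0" and ?b = "\<lambda>x. min (f x) e"
      have cf: "continuous_on UNIV f"
        using f by (rule Cc_continuous)
      have a: "?a \<in> Cc"
        by (rule Cc_support[OF _ f]) (use e cf in \<open>auto intro!: continuous_intros continuous_on_max\<close>)
      have b: "?b \<in> Cc"
        by (rule Cc_support[OF _ f]) (use e cf in \<open>auto intro!: continuous_intros continuous_on_min\<close>)
      have "closed {x. e \<le> f x}"
        using cf by (intro closed_Collect_le) auto
      then have "closure {x. ?a x \<noteq> 0} \<subseteq> {x. e \<le> f x}"
        by (intro closure_minimal) auto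
      then have "closure {x. ?a x \<noteq> 0} \<inter> E = {}"
        using zero e by force
      then have "\<nu> ?a = 0"
        using \<nu> a by (simp add: radon_nonneg_def)
      moreover have "(\<lambda>x. ?a x + ?b x) = f"
        by auto
      ultimately have "\<nu> f = \<nu> ?b"
        using pos_functional_add[OF pos a b] by simp
      moreover have "\<bar>\<nu> ?b\<bar> \<le> B * e"
        using f0 e by (intro B b closure_mono) (auto simp: min_def)
      ultimately show ?thesis
        by simp
    qed
    then have "\<bar>\<nu> f\<bar> \<le> d" if "0 < d" for d
    proof -
      \<comment> \<open>Neither the sign of \<open>B\<close> nor \<open>B \<noteq> 0\<close> is
        known; the divisor \<open>\<bar>B\<bar> + 1\<close> is positive and exceeds
        \<open>B\<close>.\<close>
      have "\<bar>\<nu> f\<bar> \<le> B * (1 / (\<bar>B\<bar> + 1) * d)"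
        using that by (intro \<open>\<And>e. 0 < e \<Longrightarrow> \<bar>\<nu> f\<bar> \<le> B * e\<close>) simp
      also have "\<dots> = (B / (\<bar>B\<bar> + 1)) * d"
        by simp
      also have "\<dots> \<le> 1 * d"
        using that by (intro mult_right_mono) auto
      finally show ?thesis
        by simp
    qed
    then show ?thesis
      by (metis abs_le_zero_iff field_le_epsilon add_0)
  qed
  have "\<nu> (\<lambda>x. max (f x) 0) = 0"
    by (rule nonneg) (use f zero in auto)
  moreover have "\<nu> (\<lambda>x. max (- f x) 0) = 0"
    by (rule nonneg) (use f zero Cc_max0[OF Cc_uminus[OF f]] in auto)
  moreover have "(\<lambda>x. max (f x) 0 - max (- f x) 0) = f"
    by auto
  ultimately show ?thesis
    using pos_functional_diff[OF pos, of "\<lambda>x. max (f x) 0" "\<lambda>x. max (- f x) 0"]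
      f Cc_max0[OF Cc_uminus[OF f]] by simp
qed

section \<open>Product measures by iterated integration\<close>

lemma Cc_section:
  fixes F :: "'a::t2_space \<times> 'b::t2_space \<Rightarrow> real"
  assumes "F \<in> Cc"
  shows "(\<lambda>y. F (x, y)) \<in> Cc"
proof -
  let ?K = "closure {z. F z \<noteq> 0}"
  have K: "compact (snd ` ?K)"
    using Cc_compact_support[OF assms] by (intro compact_continuous_image continuous_intros) 
  have "closure {y. F (x, y) \<noteq> 0} \<subseteq> snd ` ?K"
  proof (rule closure_minimal)
    show "{y. F (x, y) \<noteq> 0} \<subseteq> snd ` ?K"
      using closure_subset[of "{z. F z \<noteq> 0}"] by force
  qed (use K compact_imp_closed in auto)
  moreover have "continuous_on UNIV (\<lambda>y. F (x, y))"
    by (rule continuous_on_compose2[OF Cc_continuous[OF assms]]) (auto intro: continuous_intros)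
  ultimately show ?thesis
    using compact_closure_subset[OF K] by (simp add: Cc_def)
qed

text \<open>All sections are supported in one compact set, the second projection of the support of
  \<open>F\<close>, over which \<open>F\<close> is continuous in \<open>x\<close> uniformly in
  \<open>y\<close>. A bump equal to 1 there carries the uniform estimate over to the
  integrals.\<close>

lemma Cc_integral_section:
  fixes F :: "'a::t2_space \<times> 'b::t2_space \<Rightarrow> real"
  assumes lc: "locally_compact_space (euclidean :: 'b topology)"
    and \<nu>: "\<nu> \<in> radon_nonneg E" and F: "F \<in> Cc"
  shows "(\<lambda>x. \<nu> (\<lambda>y. F (x, y))) \<in> Cc"
proof -
  let ?K = "closure {z. F z \<noteq> 0}"
  let ?G = "\<lambda>x. \<nu> (\<lambda>y. F (x, y))"
  have pos: "pos_functional \<nu>"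
    using \<nu> by (rule radon_nonneg_pos_functional)
  have K1: "compact (fst ` ?K)" and K2: "compact (snd ` ?K)"
    using Cc_compact_support[OF F] by (auto intro!: compact_continuous_image continuous_intros)
  have outside: "F (x, y) = 0" if "x \<notin> fst ` ?K \<or> y \<notin> snd ` ?K" for x y
    using that closure_subset[of "{z. F z \<noteq> 0}"] by force
  have "closure {x. ?G x \<noteq> 0} \<subseteq> fst ` ?K"
  proof (rule closure_minimal)
    have "?G x = 0" if "x \<notin> fst ` ?K" for x
      using outside that pos_functional_0[OF pos] by simp
    then show "{x. ?G x \<noteq> 0} \<subseteq> fst ` ?K"
      by blast
  qed (use K1 compact_imp_closed in auto)
  moreover have "continuous_on UNIV ?G"
    unfolding continuous_on_eq_continuous_at[OF open_UNIV] 
  proof (intro ballI)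
    fix x0 :: 'a
    obtain h where h: "h \<in> Cc" "\<And>x. 0 \<le> h x" "\<And>x. h x \<le> 1" "\<And>x. x \<in> snd ` ?K \<Longrightarrow> h x = 1"
      using Cc_bump[OF lc K2] by blast
    have \<nu>h: "0 \<le> \<nu> h"
      using pos_functional_nonneg[OF pos] h by simp
    show "isCont ?G x0"
      unfolding isCont_def tendsto_iff
    proof (intro allI impI)
      fix e :: real assume e: "0 < e"
      \<comment> \<open>The summand 1 keeps the denominator positive and makes
        \<open>d * \<nu> h < e\<close> strict.\<close>
      define d where "d = e / (\<nu> h + 1)"
      have d: "0 < d" "d * \<nu> h < e"
        using e \<nu>h by (auto simp: d_def field_simps)
      have "continuous_on (UNIV \<times> snd ` ?K) F"
        using Cc_continuous[OF F] continuous_on_subset by blast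
      then obtain A where A: "x0 \<in> A" "open A"
          "\<forall>x\<in>A \<inter> UNIV. \<forall>y\<in>snd ` ?K. dist (F (x, y)) (F (x0, y)) \<le> d"
        using continuous_on_prod_compactE[OF _ K2 UNIV_I d(1)] by blast
      have "dist (?G x) (?G x0) < e" if x: "x \<in> A" for x
      proof -
        let ?D = "\<lambda>y. F (x, y) - F (x0, y)"
        have le: "\<bar>?D y\<bar> \<le> d * h y" for y
        proof (cases "y \<in> snd ` ?K")
          case True
          then have "dist (F (x, y)) (F (x0, y)) \<le> d"
            using A(3) x by blast
          then show ?thesis
            using h(4)[OF True] by (simp add: dist_real_def)
        qed (use outside h(2) d in simp)
        have D: "?D \<in> Cc"
          using Cc_section[OF F] by simp
        have "\<nu> ?D \<le> \<nu> (\<lambda>y. d * h y)" 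
          by (rule pos_functional_mono[OF pos D]) (use h le in \<open>auto simp: abs_le_iff\<close>)
        moreover have "- \<nu> ?D \<le> \<nu> (\<lambda>y. d * h y)"
          using pos_functional_mono[OF pos Cc_uminus[OF D], of "\<lambda>y. d * h y"]
            pos_functional_diff[OF pos Cc_0 D] pos_functional_0[OF pos] h le
          by (simp add: abs_le_iff)
        moreover have "\<nu> (\<lambda>y. d * h y) = d * \<nu> h"
          using radon_cmult[OF radon_nonneg_radon[OF \<nu>] h(1)] .
        ultimately have "\<bar>\<nu> ?D\<bar> < e"
          using d by simp
        moreover have "\<nu> ?D = ?G x - ?G x0"
          using Cc_section[OF F] by (intro pos_functional_diff[OF pos])
        ultimately show ?thesis
          by (simp add: dist_real_def)
      qed
      then show "\<forall>\<^sub>F x in at x0. dist (?G x) (?G x0) < e"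
        unfolding eventually_at_topological using A by (intro exI[of _ A]) auto
    qed
  qed
  ultimately show ?thesis
    using compact_closure_subset[OF K1] by (simp add: Cc_def)
qed

lemma radon_product_pos_functional:
  fixes \<mu> :: "('a::t2_space \<Rightarrow> real) \<Rightarrow> real" and \<nu> :: "('b::t2_space \<Rightarrow> real) \<Rightarrow> real"
  assumes lc: "locally_compact_space (euclidean :: 'b topology)"
    and \<mu>: "\<mu> \<in> radon_nonneg UNIV" and \<nu>: "\<nu> \<in> radon_nonneg UNIV"
  shows "pos_functional (radon_product \<mu> \<nu>)"
proof -
  have pos: "pos_functional \<mu>" "pos_functional \<nu>"
    using \<mu> \<nu> radon_nonneg_pos_functional by auto
  show ?thesis
    unfolding pos_functional_def
  proof (intro conjI ballI impI)
    fix F G :: "'a \<times> 'b \<Rightarrow> real" assume FG: "F \<in> Cc" "G \<in> Cc"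
    have "(\<lambda>x. \<nu> (\<lambda>y. F (x, y) + G (x, y))) = (\<lambda>x. \<nu> (\<lambda>y. F (x, y)) + \<nu> (\<lambda>y. G (x, y)))"
      using FG pos_functional_add[OF pos(2)] Cc_section by blast
    then show "radon_product \<mu> \<nu> (\<lambda>x. F x + G x) = radon_product \<mu> \<nu> F + radon_product \<mu> \<nu> G"
      using FG pos_functional_add[OF pos(1) Cc_integral_section[OF lc \<nu> FG(1)] Cc_integral_section[OF lc \<nu> FG(2)]]
      by (simp add: radon_product_def)
  next
    fix F :: "'a \<times> 'b \<Rightarrow> real" assume F: "F \<in> Cc" "\<forall>z. 0 \<le> F z"
    have "0 \<le> \<nu> (\<lambda>y. F (x, y))" for x
      using F Cc_section pos_functional_nonneg[OF pos(2)] by blast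
    then show "0 \<le> radon_product \<mu> \<nu> F"
      using F pos_functional_nonneg[OF pos(1) Cc_integral_section[OF lc \<nu> F(1)]] by (simp add: radon_product_def)
  qed
qed

section \<open>The energy form\<close>

lemma radon_nonneg_add:
  fixes p :: "('a::t2_space \<Rightarrow> real) \<Rightarrow> real"
  assumes "locally_compact_space (euclidean :: 'a topology)" "p \<in> radon_nonneg E" "n \<in> radon_nonneg E"
  shows "(\<lambda>f. p f + n f) \<in> radon_nonneg E"
proof (rule radon_nonnegI[OF assms(1)])
  show "pos_functional (\<lambda>f. p f + n f)"
    using assms by (intro pos_functional_plus radon_nonneg_pos_functional)
qed (use assms in \<open>auto simp: radon_nonneg_def radon_def algebra_simps\<close>)

lemma radon_nonneg_scale:
  fixes p :: "('a::t2_space \<Rightarrow> real) \<Rightarrow> real"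
  assumes "locally_compact_space (euclidean :: 'a topology)" "p \<in> radon_nonneg E" "0 \<le> c"
  shows "(\<lambda>f. c * p f) \<in> radon_nonneg E"
proof (rule radon_nonnegI[OF assms(1)])
  show "pos_functional (\<lambda>f. c * p f)"
    using radon_nonneg_pos_functional[OF assms(2)] assms(3)
    by (simp add: pos_functional_def distrib_left)
qed (use assms in \<open>auto simp: radon_nonneg_def radon_def algebra_simps\<close>)

lemma radon_nonneg_zero:
  assumes "locally_compact_space (euclidean :: 'a::t2_space topology)"
  shows "(\<lambda>_::'a \<Rightarrow> real. 0) \<in> radon_nonneg E"
  by (rule radon_nonnegI[OF assms]) (auto simp: pos_functional_zero)

lemma tendsto_fun_iff:
  fixes x :: "'s \<Rightarrow> 'b \<Rightarrow> 'c::topological_space"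
  shows "(x \<longlongrightarrow> l) F \<longleftrightarrow> (\<forall>i. ((\<lambda>s. x s i) \<longlongrightarrow> l i) F)"
proof -
  have "(x \<longlongrightarrow> l) F \<longleftrightarrow> limitin (product_topology (\<lambda>_. euclidean) UNIV) x l F"
    by (simp add: euclidean_product_topology flip: limitin_canonical_iff)
  also have "\<dots> \<longleftrightarrow> (\<forall>i. ((\<lambda>s. x s i) \<longlongrightarrow> l i) F)"
    by (simp add: limitin_componentwise)
  finally show ?thesis .
qed

locale pd_kernel =
  fixes \<kappa> :: "'a::t2_space \<times> 'a \<Rightarrow> ereal"
  assumes lc: "locally_compact_space (euclidean :: 'a topology)"
    and kernel: "\<kappa> \<in> lsc_class"
    and pd: "positive_definite \<kappa>"
begin

definition mutual :: "(('a \<Rightarrow> real) \<Rightarrow> real) \<Rightarrow> (('a \<Rightarrow> real) \<Rightarrow> real) \<Rightarrow> ereal" where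
  "mutual p n = lsc_integral (radon_product p n) \<kappa>"

definition energy_cone :: "(('a \<Rightarrow> real) \<Rightarrow> real) set" where
  "energy_cone = {p \<in> radon_nonneg UNIV. mutual p p \<noteq> \<infinity>}"

text \<open>By construction this set is closed under sums, differences and halves, which is the
  linear structure that the estimates need.\<close>

definition energy_span :: "(('a \<Rightarrow> real) \<Rightarrow> real) set" where
  "energy_span = {\<nu>. \<exists>p\<in>energy_cone. \<exists>n\<in>energy_cone. \<nu> = (\<lambda>f. p f - n f)}"

text \<open>\<open>real_of_ereal\<close> turns an infinite energy into 0, so the laws of
  \<open>quad\<close> are stated on \<open>energy_span\<close>, where the energy is finite.\<close>

definition quad :: "(('a \<Rightarrow> real) \<Rightarrow> real) \<Rightarrow> real" where
  "quad \<nu> = real_of_ereal (energy \<kappa> \<nu> \<nu>)"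

lemma prod_pos:
  "p \<in> radon_nonneg UNIV \<Longrightarrow> n \<in> radon_nonneg UNIV \<Longrightarrow> pos_functional (radon_product p n)"
  for p n :: "('a \<Rightarrow> real) \<Rightarrow> real"
  by (rule radon_product_pos_functional[OF lc])

lemma mutual_neq_MInf: "mutual p n \<noteq> -\<infinity>"
  unfolding mutual_def by (rule lsc_integral_neq_MInf[OF kernel])

lemma mutual_add_left:
  assumes "p \<in> radon_nonneg UNIV" "p' \<in> radon_nonneg UNIV" "n \<in> radon_nonneg UNIV"
  shows "mutual (\<lambda>f. p f + p' f) n = mutual p n + mutual p' n"
  unfolding mutual_def
  using lsc_integral_add[OF kernel prod_pos[OF assms(1,3)] prod_pos[OF assms(2,3)]]
  by (subst (asm) lsc_integral_cong[of _ "radon_product (\<lambda>f. p f + p' f) n"]) (auto simp: radon_product_def)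

lemma mutual_add_right:
  assumes "p \<in> radon_nonneg UNIV" "n \<in> radon_nonneg UNIV" "n' \<in> radon_nonneg UNIV"
  shows "mutual p (\<lambda>f. n f + n' f) = mutual p n + mutual p n'"
proof -
  have "radon_product p n F + radon_product p n' F = radon_product p (\<lambda>f. n f + n' f) F" if "F \<in> Cc" for F
    using pos_functional_add[OF radon_nonneg_pos_functional[OF assms(1)]
        Cc_integral_section[OF lc assms(2) that] Cc_integral_section[OF lc assms(3) that]] that
    by (simp add: radon_product_def)
  then show ?thesis
    unfolding mutual_def
    using lsc_integral_add[OF kernel prod_pos[OF assms(1,2)] prod_pos[OF assms(1,3)]]
    by (subst (asm) lsc_integral_cong[of _ "radon_product p (\<lambda>f. n f + n' f)"]) auto
qed

lemma mutual_0:
  assumes "p \<in> radon_nonneg UNIV"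
  shows "mutual p (\<lambda>_. 0) = 0" "mutual (\<lambda>_. 0) p = 0"
proof -
  have *: "radon_product p (\<lambda>_::'a \<Rightarrow> real. 0) = (\<lambda>_. 0)"
    using pos_functional_0[OF radon_nonneg_pos_functional[OF assms]]
    by (auto simp: radon_product_def fun_eq_iff)
  show "mutual p (\<lambda>_. 0) = 0"
    unfolding mutual_def * by (rule lsc_integral_zero[OF kernel])
  have *: "radon_product (\<lambda>_::'a \<Rightarrow> real. 0) p = (\<lambda>_. 0)"
    by (auto simp: radon_product_def fun_eq_iff)
  show "mutual (\<lambda>_. 0) p = 0"
    unfolding mutual_def * by (rule lsc_integral_zero[OF kernel])
qed

text \<open>The two brackets are positive functionals whose difference is the product measure. They
  need not be its Jordan decomposition, which is why integrals against arbitrary decompositions were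
  studied.\<close>

lemma prod_diff:
  fixes p n :: "('a \<Rightarrow> real) \<Rightarrow> real"
  assumes "p \<in> radon_nonneg UNIV" "n \<in> radon_nonneg UNIV" "F \<in> Cc"
  shows "radon_product (\<lambda>f. p f - n f) (\<lambda>f. p f - n f) F =
    (radon_product p p F + radon_product n n F) - (radon_product p n F + radon_product n p F)"
  using assms pos_functional_diff[OF radon_nonneg_pos_functional[OF assms(1)]
      Cc_integral_section[OF lc assms(1,3)] Cc_integral_section[OF lc assms(2,3)]]
    pos_functional_diff[OF radon_nonneg_pos_functional[OF assms(2)]
      Cc_integral_section[OF lc assms(1,3)] Cc_integral_section[OF lc assms(2,3)]]
  by (simp add: radon_product_def)

lemma lsc_integral_prod_sum:
  assumes "p \<in> radon_nonneg UNIV" "n \<in> radon_nonneg UNIV" "p' \<in> radon_nonneg UNIV" "n' \<in> radon_nonneg UNIV"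
  shows "lsc_integral (\<lambda>F. radon_product p n F + radon_product p' n' F) \<kappa> = mutual p n + mutual p' n'"
  unfolding mutual_def using assms by (intro lsc_integral_add[OF kernel] prod_pos)

lemma energy_diff:
  assumes p: "p \<in> radon_nonneg UNIV" and n: "n \<in> radon_nonneg UNIV"
    and "mutual p p + mutual n n \<noteq> \<infinity>" "mutual p n + mutual n p \<noteq> \<infinity>"
  shows "energy_defined \<kappa> (\<lambda>f. p f - n f) (\<lambda>f. p f - n f)"
    and "energy \<kappa> (\<lambda>f. p f - n f) (\<lambda>f. p f - n f) =
      (mutual p p + mutual n n) - (mutual p n + mutual n p)"
  using radon_integral_diff[OF kernel pos_functional_plus[OF prod_pos[OF p p] prod_pos[OF n n]]
      pos_functional_plus[OF prod_pos[OF p n] prod_pos[OF n p]] prod_diff[OF p n]] assms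
  unfolding energy_defined_def energy_def by (simp_all add: lsc_integral_prod_sum)

text \<open>This replaces the Cauchy-Schwarz inequality: with finite self-energies and an infinite
  mixed energy, the energy of \<open>p - n\<close> would be defined and equal to
  \<open>-\<infinity>\<close>.\<close>

lemma energy_cone_mutual_finite:
  assumes "p \<in> energy_cone" "n \<in> energy_cone"
  shows "mutual p n \<noteq> \<infinity>"
proof -
  have p: "p \<in> radon_nonneg UNIV" "mutual p p \<noteq> \<infinity>" and n: "n \<in> radon_nonneg UNIV" "mutual n n \<noteq> \<infinity>"
    using assms by (auto simp: energy_cone_def)
  let ?\<nu> = "\<lambda>f. p f - n f"
  have "?\<nu> \<in> radon"
    using p n by (intro radon_diff radon_nonneg_radon)
  then have "radon_integral_defined (radon_product ?\<nu> ?\<nu>) \<kappa> \<Longrightarrow> 0 \<le> radon_integral (radon_product ?\<nu> ?\<nu>) \<kappa>"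
    using pd by (auto simp: positive_definite_def energy_defined_def energy_def)
  then have "mutual p n + mutual n p \<noteq> \<infinity>"
    using radon_integral_nonneg_imp_finite[OF kernel pos_functional_plus[OF prod_pos[OF p(1) p(1)] prod_pos[OF n(1) n(1)]]
      pos_functional_plus[OF prod_pos[OF p(1) n(1)] prod_pos[OF n(1) p(1)]] prod_diff[OF p(1) n(1)]]
      p n by (simp add: lsc_integral_prod_sum)
  then show ?thesis
    using mutual_neq_MInf[of n p] by auto
qed

definition mut :: "(('a \<Rightarrow> real) \<Rightarrow> real) \<Rightarrow> (('a \<Rightarrow> real) \<Rightarrow> real) \<Rightarrow> real" where
  "mut p n = real_of_ereal (mutual p n)"

lemma mutual_eq_mut: "p \<in> energy_cone \<Longrightarrow> n \<in> energy_cone \<Longrightarrow> mutual p n = ereal (mut p n)"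
  using energy_cone_mutual_finite[of p n] mutual_neq_MInf[of p n]
  unfolding mut_def by (cases "mutual p n") auto

lemma energy_cone_radon: "p \<in> energy_cone \<Longrightarrow> p \<in> radon_nonneg UNIV"
  by (simp add: energy_cone_def)

lemma energy_cone_add:
  assumes "p \<in> energy_cone" "n \<in> energy_cone"
  shows "(\<lambda>f. p f + n f) \<in> energy_cone"
proof -
  let ?s = "\<lambda>f. p f + n f"
  have M: "p \<in> radon_nonneg UNIV" "n \<in> radon_nonneg UNIV"
    using assms energy_cone_radon by auto
  then have s: "?s \<in> radon_nonneg UNIV"
    by (rule radon_nonneg_add[OF lc])
  have "mutual ?s ?s = (mutual p p + mutual p n) + (mutual n p + mutual n n)"
    using mutual_add_left[OF M s] mutual_add_right[OF M(1) M] mutual_add_right[OF M(2) M] by simp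
  then have "mutual ?s ?s \<noteq> \<infinity>"
    using assms by (simp add: mutual_eq_mut)
  then show ?thesis
    using s by (simp add: energy_cone_def)
qed

lemma mut_add:
  assumes "p \<in> energy_cone" "p' \<in> energy_cone" "n \<in> energy_cone"
  shows "mut (\<lambda>f. p f + p' f) n = mut p n + mut p' n" "mut n (\<lambda>f. p f + p' f) = mut n p + mut n p'"
proof -
  have "ereal (mut (\<lambda>f. p f + p' f) n) = ereal (mut p n + mut p' n)"
    using mutual_add_left[of p p' n] assms energy_cone_add[OF assms(1,2)]
    by (simp add: energy_cone_radon mutual_eq_mut)
  then show "mut (\<lambda>f. p f + p' f) n = mut p n + mut p' n"
    by simp
  have "ereal (mut n (\<lambda>f. p f + p' f)) = ereal (mut n p + mut n p')"
    using mutual_add_right[of n p p'] assms energy_cone_add[OF assms(1,2)]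
    by (simp add: energy_cone_radon mutual_eq_mut)
  then show "mut n (\<lambda>f. p f + p' f) = mut n p + mut n p'"
    by simp
qed

lemma energy_cone_zero: "(\<lambda>_. 0) \<in> energy_cone"
  using radon_nonneg_zero[OF lc] mutual_0 by (simp add: energy_cone_def)

lemma energy_span_diff_cone: "p \<in> energy_cone \<Longrightarrow> n \<in> energy_cone \<Longrightarrow> (\<lambda>f. p f - n f) \<in> energy_span"
  unfolding energy_span_def by blast

lemma energy_cone_subset_span: "p \<in> energy_cone \<Longrightarrow> p \<in> energy_span"
  using energy_span_diff_cone[OF _ energy_cone_zero] by simp

lemma quad_diff_cone:
  assumes "p \<in> energy_cone" "n \<in> energy_cone"
  shows "quad (\<lambda>f. p f - n f) = mut p p + mut n n - mut p n - mut n p"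
    and "(\<lambda>f. p f - n f) \<in> finite_energy \<kappa>"
proof -
  have en: "energy_defined \<kappa> (\<lambda>f. p f - n f) (\<lambda>f. p f - n f)"
    "energy \<kappa> (\<lambda>f. p f - n f) (\<lambda>f. p f - n f) = ereal (mut p p + mut n n - mut p n - mut n p)"
    using energy_diff[of p n] assms by (auto simp: mutual_eq_mut energy_cone_radon)
  then show "quad (\<lambda>f. p f - n f) = mut p p + mut n n - mut p n - mut n p"
    by (simp add: quad_def)
  have "(\<lambda>f. p f - n f) \<in> radon"
    using assms by (intro radon_diff) (auto dest!: energy_cone_radon radon_nonneg_radon)
  then show "(\<lambda>f. p f - n f) \<in> finite_energy \<kappa>"
    using en by (simp add: finite_energy_def)
qed

lemma energy_span_finite_energy: "\<nu> \<in> energy_span \<Longrightarrow> \<nu> \<in> finite_energy \<kappa>"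
  using quad_diff_cone(2) by (auto simp: energy_span_def)

lemma quad_nonneg: "\<nu> \<in> energy_span \<Longrightarrow> 0 \<le> quad \<nu>"
  using energy_span_finite_energy[of \<nu>] pd
  by (auto simp: quad_def positive_definite_def finite_energy_def intro!: real_of_ereal_pos)

section \<open>The parallelogram law and its consequences\<close>

text \<open>Regrouping writes both \<open>u + v\<close> and \<open>u - v\<close> as differences of
  elements of the cone; expanding by biadditivity of \<open>mut\<close> then cancels the cross
  terms.\<close>

lemma energy_span_add_diff:
  assumes "u \<in> energy_span" "v \<in> energy_span"
  shows "(\<lambda>f. u f + v f) \<in> energy_span" "(\<lambda>f. u f - v f) \<in> energy_span"
    and "quad (\<lambda>f. u f + v f) + quad (\<lambda>f. u f - v f) = 2 * quad u + 2 * quad v"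
proof -
  obtain p n where u: "p \<in> energy_cone" "n \<in> energy_cone" "u = (\<lambda>f. p f - n f)"
    using assms(1) by (auto simp: energy_span_def)
  obtain p' n' where v: "p' \<in> energy_cone" "n' \<in> energy_cone" "v = (\<lambda>f. p' f - n' f)"
    using assms(2) by (auto simp: energy_span_def)
  note cone = u(1,2) v(1,2)
  have plus: "(\<lambda>f. u f + v f) = (\<lambda>f. (p f + p' f) - (n f + n' f))"
    using u v by auto
  have minus: "(\<lambda>f. u f - v f) = (\<lambda>f. (p f + n' f) - (n f + p' f))"
    using u v by auto
  show "(\<lambda>f. u f + v f) \<in> energy_span" "(\<lambda>f. u f - v f) \<in> energy_span"
    unfolding plus minus by (intro energy_span_diff_cone energy_cone_add cone)+
  have a: "quad (\<lambda>f. u f + v f) = mut (\<lambda>f. p f + p' f) (\<lambda>f. p f + p' f) + mut (\<lambda>f. n f + n' f) (\<lambda>f. n f + n' f)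
      - mut (\<lambda>f. p f + p' f) (\<lambda>f. n f + n' f) - mut (\<lambda>f. n f + n' f) (\<lambda>f. p f + p' f)"
    unfolding plus using cone by (intro quad_diff_cone(1) energy_cone_add)
  have b: "quad (\<lambda>f. u f - v f) = mut (\<lambda>f. p f + n' f) (\<lambda>f. p f + n' f) + mut (\<lambda>f. n f + p' f) (\<lambda>f. n f + p' f)
      - mut (\<lambda>f. p f + n' f) (\<lambda>f. n f + p' f) - mut (\<lambda>f. n f + p' f) (\<lambda>f. p f + n' f)"
    unfolding minus using cone by (intro quad_diff_cone(1) energy_cone_add)
  show "quad (\<lambda>f. u f + v f) + quad (\<lambda>f. u f - v f) = 2 * quad u + 2 * quad v"
    using a b quad_diff_cone(1)[OF u(1,2), folded u(3)] quad_diff_cone(1)[OF v(1,2), folded v(3)] cone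
    by (simp add: mut_add energy_cone_add)
qed

text \<open>The parallelogram laws for \<open>(u, v)\<close> and for \<open>(v, u)\<close> share the
  right-hand side and the energy of the sum.\<close>

lemma quad_minus_commute:
  assumes "u \<in> energy_span" "v \<in> energy_span"
  shows "quad (\<lambda>f. u f - v f) = quad (\<lambda>f. v f - u f)"
  using energy_span_add_diff(3)[OF assms] energy_span_add_diff(3)[OF assms(2,1)]
  by (simp add: add.commute)

lemma quad_add_le:
  assumes "u \<in> energy_span" "v \<in> energy_span"
  shows "quad (\<lambda>f. u f + v f) \<le> 2 * quad u + 2 * quad v"
  using energy_span_add_diff[OF assms] quad_nonneg[of "\<lambda>f. u f - v f"] by linarith

lemma quad_diff_le:
  assumes "u \<in> energy_span" "v \<in> energy_span"
  shows "quad (\<lambda>f. u f - v f) \<le> 2 * quad u + 2 * quad v"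
  using energy_span_add_diff[OF assms] quad_nonneg[of "\<lambda>f. u f + v f"] by linarith

text \<open>A triangle inequality for squared norms, from the parallelogram law with a nonnegative
  term dropped. The factor 2 does no harm in limits and is the source of the constants in the
  epsilon estimates below.\<close>

lemma quad_triangle:
  assumes "u \<in> energy_span" "v \<in> energy_span" "w \<in> energy_span"
  shows "quad (\<lambda>f. u f - w f) \<le> 2 * quad (\<lambda>f. u f - v f) + 2 * quad (\<lambda>f. v f - w f)"
  using quad_add_le[OF energy_span_add_diff(2)[OF assms(1,2)] energy_span_add_diff(2)[OF assms(2,3)]]
  by simp

text \<open>By additivity in each argument the energy of \<open>p\<close> is the fourfold sum of
  that of its half, and an infinite summand would make the sum infinite.\<close>

lemma energy_cone_half:
  assumes "p \<in> energy_cone"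
  shows "(\<lambda>f. p f / 2) \<in> energy_cone"
proof -
  let ?h = "\<lambda>f. p f / 2"
  have h: "?h \<in> radon_nonneg UNIV"
    using radon_nonneg_scale[OF lc energy_cone_radon[OF assms], of "1/2"] by simp
  have "mutual p p = mutual ?h p + mutual ?h p"
    using mutual_add_left[OF h h energy_cone_radon[OF assms]] by simp
  moreover have "mutual ?h p = mutual ?h ?h + mutual ?h ?h"
    using mutual_add_right[OF h h h] by simp
  ultimately have "mutual ?h ?h \<noteq> \<infinity>"
    using assms by (auto simp: energy_cone_def)
  then show ?thesis
    using h by (simp add: energy_cone_def)
qed

lemma energy_span_half:
  assumes "u \<in> energy_span"
  shows "(\<lambda>f. u f / 2) \<in> energy_span" "quad (\<lambda>f. u f / 2) = quad u / 4"
proof -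
  obtain p n where u: "p \<in> energy_cone" "n \<in> energy_cone" "u = (\<lambda>f. p f - n f)"
    using assms(1) by (auto simp: energy_span_def)
  then show span: "(\<lambda>f. u f / 2) \<in> energy_span"
    using energy_span_diff_cone[OF energy_cone_half energy_cone_half, of p n] by (simp add: diff_divide_distrib)
  have "quad (\<lambda>_. 0) = 0"
    using energy_span_add_diff(3)[OF energy_cone_subset_span energy_cone_subset_span, OF energy_cone_zero energy_cone_zero]
    by simp
  then show "quad (\<lambda>f. u f / 2) = quad u / 4"
    using energy_span_add_diff(3)[OF span span] by simp
qed

text \<open>Quantitative convexity: two elements of almost minimal energy must be close as soon as
  their midpoint cannot have much smaller energy.\<close>

lemma quad_midpoint:
  assumes "u \<in> energy_span" "v \<in> energy_span"
  shows "4 * quad (\<lambda>f. (u f + v f) / 2) = 2 * quad u + 2 * quad v - quad (\<lambda>f. u f - v f)"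
  using energy_span_half(2)[OF energy_span_add_diff(1)[OF assms]] energy_span_add_diff(3)[OF assms]
  by (simp add: field_simps)

lemma energy_dist_quad: "energy_dist \<kappa> u v = sqrt (quad (\<lambda>f. u f - v f))"
  by (simp add: energy_dist_def energy_norm_def quad_def)

text \<open>A converse to \<open>quad_diff_cone\<close>: a finite energy and finite mixed terms
  leave a finite sum of the self-energies, neither of which can be
  \<open>-\<infinity>\<close>.\<close>

lemma finite_energy_imp_cone:
  assumes p: "p \<in> radon_nonneg UNIV" and n: "n \<in> radon_nonneg UNIV"
    and fin: "(\<lambda>f. p f - n f) \<in> finite_energy \<kappa>" and mixed: "mutual p n + mutual n p \<noteq> \<infinity>"
  shows "p \<in> energy_cone" "n \<in> energy_cone"
proof -
  have "mutual p p + mutual n n \<noteq> \<infinity>"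
    using finite_radon_integral_imp_finite[OF kernel pos_functional_plus[OF prod_pos[OF p p] prod_pos[OF n n]]
      pos_functional_plus[OF prod_pos[OF p n] prod_pos[OF n p]] prod_diff[OF p n]] fin mixed p n
    by (simp add: lsc_integral_prod_sum finite_energy_def energy_defined_def energy_def)
  then show "p \<in> energy_cone" "n \<in> energy_cone"
    using p n mutual_neq_MInf[of p p] mutual_neq_MInf[of n n] by (auto simp: energy_cone_def)
qed

text \<open>This matches the measures that the definition of \<open>consistent\<close> speaks of
  with the cone on which the form is finite.\<close>

lemma finite_energy_Int_nonneg: "finite_energy \<kappa> \<inter> radon_nonneg UNIV = energy_cone"
proof (intro antisym subsetI)
  fix p assume "p \<in> finite_energy \<kappa> \<inter> radon_nonneg UNIV"
  then show "p \<in> energy_cone"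
    using finite_energy_imp_cone(1)[OF _ radon_nonneg_zero[OF lc], of p] mutual_0[of p] by simp
next
  fix p assume "p \<in> energy_cone"
  then show "p \<in> finite_energy \<kappa> \<inter> radon_nonneg UNIV"
    using energy_span_finite_energy energy_cone_subset_span energy_cone_radon by blast
qed

end

text \<open>
  The sets \<open>Z (\<Phi>, e)\<close> below replace the convex hulls of the tails of the net: they are closed under
  midpoints, which is all that the minimal energy argument needs.
\<close>

lemma (in pd_kernel) cluster_point_strong_limit:
  assumes cons: "consistent \<kappa>" and F: "F \<noteq> bot"
    and bdd: "\<forall>\<^sub>F s in F. p s \<in> energy_cone \<and> n s \<in> energy_cone \<and> quad (p s) \<le> C"
    and cauchy: "\<And>e. 0 < e \<Longrightarrow>
      \<forall>\<^sub>F (s, t) in F \<times>\<^sub>F F. quad (\<lambda>f. (p s f - n s f) - (p t f - n t f)) < e"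
    and conv: "(p \<longlongrightarrow> p0) F" "(n \<longlongrightarrow> n0) F"
    and nonneg: "p0 \<in> radon_nonneg UNIV" "n0 \<in> radon_nonneg UNIV"
  shows "p0 \<in> energy_cone" "n0 \<in> energy_cone"
    and "((\<lambda>s. quad (\<lambda>f. (p s f - n s f) - (p0 f - n0 f))) \<longlongrightarrow> 0) F"
proof -
  define u where "u s = (\<lambda>f. p s f - n s f)" for s
  define dif where "dif a b = (\<lambda>f. a f - b f)" for a b :: "('a \<Rightarrow> real) \<Rightarrow> real"
  \<comment> \<open>An index is a finite set of test functions with a tolerance, which serves both
    for the vague neighbourhood of \<open>(p0, n0)\<close> and for the strong distance to the tail
    of the net.\<close>
  define I :: "(('a \<Rightarrow> real) set \<times> real) set" where "I = {i. finite (fst i) \<and> 0 < snd i}"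
  define Z where "Z i = {(a, b). a \<in> energy_cone \<and> b \<in> energy_cone \<and>
      (\<forall>f\<in>fst i. \<bar>a f - p0 f\<bar> \<le> snd i \<and> \<bar>b f - n0 f\<bar> \<le> snd i) \<and>
      (\<forall>\<^sub>F s in F. u s \<in> energy_span \<and> quad (dif (dif a b) (u s)) \<le> snd i)}" for i
  have cs: "a \<in> energy_span" if "a \<in> energy_cone" for a
    using that by (rule energy_cone_subset_span)
  have ds: "dif a b \<in> energy_span" if "a \<in> energy_span" "b \<in> energy_span" for a b
    unfolding dif_def using that by (rule energy_span_add_diff)
  have tri: "quad (dif a c) \<le> 2 * quad (dif a b) + 2 * quad (dif b c)"
    if "a \<in> energy_span" "b \<in> energy_span" "c \<in> energy_span" for a b c
    unfolding dif_def using that by (rule quad_triangle)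
  have com: "quad (dif a b) = quad (dif b a)" if "a \<in> energy_span" "b \<in> energy_span" for a b
    unfolding dif_def using that by (rule quad_minus_commute)
  have us: "\<forall>\<^sub>F s in F. u s \<in> energy_span"
    using bdd by (rule eventually_mono) (auto simp: u_def intro: energy_span_diff_cone)

  \<comment> \<open>Late pairs of the net itself belong to \<open>Z i\<close>. Their energy bound
    gives an upper bound for the minimal energy that does not depend on \<open>i\<close>.\<close>
  have nonempty: "\<exists>z\<in>Z i. quad (fst z) \<le> C" if i: "i \<in> I" for i
  proof -
    have fin: "finite (fst i)" and e: "0 < snd i"
      using i by (auto simp: I_def)
    have near: "\<forall>\<^sub>F s in F. \<forall>f\<in>fst i. \<bar>p s f - p0 f\<bar> \<le> snd i \<and> \<bar>n s f - n0 f\<bar> \<le> snd i"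
    proof (intro eventually_ball_finite fin ballI)
      fix f assume "f \<in> fst i"
      have "((\<lambda>s. p s f) \<longlongrightarrow> p0 f) F" "((\<lambda>s. n s f) \<longlongrightarrow> n0 f) F"
        using conv by (simp_all add: tendsto_fun_iff)
      then have "\<forall>\<^sub>F s in F. dist (p s f) (p0 f) < snd i" "\<forall>\<^sub>F s in F. dist (n s f) (n0 f) < snd i"
        using e by (auto dest: tendstoD)
      then show "\<forall>\<^sub>F s in F. \<bar>p s f - p0 f\<bar> \<le> snd i \<and> \<bar>n s f - n0 f\<bar> \<le> snd i"
        by eventually_elim (simp add: dist_real_def)
    qed
    obtain Pf Pg where P: "eventually Pf F" "eventually Pg F"
        "\<And>s t. Pf s \<Longrightarrow> Pg t \<Longrightarrow> quad (dif (u s) (u t)) < snd i"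
      using cauchy[OF e] unfolding eventually_prod_filter u_def dif_def by auto
    have "\<forall>\<^sub>F s in F. (p s, n s) \<in> Z i \<and> quad (p s) \<le> C"
      using near P(1) bdd
    proof eventually_elim
      case (elim s)
      have "\<forall>\<^sub>F t in F. u t \<in> energy_span \<and> quad (dif (dif (p s) (n s)) (u t)) \<le> snd i"
        using us P(2)
      proof eventually_elim
        case (elim t)
        show ?case
          using elim P(3)[OF \<open>Pf s\<close> elim(2)] by (simp add: u_def dif_def)
      qed
      then show ?case
        using elim by (simp add: Z_def)
    qed
    then show ?thesis
      using eventually_happens'[OF F] by force
  qed

  have mid: "((\<lambda>f. (a f + a' f) / 2), (\<lambda>f. (b f + b' f) / 2)) \<in> Z i"
    if z: "(a, b) \<in> Z i" "(a', b') \<in> Z i" for a b a' b' i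
  proof -
    have cone: "a \<in> energy_cone" "b \<in> energy_cone" "a' \<in> energy_cone" "b' \<in> energy_cone"
      using z by (auto simp: Z_def)
    have halves: "(\<lambda>f. (a f + a' f) / 2) \<in> energy_cone" "(\<lambda>f. (b f + b' f) / 2) \<in> energy_cone"
      using cone by (auto intro!: energy_cone_half energy_cone_add)
    have "\<bar>(a f + a' f) / 2 - p0 f\<bar> \<le> snd i" "\<bar>(b f + b' f) / 2 - n0 f\<bar> \<le> snd i" if "f \<in> fst i" for f
    proof -
      have "\<bar>a f - p0 f\<bar> \<le> snd i" "\<bar>a' f - p0 f\<bar> \<le> snd i" "\<bar>b f - n0 f\<bar> \<le> snd i" "\<bar>b' f - n0 f\<bar> \<le> snd i"
        using z that by (auto simp: Z_def)
      then show "\<bar>(a f + a' f) / 2 - p0 f\<bar> \<le> snd i" "\<bar>(b f + b' f) / 2 - n0 f\<bar> \<le> snd i"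
        by (simp_all add: abs_le_iff field_simps)
    qed
    moreover have "\<forall>\<^sub>F s in F. u s \<in> energy_span \<and>
        quad (dif (dif (\<lambda>f. (a f + a' f) / 2) (\<lambda>f. (b f + b' f) / 2)) (u s)) \<le> snd i"
    proof -
      have "\<forall>\<^sub>F s in F. u s \<in> energy_span \<and> quad (dif (dif a b) (u s)) \<le> snd i"
          "\<forall>\<^sub>F s in F. u s \<in> energy_span \<and> quad (dif (dif a' b') (u s)) \<le> snd i"
        using z by (auto simp: Z_def)
      then show ?thesis
      proof eventually_elim
        case (elim s)
        let ?v = "dif (dif a b) (u s)" and ?v' = "dif (dif a' b') (u s)"
        have v: "?v \<in> energy_span" "?v' \<in> energy_span"
          using elim cone by (auto intro: ds cs)
        \<comment> \<open>Subtracting \<open>u s\<close> commutes with taking midpoints, so the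
          strong condition is convex by the midpoint identity.\<close>
        have "dif (dif (\<lambda>f. (a f + a' f) / 2) (\<lambda>f. (b f + b' f) / 2)) (u s) = (\<lambda>f. (?v f + ?v' f) / 2)"
          by (auto simp: dif_def field_simps)
        then show ?case
          using quad_midpoint[OF v] quad_nonneg[OF energy_span_add_diff(2)[OF v]]
            elim(1) elim[THEN conjunct2] by simp
      qed
    qed
    ultimately show ?thesis
      using halves by (simp add: Z_def)
  qed

  have Z_quad: "0 \<le> quad (fst z)" if "z \<in> Z i" for z i
    using that by (auto simp: Z_def intro!: quad_nonneg cs)
  define d where "d i = (INF z\<in>Z i. quad (fst z))" for i
  have d_le: "d i \<le> quad (fst z)" if "z \<in> Z i" for z i
    unfolding d_def using that Z_quad by (intro cINF_lower bdd_belowI2[of _ 0])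
  have d_C: "d i \<le> C" if "i \<in> I" for i
    using nonempty[OF that] d_le by (meson order_trans)
  \<comment> \<open>The infima increase as the neighbourhoods shrink, so \<open>D\<close> is their
    limit; it is finite because \<open>C\<close> bounds them all.\<close>
  define D where "D = (SUP i\<in>I. d i)"
  have I_ne: "({}, 1) \<in> I"
    by (simp add: I_def)
  have d_D: "d i \<le> D" if "i \<in> I" for i
    unfolding D_def using that d_C by (intro cSUP_upper bdd_aboveI2)
  \<comment> \<open>Energy is compared with the common value \<open>D\<close> and not with
    \<open>d i\<close>: this makes the sets decrease when the index is refined. They are nonempty
    since \<open>d i \<le> D\<close> and the tolerance is positive.\<close>
  define K where "K i = {z \<in> Z i. quad (fst z) \<le> D + snd i}" for i
  have K_ne: "K i \<noteq> {}" if i: "i \<in> I" for i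
  proof (rule ccontr)
    assume "\<not> K i \<noteq> {}"
    then have "D + snd i \<le> d i"
      unfolding d_def K_def using nonempty[OF i] by (intro cINF_greatest) force+
    then show False
      using d_D[OF i] i by (simp add: I_def)
  qed
  have K_anti: "K j \<subseteq> K i" if "fst i \<subseteq> fst j" "snd j \<le> snd i" for i j
  proof
    fix z assume z: "z \<in> K j"
    have "\<forall>\<^sub>F s in F. u s \<in> energy_span \<and> quad (dif (dif (fst z) (snd z)) (u s)) \<le> snd j"
      using z by (auto simp: K_def Z_def)
    then have "\<forall>\<^sub>F s in F. u s \<in> energy_span \<and> quad (dif (dif (fst z) (snd z)) (u s)) \<le> snd i"
      by (rule eventually_mono) (use that in auto)
    then show "z \<in> K i"
      using z that by (fastforce simp: K_def Z_def)
  qed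
  define G where "G = (INF i\<in>I. principal (K i))"
  have ev_G: "eventually P G \<longleftrightarrow> (\<exists>i\<in>I. \<forall>z\<in>K i. P z)" for P
    unfolding G_def
  proof (subst eventually_INF_base)
    fix i j assume ij: "i \<in> I" "j \<in> I"
    then show "\<exists>k\<in>I. principal (K k) \<le> inf (principal (K i)) (principal (K j))"
      using K_anti by (intro bexI[of _ "(fst i \<union> fst j, min (snd i) (snd j))"]) (auto simp: I_def)
  qed (use I_ne in \<open>auto simp: eventually_principal\<close>)
  have G: "G \<noteq> bot"
    unfolding trivial_limit_def ev_G using K_ne by blast

  have small: "\<exists>i\<in>I. \<forall>z\<in>K i. \<forall>z'\<in>K i. quad (dif (fst z) (fst z')) < e \<and> quad (dif (snd z) (snd z')) < e"
    if e: "0 < e" for e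
  proof -
    \<comment> \<open>First components will differ by less than \<open>8 * \<epsilon>\<close> and
      second ones by less than
      \<open>2 * 8 * \<epsilon> + 2 * 4 * \<epsilon> = 24 * \<epsilon>\<close>; 26 leaves
      room.\<close>
    define \<epsilon> where "\<epsilon> = e / 26"
    have \<epsilon>: "0 < \<epsilon>"
      using e by (simp add: \<epsilon>_def)
    have "D - \<epsilon> < D"
      using \<epsilon> by simp
    then obtain i where i: "i \<in> I" "D - \<epsilon> < d i"
      unfolding D_def using less_cSUP_iff[of I d] I_ne d_C by (metis bdd_aboveI2 empty_iff)
    let ?j = "(fst i, min (snd i) \<epsilon>)"
    have j: "?j \<in> I"
      using i \<epsilon> by (auto simp: I_def)
    have "quad (dif (fst z) (fst z')) < e \<and> quad (dif (snd z) (snd z')) < e" if z: "z \<in> K ?j" "z' \<in> K ?j" for z z'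
    proof -
      obtain a b a' b' where ab: "z = (a, b)" "z' = (a', b')"
        by (cases z, cases z')
      have zi: "(a, b) \<in> Z i" "(a', b') \<in> Z i"
        using z ab K_anti[of i ?j] by (auto simp: K_def)
      have cone: "a \<in> energy_cone" "b \<in> energy_cone" "a' \<in> energy_cone" "b' \<in> energy_cone"
        using zi by (auto simp: Z_def)
      note span = cone[THEN cs]
      \<comment> \<open>The midpoint lies in \<open>Z i\<close>, whose infimum exceeds
        \<open>D - \<epsilon>\<close>. Against the upper bound \<open>D + \<epsilon>\<close> for
        \<open>a\<close> and \<open>a'\<close> this leaves \<open>8 * \<epsilon>\<close> for their
        difference.\<close>
      have "D - \<epsilon> < quad (\<lambda>f. (a f + a' f) / 2)"
        using d_le[OF mid[OF zi]] i(2) by simp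
      moreover have "quad a \<le> D + \<epsilon>" "quad a' \<le> D + \<epsilon>"
        using z ab by (auto simp: K_def)
      ultimately have a: "quad (dif a a') < 8 * \<epsilon>"
        using quad_midpoint[OF span(1,3)] by (simp add: dif_def)
      have "\<forall>\<^sub>F s in F. u s \<in> energy_span \<and> quad (dif (dif a b) (u s)) \<le> \<epsilon>"
          "\<forall>\<^sub>F s in F. u s \<in> energy_span \<and> quad (dif (dif a' b') (u s)) \<le> \<epsilon>"
        using z unfolding ab K_def Z_def by (auto elim: eventually_mono)
      then have "\<forall>\<^sub>F s in F. quad (dif (dif a b) (dif a' b')) \<le> 4 * \<epsilon>"
      proof eventually_elim
        case (elim s)
        then show ?case
          using tri[of "dif a b" "u s" "dif a' b'"] com[of "u s" "dif a' b'"] span ds by auto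
      qed
      then have ab': "quad (dif (dif a b) (dif a' b')) \<le> 4 * \<epsilon>"
        using eventually_happens'[OF F] by force
      \<comment> \<open>The second components carry no minimality of their own; they are controlled
        through the first components and the differences.\<close>
      have "dif b b' = (\<lambda>f. dif a a' f - dif (dif a b) (dif a' b') f)"
        by (auto simp: dif_def)
      then have "quad (dif b b') < 24 * \<epsilon>"
        using quad_diff_le[OF ds[OF span(1,3)] ds[OF ds[OF span(1,2)] ds[OF span(3,4)]]] a ab' by simp
      then show ?thesis
        using a \<epsilon> by (simp add: ab \<epsilon>_def)
    qed
    then show ?thesis
      using j by blast
  qed

  \<comment> \<open>Consistency is applied to the image of \<open>G\<close> under a map
    \<open>\<pi>\<close>, used below for each of the two projections; \<open>x0\<close> is the vague
    limit of that image.\<close>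
  have apply_consistent: "x0 \<in> energy_cone \<and> ((\<lambda>z. quad (dif (\<pi> z) x0)) \<longlongrightarrow> 0) G"
    if \<pi>: "\<And>i z. z \<in> K i \<Longrightarrow> \<pi> z \<in> energy_cone"
      and cau: "\<And>e. 0 < e \<Longrightarrow> \<exists>i\<in>I. \<forall>z\<in>K i. \<forall>z'\<in>K i. quad (dif (\<pi> z) (\<pi> z')) < e"
      and lim: "\<And>f e. 0 < e \<Longrightarrow> \<exists>i\<in>I. \<forall>z\<in>K i. \<bar>\<pi> z f - x0 f\<bar> \<le> e"
      and x0: "x0 \<in> radon_nonneg UNIV"
    for \<pi> :: "(('a \<Rightarrow> real) \<Rightarrow> real) \<times> (('a \<Rightarrow> real) \<Rightarrow> real) \<Rightarrow> ('a \<Rightarrow> real) \<Rightarrow> real" and x0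
  proof -
    let ?H = "filtermap \<pi> G"
    have H: "?H \<noteq> bot"
      using G by (simp add: filtermap_bot_iff)
    have "?H \<le> principal (finite_energy \<kappa> \<inter> radon_nonneg UNIV)"
      unfolding finite_energy_Int_nonneg le_principal eventually_filtermap ev_G
      using \<pi> I_ne by blast
    moreover have "cauchy_along (energy_dist \<kappa>) (\<lambda>\<nu>. \<nu>) ?H"
      unfolding cauchy_along_def
    proof (intro allI impI)
      fix e :: real assume e: "0 < e"
      then obtain i where i: "i \<in> I" "\<forall>z\<in>K i. \<forall>z'\<in>K i. quad (dif (\<pi> z) (\<pi> z')) < e\<^sup>2"
        using cau[of "e\<^sup>2"] by auto
      have "energy_dist \<kappa> a b < e" if "a \<in> \<pi> ` K i" "b \<in> \<pi> ` K i" for a b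
        using that i e unfolding energy_dist_quad by (auto simp: dif_def real_sqrt_less_iff intro!: real_less_lsqrt)
      moreover have "\<forall>\<^sub>F a in ?H. a \<in> \<pi> ` K i"
        unfolding eventually_filtermap ev_G using i(1) by blast
      ultimately show "\<forall>\<^sub>F (s, t) in ?H \<times>\<^sub>F ?H. energy_dist \<kappa> s t < e"
        unfolding eventually_prod_filter
        by (intro exI[of _ "\<lambda>a. a \<in> \<pi> ` K i"]) auto
    qed
    moreover have "cluster_point_along vague_topology (\<lambda>\<nu>. \<nu>) ?H x0"
      unfolding cluster_point_along_def
    proof (intro conjI allI impI)
      show "x0 \<in> topspace vague_topology"
        using x0 by (simp add: vague_topology_def radon_nonneg_radon)
      fix U assume "openin vague_topology U \<and> x0 \<in> U"
      then obtain V where V: "open V" "U = radon \<inter> V" "x0 \<in> V"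
        by (auto simp: vague_topology_def openin_open)
      have "(\<pi> \<longlongrightarrow> x0) G"
        unfolding tendsto_fun_iff tendsto_iff ev_G
      proof (intro allI impI)
        fix f and e :: real assume "0 < e"
        then obtain i where "i \<in> I" "\<forall>z\<in>K i. \<bar>\<pi> z f - x0 f\<bar> \<le> e / 2"
          using lim[of "e / 2" f] by auto
        then show "\<exists>i\<in>I. \<forall>z\<in>K i. dist (\<pi> z f) (x0 f) < e"
          using \<open>0 < e\<close> by (intro bexI[of _ i]) (force simp: dist_real_def)
      qed
      then have "\<forall>\<^sub>F z in G. \<pi> z \<in> V"
        using V by (blast dest: topological_tendstoD)
      moreover have "\<forall>\<^sub>F z in G. \<pi> z \<in> radon"
        unfolding ev_G using \<pi> I_ne by (meson energy_cone_radon radon_nonneg_radon)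
      ultimately have "\<forall>\<^sub>F z in G. \<pi> z \<in> U"
        by eventually_elim (simp add: V)
      then show "\<exists>\<^sub>F \<nu> in ?H. \<nu> \<in> U"
        using eventually_frequently[OF H, of "\<lambda>\<nu>. \<nu> \<in> U"] by (simp add: eventually_filtermap)
    qed
    ultimately have x0_fin: "x0 \<in> finite_energy \<kappa>" and "((\<lambda>\<nu>. energy_dist \<kappa> \<nu> x0) \<longlongrightarrow> 0) ?H"
      using cons H unfolding consistent_def by blast+
    then have dist: "((\<lambda>z. energy_dist \<kappa> (\<pi> z) x0) \<longlongrightarrow> 0) G"
      by (simp add: filterlim_filtermap)
    have x0_cone: "x0 \<in> energy_cone"
      using x0_fin x0 finite_energy_Int_nonneg by blast
    have "\<forall>\<^sub>F z in G. \<pi> z \<in> energy_cone"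
      unfolding ev_G using \<pi> I_ne by blast
    then have "\<forall>\<^sub>F z in G. (energy_dist \<kappa> (\<pi> z) x0)\<^sup>2 = quad (dif (\<pi> z) x0)"
    proof eventually_elim
      case (elim z)
      then have "0 \<le> quad (dif (\<pi> z) x0)"
        using x0_cone by (intro quad_nonneg ds cs)
      then show ?case
        unfolding energy_dist_quad by (simp add: dif_def)
    qed
    moreover have "((\<lambda>z. (energy_dist \<kappa> (\<pi> z) x0)\<^sup>2) \<longlongrightarrow> 0) G"
      using tendsto_power[OF dist, of 2] by simp
    ultimately show ?thesis
      using x0_cone by (simp add: tendsto_cong)
  qed

  have K_cone: "fst z \<in> energy_cone" "snd z \<in> energy_cone" if "z \<in> K i" for z i
    using that by (auto simp: K_def Z_def)
  have p: "p0 \<in> energy_cone \<and> ((\<lambda>z. quad (dif (fst z) p0)) \<longlongrightarrow> 0) G"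
  proof (rule apply_consistent)
    show "\<exists>i\<in>I. \<forall>z\<in>K i. \<bar>fst z f - p0 f\<bar> \<le> e" if "0 < e" for f e
      using that by (intro bexI[of _ "({f}, e)"]) (auto simp: I_def K_def Z_def)
    show "\<exists>i\<in>I. \<forall>z\<in>K i. \<forall>z'\<in>K i. quad (dif (fst z) (fst z')) < e" if "0 < e" for e
      using small[OF that] by blast
  qed (use K_cone nonneg in auto)
  have n: "n0 \<in> energy_cone \<and> ((\<lambda>z. quad (dif (snd z) n0)) \<longlongrightarrow> 0) G"
  proof (rule apply_consistent)
    show "\<exists>i\<in>I. \<forall>z\<in>K i. \<bar>snd z f - n0 f\<bar> \<le> e" if "0 < e" for f e
      using that by (intro bexI[of _ "({f}, e)"]) (auto simp: I_def K_def Z_def)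
    show "\<exists>i\<in>I. \<forall>z\<in>K i. \<forall>z'\<in>K i. quad (dif (snd z) (snd z')) < e" if "0 < e" for e
      using small[OF that] by blast
  qed (use K_cone nonneg in auto)
  show "p0 \<in> energy_cone" "n0 \<in> energy_cone"
    using p n by auto
  have u0: "dif p0 n0 \<in> energy_span"
    using p n by (intro ds cs) auto
  have "((\<lambda>s. quad (dif (u s) (dif p0 n0))) \<longlongrightarrow> 0) F"
    unfolding tendsto_iff
  proof (intro allI impI)
    fix e :: real assume e: "0 < e"
    \<comment> \<open>The triangle estimate below gives
      \<open>2 * \<epsilon> + 2 * 4 * \<epsilon> = 10 * \<epsilon>\<close>, which stays under
      \<open>e\<close>.\<close>
    define \<epsilon> where "\<epsilon> = e / 12"
    have \<epsilon>: "0 < \<epsilon>"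
      using e by (simp add: \<epsilon>_def)
    \<comment> \<open>No test functions are needed for this index: a single pair is wanted that is
      strongly close both to the limit and to the tail of the net.\<close>
    have "\<forall>\<^sub>F z in G. dist (quad (dif (fst z) p0)) 0 < \<epsilon>" "\<forall>\<^sub>F z in G. dist (quad (dif (snd z) n0)) 0 < \<epsilon>"
      using p n \<epsilon> by (auto dest: tendstoD)
    moreover have "\<forall>\<^sub>F z in G. z \<in> K ({}, \<epsilon>)"
      unfolding ev_G using \<epsilon> by (intro bexI[of _ "({}, \<epsilon>)"]) (auto simp: I_def)
    ultimately have "\<forall>\<^sub>F z in G. quad (dif (fst z) p0) < \<epsilon> \<and> quad (dif (snd z) n0) < \<epsilon> \<and> z \<in> K ({}, \<epsilon>)"
      by eventually_elim (auto simp: abs_less_iff)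
    then obtain a b where ab: "quad (dif a p0) < \<epsilon>" "quad (dif b n0) < \<epsilon>" "(a, b) \<in> K ({}, \<epsilon>)"
      using eventually_happens'[OF G] by force
    have cone: "a \<in> energy_cone" "b \<in> energy_cone"
      using ab(3) by (auto simp: K_def Z_def)
    have "dif (dif a b) (dif p0 n0) = (\<lambda>f. dif a p0 f - dif b n0 f)"
      by (auto simp: dif_def)
    then have lim: "quad (dif (dif a b) (dif p0 n0)) \<le> 4 * \<epsilon>"
      using quad_diff_le[of "dif a p0" "dif b n0"] ab cone p n ds cs by auto
    have "\<forall>\<^sub>F s in F. u s \<in> energy_span \<and> quad (dif (dif a b) (u s)) \<le> \<epsilon>"
      using ab(3) by (auto simp: K_def Z_def)
    then show "\<forall>\<^sub>F s in F. dist (quad (dif (u s) (dif p0 n0))) 0 < e"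
    proof eventually_elim
      case (elim s)
      have "quad (dif (u s) (dif p0 n0)) \<le> 10 * \<epsilon>"
        using tri[of "u s" "dif a b" "dif p0 n0"] com[of "u s" "dif a b"] elim lim u0 cone ds cs by auto
      moreover have "0 \<le> quad (dif (u s) (dif p0 n0))"
        using ds[OF conjunct1[OF elim] u0] by (rule quad_nonneg)
      ultimately show ?case
        using \<epsilon> by (simp add: \<epsilon>_def dist_real_def)
    qed
  qed
  then show "((\<lambda>s. quad (\<lambda>f. (p s f - n s f) - (p0 f - n0 f))) \<longlongrightarrow> 0) F"
    by (simp add: u_def dif_def)
qed

section \<open>Resultants of families of measures on a condenser\<close>

lemma radon_product_vanish:
  fixes p n :: "('a::t2_space \<Rightarrow> real) \<Rightarrow> real"
  assumes lc: "locally_compact_space (euclidean :: 'a topology)"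
    and p: "p \<in> radon_nonneg E" and n: "n \<in> radon_nonneg E'" and F: "F \<in> Cc"
    and zero: "\<And>x y. x \<in> E \<Longrightarrow> y \<in> E' \<Longrightarrow> F (x, y) = 0"
  shows "radon_product p n F = 0"
proof -
  have "n (\<lambda>y. F (x, y)) = 0" if "x \<in> E" for x
    by (rule radon_nonneg_vanish[OF n Cc_section[OF F]]) (rule zero[OF that])
  then have "p (\<lambda>x. n (\<lambda>y. F (x, y))) = 0"
    by (rule radon_nonneg_vanish[OF p Cc_integral_section[OF lc n F]])
  then show ?thesis
    by (simp add: radon_product_def)
qed

text \<open>\<open>T\<close> stands for the total mass, which is tested on functions between 0 and
  1. Cutting \<open>f\<close> at 0 and \<open>c\<close> changes its positive part only off
  \<open>E\<close>, where the measure does not see it.\<close>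

lemma radon_nonneg_mass_bound:
  assumes \<nu>: "\<nu> \<in> radon_nonneg E" and f: "f \<in> Cc" and c: "0 \<le> c"
    and le: "\<And>x. x \<in> E \<Longrightarrow> f x \<le> c"
    and T: "\<And>h. h \<in> Cc \<Longrightarrow> (\<And>x. 0 \<le> h x) \<Longrightarrow> (\<And>x. h x \<le> 1) \<Longrightarrow> \<nu> h \<le> T"
  shows "\<nu> f \<le> c * T"
proof -
  have pos: "pos_functional \<nu>"
    using \<nu> by (rule radon_nonneg_pos_functional)
  let ?m = "\<lambda>x. max (f x) 0" and ?h = "\<lambda>x. min (max (f x) 0) c"
  have m: "?m \<in> Cc"
    using f by simp
  have h: "?h \<in> Cc"
    by (rule Cc_support[OF _ f]) (use c f in \<open>auto intro!: continuous_on_min continuous_on_max dest: Cc_continuous\<close>)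
  have "\<nu> (\<lambda>x. ?m x - ?h x) = 0"
  proof (rule radon_nonneg_vanish[OF \<nu>])
    show "?m x - ?h x = 0" if "x \<in> E" for x
      using le[OF that] c by (simp add: max_def)
  qed (use Cc_diff[OF m h] in simp)
  then have "\<nu> ?m = \<nu> ?h"
    using pos_functional_diff[OF pos m h] by simp
  moreover have "\<nu> f \<le> \<nu> ?m"
    by (rule pos_functional_mono[OF pos f m]) simp
  moreover have "\<nu> ?h \<le> c * T"
  proof (cases "c = 0")
    case True
    then have "?h = (\<lambda>_. 0)"
      by (auto simp: fun_eq_iff)
    then show ?thesis
      using pos_functional_0[OF pos] True by simp
  next
    case False
    then have "\<nu> (\<lambda>x. (1 / c) * ?h x) \<le> T"
      using c by (intro T Cc_cmult h) (auto simp: field_simps)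
    then have "(1 / c) * \<nu> ?h \<le> T"
      unfolding radon_cmult[OF radon_nonneg_radon[OF \<nu>] h] .
    then show ?thesis
      using c False by (simp add: field_simps)
  qed
  ultimately show ?thesis
    by simp
qed

section \<open>Vague limits, vague boundedness and finer filters\<close>

text \<open>Linearity, positivity and the support condition pass to pointwise limits. The bounds
  over compact sets need not be uniform along the filter; \<open>radon_nonnegI\<close> recovers them
  from positivity.\<close>

lemma radon_nonneg_limit:
  fixes \<nu> :: "'s \<Rightarrow> ('a::t2_space \<Rightarrow> real) \<Rightarrow> real"
  assumes lc: "locally_compact_space (euclidean :: 'a topology)" and F: "F \<noteq> bot"
    and ev: "\<forall>\<^sub>F s in F. \<nu> s \<in> radon_nonneg E" and lim: "\<And>f. ((\<lambda>s. \<nu> s f) \<longlongrightarrow> l f) F"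
  shows "l \<in> radon_nonneg E"
proof (rule radon_nonnegI[OF lc])
  have eq: "l f = c" if "\<And>\<mu>. \<mu> \<in> radon_nonneg E \<Longrightarrow> \<mu> f = c" for f c
  proof -
    have "\<forall>\<^sub>F s in F. \<nu> s f = c"
      using ev by eventually_elim (rule that)
    then have "((\<lambda>s. \<nu> s f) \<longlongrightarrow> c) F"
      by (rule tendsto_eventually)
    then show ?thesis
      by (rule tendsto_unique[OF F lim])
  qed
  show "l f = 0" if "f \<notin> Cc" for f
    using that by (intro eq) (simp add: radon_outside radon_nonneg_radon)
  show "l f = 0" if "f \<in> Cc" "closure {x. f x \<noteq> 0} \<inter> E = {}" for f
    using that by (intro eq) (simp add: radon_nonneg_def)
  show "l (\<lambda>x. c * f x) = c * l f" if f: "f \<in> Cc" for c f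
  proof -
    have "\<forall>\<^sub>F s in F. c * \<nu> s f = \<nu> s (\<lambda>x. c * f x)"
      using ev by eventually_elim (simp add: radon_cmult[OF radon_nonneg_radon f])
    then have "((\<lambda>s. \<nu> s (\<lambda>x. c * f x)) \<longlongrightarrow> c * l f) F"
      by (rule Lim_transform_eventually[OF tendsto_mult_left[OF lim]])
    then show ?thesis
      by (rule tendsto_unique[OF F lim])
  qed
  show "pos_functional l"
    unfolding pos_functional_def
  proof (intro conjI ballI impI)
    fix f h :: "'a \<Rightarrow> real" assume fh: "f \<in> Cc" "h \<in> Cc"
    have "\<forall>\<^sub>F s in F. \<nu> s f + \<nu> s h = \<nu> s (\<lambda>x. f x + h x)"
      using ev by eventually_elim (simp add: radon_add[OF radon_nonneg_radon fh])
    then have "((\<lambda>s. \<nu> s (\<lambda>x. f x + h x)) \<longlongrightarrow> l f + l h) F"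
      by (rule Lim_transform_eventually[OF tendsto_add[OF lim lim]])
    then show "l (\<lambda>x. f x + h x) = l f + l h"
      by (rule tendsto_unique[OF F lim])
  next
    fix f :: "'a \<Rightarrow> real" assume f: "f \<in> Cc" "\<forall>x. 0 \<le> f x"
    have "\<forall>\<^sub>F s in F. 0 \<le> \<nu> s f"
      using ev by eventually_elim (use f in \<open>simp add: radon_nonneg_def\<close>)
    then show "0 \<le> l f"
      by (rule tendsto_lowerbound[OF lim _ F])
  qed
qed

text \<open>As a supremum of evaluations at functions of \<open>Cc\<close>, the integral is vaguely
  lower semicontinuous. Thus inequality constraints survive in the limit, while equalities could
  lose mass.\<close>

lemma lsc_integral_limit:
  assumes F: "F \<noteq> bot" and lim: "\<And>f. ((\<lambda>s. \<nu> s f) \<longlongrightarrow> l f) F"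
    and ev: "\<forall>\<^sub>F s in F. lsc_integral (\<nu> s) \<psi> \<le> ereal c"
  shows "lsc_integral l \<psi> \<le> ereal c"
  unfolding lsc_integral_def
proof (rule SUP_least)
  fix f assume f: "f \<in> {f \<in> Cc. \<forall>x. ereal (f x) \<le> \<psi> x}"
  have "\<forall>\<^sub>F s in F. \<nu> s f \<le> c"
    using ev
  proof eventually_elim
    case (elim s)
    have "ereal (\<nu> s f) \<le> lsc_integral (\<nu> s) \<psi>"
      unfolding lsc_integral_def using f by (rule SUP_upper)
    also note elim
    finally show ?case
      by simp
  qed
  then show "ereal (l f) \<le> ereal c"
    using tendsto_upperbound[OF lim _ F] by simp
qed

lemma Cc_abs_bounded:
  assumes "f \<in> Cc"
  obtains M where "0 < M" "\<And>x. \<bar>f x\<bar> \<le> M"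
proof -
  let ?K = "closure {x. f x \<noteq> 0}"
  have "compact (f ` ?K)"
    using Cc_continuous[OF assms] Cc_compact_support[OF assms]
    by (intro compact_continuous_image) (auto intro: continuous_on_subset)
  then have "\<exists>M>0. \<forall>y\<in>f ` ?K. norm y \<le> M"
    unfolding bounded_pos[symmetric] by (rule compact_imp_bounded)
  then obtain M where M: "0 < M" "\<forall>y\<in>f ` ?K. norm y \<le> M"
    by auto
  have "\<bar>f x\<bar> \<le> M" for x
  proof (cases "f x = 0")
    case False
    then have "f x \<in> f ` ?K"
      using closure_subset[of "{x. f x \<noteq> 0}"] by blast
    then show ?thesis
      using M(2) by fastforce
  qed (use M in simp)
  then show ?thesis
    using that M(1) by blast
qed

text \<open>Since \<open>f / g\<close> is bounded by some \<open>M\<close>, the function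
  \<open>\<bar>f\<bar> / M\<close> is a minorant of \<open>g\<close>. The bound \<open>M * c\<close>
  does not depend on the measure, which is what vague compactness requires.\<close>

lemma constraint_imp_bounded:
  fixes g :: "'a::topological_space \<Rightarrow> real"
  assumes f: "f \<in> Cc" and g: "continuous_on UNIV g" "\<And>x. 0 < g x"
  obtains B where "\<And>\<nu> E. \<nu> \<in> radon_nonneg E \<Longrightarrow> lsc_integral \<nu> (\<lambda>x. ereal (g x)) \<le> ereal c \<Longrightarrow> \<bar>\<nu> f\<bar> \<le> B"
proof -
  have "(\<lambda>x. inverse (g x) * f x) \<in> Cc"
    using g by (intro Cc_times f continuous_on_inverse) (auto simp: less_imp_neq[OF g(2), symmetric])
  then obtain M where M: "0 < M" "\<And>x. \<bar>inverse (g x) * f x\<bar> \<le> M"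
    using Cc_abs_bounded by blast
  have le: "(1 / M) * \<bar>f x\<bar> \<le> g x" for x
    using M(1) M(2)[of x] g(2)[of x] by (simp add: abs_mult field_simps)
  have "\<bar>\<nu> f\<bar> \<le> M * c" if \<nu>: "\<nu> \<in> radon_nonneg E" "lsc_integral \<nu> (\<lambda>x. ereal (g x)) \<le> ereal c" for \<nu> E
  proof -
    have pos: "pos_functional \<nu>"
      using \<nu>(1) by (rule radon_nonneg_pos_functional)
    have h: "(\<lambda>x. (1 / M) * \<bar>f x\<bar>) \<in> Cc"
      using f by (intro Cc_cmult Cc_abs)
    have "ereal (\<nu> (\<lambda>x. (1 / M) * \<bar>f x\<bar>)) \<le> lsc_integral \<nu> (\<lambda>x. ereal (g x))"
      unfolding lsc_integral_def using h le by (intro SUP_upper) auto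
    also note \<nu>(2)
    finally have "\<nu> (\<lambda>x. (1 / M) * \<bar>f x\<bar>) \<le> c"
      by simp
    then have "(1 / M) * \<nu> (\<lambda>x. \<bar>f x\<bar>) \<le> c"
      unfolding radon_cmult[OF radon_nonneg_radon[OF \<nu>(1)] Cc_abs[OF f]] .
    then have "\<nu> (\<lambda>x. \<bar>f x\<bar>) \<le> M * c"
      using M(1) by (simp add: field_simps)
    moreover have "\<nu> f \<le> \<nu> (\<lambda>x. \<bar>f x\<bar>)"
      by (rule pos_functional_mono[OF pos f Cc_abs[OF f]]) simp
    moreover have "\<nu> (\<lambda>x. - f x) \<le> \<nu> (\<lambda>x. \<bar>f x\<bar>)"
      by (rule pos_functional_mono[OF pos Cc_uminus[OF f] Cc_abs[OF f]]) simp
    moreover have "\<nu> (\<lambda>x. - f x) = - \<nu> f"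
      using pos_functional_diff[OF pos Cc_0 f] pos_functional_0[OF pos] by simp
    ultimately show ?thesis
      by simp
  qed
  then show ?thesis
    using that by blast
qed

text \<open>The filter form of passing to a convergent subnet: \<open>F\<close> is refined by the
  preimages of the neighbourhoods of \<open>z\<close>.\<close>

lemma cluster_point_finer_filter:
  assumes "cluster_point_along T x F z"
  obtains F' where "F' \<le> F" "F' \<noteq> bot" "limitin T x z F'"
proof
  let ?F' = "inf F (filtercomap x (nhdsin T z))"
  have z: "z \<in> topspace T" and freq: "\<And>U. openin T U \<Longrightarrow> z \<in> U \<Longrightarrow> \<exists>\<^sub>F s in F. x s \<in> U"
    using assms by (auto simp: cluster_point_along_def)
  show "?F' \<le> F"
    by simp
  show "?F' \<noteq> bot"
    unfolding trivial_limit_def eventually_inf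
  proof clarify
    fix Q R assume Q: "eventually Q F" and R: "eventually R (filtercomap x (nhdsin T z))"
      and QR: "\<forall>s. Q s \<and> R s \<longrightarrow> False"
    obtain U where U: "openin T U" "z \<in> U" "\<And>s. x s \<in> U \<Longrightarrow> R s"
      using R z unfolding eventually_filtercomap eventually_nhdsin by blast
    have "\<exists>\<^sub>F s in F. Q s \<and> x s \<in> U"
      using freq[OF U(1,2)] Q by (rule frequently_eventually_conj)
    then obtain s where "Q s" "x s \<in> U"
      by (auto dest: frequently_ex)
    then show False
      using U(3) QR by blast
  qed
  show "limitin T x z ?F'"
    unfolding limitin_def
  proof (intro conjI allI impI z)
    fix U assume "openin T U \<and> z \<in> U"
    then have "\<forall>\<^sub>F w in nhdsin T z. w \<in> U"
      unfolding eventually_nhdsin by auto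
    then have "\<forall>\<^sub>F s in filtercomap x (nhdsin T z). x s \<in> U"
      by (rule eventually_filtercomapI)
    then show "\<forall>\<^sub>F s in ?F'. x s \<in> U"
      by (rule filter_leD[rotated]) simp
  qed
qed

lemma limitin_imp_cluster_point:
  assumes "limitin T x z F'" "F' \<le> F" "F' \<noteq> bot"
  shows "cluster_point_along T x F z"
  unfolding cluster_point_along_def
proof (intro conjI allI impI)
  show "z \<in> topspace T"
    using assms(1) by (simp add: limitin_def)
  fix U assume "openin T U \<and> z \<in> U"
  then have "\<exists>\<^sub>F s in F'. x s \<in> U"
    using assms(1,3) by (auto simp: limitin_def intro: eventually_frequently)
  then show "\<exists>\<^sub>F s in F. x s \<in> U"
    using filter_leD[OF assms(2)] by (auto simp: frequently_def)
qed

text \<open>A cluster point of the image filter exists by compactness; pulling its neighbourhoods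
  back refines \<open>F\<close> itself, so that other properties along \<open>F\<close> remain
  available.\<close>

lemma compact_imp_cluster_limit:
  fixes y :: "'s \<Rightarrow> 'b::topological_space"
  assumes "compact U" "F \<noteq> bot" "\<forall>\<^sub>F s in F. y s \<in> U"
  obtains z F' where "F' \<le> F" "F' \<noteq> bot" "(y \<longlongrightarrow> z) F'"
proof -
  have "filtermap y F \<noteq> bot" "eventually (\<lambda>w. w \<in> U) (filtermap y F)"
    using assms by (auto simp: filtermap_bot_iff eventually_filtermap)
  then obtain z where z: "inf (nhds z) (filtermap y F) \<noteq> bot"
    using assms(1) unfolding compact_filter by blast
  let ?F' = "inf F (filtercomap y (nhds z))"
  have "?F' \<noteq> bot"
  proof
    assume "?F' = bot"
    then have "eventually (\<lambda>_. False) ?F'"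
      by simp
    then obtain Q R where QR: "eventually Q F" "eventually R (filtercomap y (nhds z))" "\<And>s. Q s \<Longrightarrow> R s \<Longrightarrow> False"
      unfolding eventually_inf by blast
    obtain V where V: "eventually V (nhds z)" "\<And>s. V (y s) \<Longrightarrow> R s"
      using QR(2) unfolding eventually_filtercomap by blast
    have "eventually (\<lambda>w. \<not> V w) (filtermap y F)"
      unfolding eventually_filtermap using QR(1) by (rule eventually_mono) (use QR V in blast)
    then have "eventually (\<lambda>_. False) (inf (nhds z) (filtermap y F))"
      unfolding eventually_inf using V(1) by blast
    then show False
      using z by (simp add: trivial_limit_def)
  qed
  moreover have "(y \<longlongrightarrow> z) ?F'"
    unfolding filterlim_iff_le_filtercomap by simp
  ultimately show ?thesis
    using that inf_le1 by blast
qed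

text \<open>\<open>K\<close> may be larger than the support, so that several test functions can
  share one finite set of plates.\<close>

lemma infsum_plates_finite:
  assumes J: "\<And>i. i \<in> J \<Longrightarrow> \<mu> i \<in> radon_nonneg (A i)" and K: "finite {i \<in> J. A i \<inter> K \<noteq> {}}"
    and f: "f \<in> Cc" "closure {x. f x \<noteq> 0} \<subseteq> K"
  shows "(\<Sum>\<^sub>\<infinity>i\<in>J. c i * \<mu> i f) = (\<Sum>i | i \<in> J \<and> A i \<inter> K \<noteq> {}. c i * \<mu> i f :: real)"
proof -
  have "\<mu> i f = 0" if "i \<in> J" "A i \<inter> K = {}" for i
    using J[OF that(1)] f that(2) unfolding radon_nonneg_def by blast
  then have "(\<Sum>\<^sub>\<infinity>i\<in>J. c i * \<mu> i f) = (\<Sum>\<^sub>\<infinity>i | i \<in> J \<and> A i \<inter> K \<noteq> {}. c i * \<mu> i f)"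
    by (intro infsum_cong_neutral) auto
  then show ?thesis
    using K by simp
qed

section \<open>The two parts of a resultant and their supports\<close>

locale condenser_kernel = pd_kernel \<kappa> for \<kappa> :: "'a::t2_space \<times> 'a \<Rightarrow> ereal" +
  fixes P N :: "nat set" and A :: "nat \<Rightarrow> 'a set"
  assumes cond: "condenser P N A"
begin

text \<open>For \<open>J = P\<close> and \<open>J = N\<close> these are the two nonnegative measures
  whose difference is the resultant.\<close>

definition part :: "nat set \<Rightarrow> (nat \<Rightarrow> ('a \<Rightarrow> real) \<Rightarrow> real) \<Rightarrow> ('a \<Rightarrow> real) \<Rightarrow> real" where
  "part J \<mu> f = (\<Sum>\<^sub>\<infinity>i\<in>J. \<mu> i f)"

lemma plates_finite: "compact K \<Longrightarrow> J \<subseteq> P \<union> N \<Longrightarrow> finite {i \<in> J. A i \<inter> K \<noteq> {}}"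
proof -
  assume "compact K" "J \<subseteq> P \<union> N"
  then have "finite {i \<in> P \<union> N. A i \<inter> K \<noteq> {}}"
    using cond by (simp add: condenser_def)
  then show ?thesis
    by (rule rev_finite_subset) (use \<open>J \<subseteq> P \<union> N\<close> in auto)
qed

lemma measures_nonneg: "\<mu> \<in> condenser_measures P N A \<Longrightarrow> i \<in> P \<union> N \<Longrightarrow> \<mu> i \<in> radon_nonneg (A i)"
  by (auto simp: condenser_measures_def)

lemma part_eq:
  assumes "\<mu> \<in> condenser_measures P N A" "J \<subseteq> P \<union> N" "f \<in> Cc"
  shows "part J \<mu> f = (\<Sum>i | i \<in> J \<and> A i \<inter> closure {x. f x \<noteq> 0} \<noteq> {}. \<mu> i f)"
  using infsum_plates_finite[of J \<mu> A "closure {x. f x \<noteq> 0}" f "\<lambda>_. 1"]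
    measures_nonneg[OF assms(1)] plates_finite[OF Cc_compact_support[OF assms(3)] assms(2)] assms
  by (auto simp: part_def)

lemma part_eq_compact:
  assumes "\<mu> \<in> condenser_measures P N A" "J \<subseteq> P \<union> N" "f \<in> Cc" "compact K" "closure {x. f x \<noteq> 0} \<subseteq> K"
  shows "part J \<mu> f = (\<Sum>i | i \<in> J \<and> A i \<inter> K \<noteq> {}. \<mu> i f)"
  using infsum_plates_finite[of J \<mu> A K f "\<lambda>_. 1"]
    measures_nonneg[OF assms(1)] plates_finite[OF assms(4,2)] assms
  by (auto simp: part_def)

lemma part_radon_nonneg:
  assumes \<mu>: "\<mu> \<in> condenser_measures P N A" and J: "J \<subseteq> P \<union> N"
  shows "part J \<mu> \<in> radon_nonneg (\<Union>i\<in>J. A i)"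
proof (rule radon_nonnegI[OF lc])
  have pos: "pos_functional (\<mu> i)" "\<mu> i \<in> radon" "\<mu> i \<in> radon_nonneg (A i)" if "i \<in> J" for i
    using measures_nonneg[OF \<mu>, of i] that J radon_nonneg_pos_functional radon_nonneg_radon by blast+
  show "part J \<mu> f = 0" if "f \<notin> Cc" for f
    using pos(2) that by (simp add: part_def radon_outside infsum_0)
  show "part J \<mu> f = 0" if "f \<in> Cc" "closure {x. f x \<noteq> 0} \<inter> (\<Union>i\<in>J. A i) = {}" for f
  proof -
    have "\<mu> i f = 0" if "i \<in> J" for i
      using pos(3)[OF that] \<open>f \<in> Cc\<close> \<open>closure {x. f x \<noteq> 0} \<inter> (\<Union>i\<in>J. A i) = {}\<close> that
      unfolding radon_nonneg_def by blast
    then show ?thesis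
      by (simp add: part_def infsum_0)
  qed
  show "part J \<mu> (\<lambda>x. c * f x) = c * part J \<mu> f" if "f \<in> Cc" for c f
  proof -
    have "(\<Sum>\<^sub>\<infinity>i\<in>J. \<mu> i (\<lambda>x. c * f x)) = (\<Sum>\<^sub>\<infinity>i\<in>J. c * \<mu> i f)"
      using pos(2) that by (intro infsum_cong) (simp add: radon_cmult)
    then show ?thesis
      by (simp add: part_def infsum_cmult_right')
  qed
  show "pos_functional (part J \<mu>)"
    unfolding pos_functional_def
  proof (intro conjI ballI impI)
    fix f h :: "'a \<Rightarrow> real" assume fh: "f \<in> Cc" "h \<in> Cc"
    \<comment> \<open>With one compact set for both functions, the three sums range over the same
      plates.\<close>
    let ?K = "closure {x. f x \<noteq> 0} \<union> closure {x. h x \<noteq> 0}"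
    have K: "compact ?K"
      using fh by (simp add: Cc_compact_support compact_Un)
    have "closure {x. f x + h x \<noteq> 0} \<subseteq> closure ({x. f x \<noteq> 0} \<union> {x. h x \<noteq> 0})"
      by (intro closure_mono) auto
    then have "part J \<mu> (\<lambda>x. f x + h x) = (\<Sum>i | i \<in> J \<and> A i \<inter> ?K \<noteq> {}. \<mu> i (\<lambda>x. f x + h x))"
      using part_eq_compact[OF \<mu> J Cc_add[OF fh] K] by simp
    also have "\<dots> = (\<Sum>i | i \<in> J \<and> A i \<inter> ?K \<noteq> {}. \<mu> i f + \<mu> i h)"
      using pos(1) fh by (intro sum.cong) (auto simp: pos_functional_add)
    also have "\<dots> = part J \<mu> f + part J \<mu> h"
      using part_eq_compact[OF \<mu> J fh(1) K] part_eq_compact[OF \<mu> J fh(2) K] by (simp add: sum.distrib)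
    finally show "part J \<mu> (\<lambda>x. f x + h x) = part J \<mu> f + part J \<mu> h" .
  next
    fix f :: "'a \<Rightarrow> real" assume f: "f \<in> Cc" "\<forall>x. 0 \<le> f x"
    have "0 \<le> \<mu> i f" if "i \<in> J" for i
      using pos_functional_nonneg[OF pos(1)[OF that] f(1)] f(2) by simp
    then show "0 \<le> part J \<mu> f"
      by (auto simp: part_eq[OF \<mu> J f(1)] intro!: sum_nonneg)
  qed
qed

lemma part_UNIV: "\<mu> \<in> condenser_measures P N A \<Longrightarrow> J \<subseteq> P \<union> N \<Longrightarrow> part J \<mu> \<in> radon_nonneg UNIV"
  using part_radon_nonneg radon_nonneg_mono by blast

lemma resultant_eq_sum:
  assumes \<mu>: "\<mu> \<in> condenser_measures P N A" and f: "f \<in> Cc" and K: "compact K" "closure {x. f x \<noteq> 0} \<subseteq> K"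
  shows "condenser_resultant P N \<mu> f = (\<Sum>i | i \<in> P \<union> N \<and> A i \<inter> K \<noteq> {}. condenser_sign P i * \<mu> i f)"
  unfolding condenser_resultant_def
  using measures_nonneg[OF \<mu>] plates_finite[OF K(1) order_refl] f K by (intro infsum_plates_finite) auto

lemma resultant_eq_parts:
  assumes \<mu>: "\<mu> \<in> condenser_measures P N A"
  shows "condenser_resultant P N \<mu> = (\<lambda>f. part P \<mu> f - part N \<mu> f)"
proof
  fix f :: "'a \<Rightarrow> real"
  show "condenser_resultant P N \<mu> f = part P \<mu> f - part N \<mu> f"
  proof (cases "f \<in> Cc")
    case True
    let ?K = "closure {x. f x \<noteq> 0}"
    let ?J = "\<lambda>J. {i \<in> J. A i \<inter> ?K \<noteq> {}}"
    have fin: "finite (?J P)" "finite (?J N)"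
      using plates_finite[OF Cc_compact_support[OF True]] by auto
    have disj: "P \<inter> N = {}"
      using cond by (simp add: condenser_def)
    have "condenser_resultant P N \<mu> f = (\<Sum>i\<in>?J (P \<union> N). condenser_sign P i * \<mu> i f)"
      using resultant_eq_sum[OF \<mu> True Cc_compact_support[OF True]] by simp
    also have "?J (P \<union> N) = ?J P \<union> ?J N"
      by auto
    also have "(\<Sum>i\<in>?J P \<union> ?J N. condenser_sign P i * \<mu> i f) =
        (\<Sum>i\<in>?J P. condenser_sign P i * \<mu> i f) + (\<Sum>i\<in>?J N. condenser_sign P i * \<mu> i f)"
      using fin disj by (intro sum.union_disjoint) auto
    also have "(\<Sum>i\<in>?J P. condenser_sign P i * \<mu> i f) = (\<Sum>i\<in>?J P. \<mu> i f)"
      by (intro sum.cong) (auto simp: condenser_sign_def)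
    also have "(\<Sum>i\<in>?J N. condenser_sign P i * \<mu> i f) = (\<Sum>i\<in>?J N. - \<mu> i f)"
      using disj by (intro sum.cong) (auto simp: condenser_sign_def)
    finally show ?thesis
      by (simp add: part_eq[OF \<mu> _ True] sum_negf)
  next
    case False
    then have "\<mu> i f = 0" if "i \<in> P \<union> N" for i
      using measures_nonneg[OF \<mu> that] by (simp add: radon_nonneg_radon radon_outside)
    then have "(\<Sum>\<^sub>\<infinity>i\<in>P \<union> N. condenser_sign P i * \<mu> i f) = 0" "(\<Sum>\<^sub>\<infinity>i\<in>P. \<mu> i f) = 0" "(\<Sum>\<^sub>\<infinity>i\<in>N. \<mu> i f) = 0"
      by (auto intro!: infsum_0)
    then show ?thesis
      by (simp add: condenser_resultant_def part_def)
  qed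
qed

text \<open>At a given test function the sum extends over finitely many plates, and the same ones
  for all \<open>s\<close>, so the limits of the components add up.\<close>

lemma part_tendsto:
  assumes ev: "\<forall>\<^sub>F s in F. x s \<in> condenser_measures P N A" and z: "z \<in> condenser_measures P N A"
    and lim: "\<And>i f. i \<in> P \<union> N \<Longrightarrow> ((\<lambda>s. x s i f) \<longlongrightarrow> z i f) F" and J: "J \<subseteq> P \<union> N"
  shows "((\<lambda>s. part J (x s)) \<longlongrightarrow> part J z) F"
  unfolding tendsto_fun_iff
proof
  fix f :: "'a \<Rightarrow> real"
  show "((\<lambda>s. part J (x s) f) \<longlongrightarrow> part J z f) F"
  proof (cases "f \<in> Cc")
    case True
    have "\<forall>\<^sub>F s in F. (\<Sum>i | i \<in> J \<and> A i \<inter> closure {x. f x \<noteq> 0} \<noteq> {}. x s i f) = part J (x s) f"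
      using ev by eventually_elim (simp add: part_eq[OF _ J True])
    moreover have "((\<lambda>s. \<Sum>i | i \<in> J \<and> A i \<inter> closure {x. f x \<noteq> 0} \<noteq> {}. x s i f) \<longlongrightarrow>
        (\<Sum>i | i \<in> J \<and> A i \<inter> closure {x. f x \<noteq> 0} \<noteq> {}. z i f)) F"
      using J by (intro tendsto_sum lim) auto
    ultimately show ?thesis
      unfolding part_eq[OF z J True] by (rule Lim_transform_eventually[rotated])
  next
    case False
    have "\<forall>\<^sub>F s in F. part J (x s) f = 0"
      using ev
    proof eventually_elim
      case (elim s)
      show ?case
        by (rule radon_outside[OF radon_nonneg_radon[OF part_UNIV[OF elim J]] False])
    qed
    moreover have "part J z f = 0"
      by (rule radon_outside[OF radon_nonneg_radon[OF part_UNIV[OF z J]] False])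
    ultimately show ?thesis
      by (simp add: tendsto_eventually)
  qed
qed

text \<open>Turns convergence in the product topology into convergence of real numbers, the form in
  which the limit arguments use it.\<close>

lemma limitin_condenser_vague_iff:
  "limitin (condenser_vague_topology P N A) x z F \<longleftrightarrow>
    z \<in> condenser_measures P N A \<and> (\<forall>\<^sub>F s in F. x s \<in> condenser_measures P N A) \<and>
    (\<forall>i\<in>P \<union> N. \<forall>f. ((\<lambda>s. x s i f) \<longlongrightarrow> z i f) F)"
proof -
  have top: "topspace (condenser_vague_topology P N A) = condenser_measures P N A"
    by (auto simp: condenser_vague_topology_def condenser_measures_def vague_topology_def
        radon_nonneg_def PiE_def Pi_def)
  have lim: "limitin (subtopology vague_topology (radon_nonneg (A i))) (\<lambda>s. x s i) (z i) F \<longleftrightarrow>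
      z i \<in> radon_nonneg (A i) \<and> (\<forall>\<^sub>F s in F. x s i \<in> radon_nonneg (A i)) \<and> (\<forall>f. ((\<lambda>s. x s i f) \<longlongrightarrow> z i f) F)"
    for i
  proof -
    have "subtopology vague_topology (radon_nonneg (A i)) = top_of_set (radon_nonneg (A i))"
      unfolding vague_topology_def subtopology_subtopology
      by (intro arg_cong[where f = top_of_set]) (auto simp: radon_nonneg_def)
    then show ?thesis
      by (simp add: limitin_subtopology tendsto_fun_iff)
  qed
  have "limitin (condenser_vague_topology P N A) x z F \<longleftrightarrow>
    z \<in> extensional (P \<union> N) \<and> (\<forall>\<^sub>F s in F. x s \<in> condenser_measures P N A) \<and>
    (\<forall>i\<in>P \<union> N. limitin (subtopology vague_topology (radon_nonneg (A i))) (\<lambda>s. x s i) (z i) F)"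
    using top unfolding condenser_vague_topology_def by (simp add: limitin_componentwise)
  also have "\<dots> \<longleftrightarrow> z \<in> condenser_measures P N A \<and> (\<forall>\<^sub>F s in F. x s \<in> condenser_measures P N A) \<and>
    (\<forall>i\<in>P \<union> N. \<forall>f. ((\<lambda>s. x s i f) \<longlongrightarrow> z i f) F)"
  proof -
    have "\<forall>\<^sub>F s in F. x s i \<in> radon_nonneg (A i)"
      if "\<forall>\<^sub>F s in F. x s \<in> condenser_measures P N A" "i \<in> P \<union> N" for i
      using that(1) by eventually_elim (use that(2) measures_nonneg in blast)
    then show ?thesis
      unfolding lim by (auto simp: condenser_measures_def PiE_def Pi_def)
  qed
  finally show ?thesis .
qed

text \<open>By local finiteness only finitely many plates meet \<open>K\<close>, so an infinite
  union of plates is closed within \<open>K\<close>.\<close>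

lemma compact_plates:
  assumes "compact K" "J \<subseteq> P \<union> N"
  shows "compact ((\<Union>i\<in>J. A i) \<inter> K)"
proof -
  have "(\<Union>i\<in>J. A i) \<inter> K = K \<inter> (\<Union>i\<in>{i \<in> J. A i \<inter> K \<noteq> {}}. A i)"
    by auto
  moreover have "closed (\<Union>i\<in>{i \<in> J. A i \<inter> K \<noteq> {}}. A i)"
    using plates_finite[OF assms] cond assms(2) by (intro closed_UN) (auto simp: condenser_def)
  ultimately show ?thesis
    using compact_Int_closed[OF assms(1)] by simp
qed

text \<open>
  With \<open>u = 1\<close> on the positive and \<open>u = 0\<close> on the negative plates, the function
  \<open>u x * u y + (1 - u x) * (1 - u y)\<close> separates the supports of the two parts of
  \<open>(p - n) \<otimes> (p - n)\<close>, so that these are its Jordan decomposition.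
\<close>

lemma finite_energy_parts:
  assumes \<mu>: "\<mu> \<in> condenser_finite_energy \<kappa> P N A"
  shows "part P \<mu> \<in> energy_cone" "part N \<mu> \<in> energy_cone"
proof -
  define p where "p = part P \<mu>"
  define n where "n = part N \<mu>"
  let ?P = "\<Union>i\<in>P. A i" and ?N = "\<Union>i\<in>N. A i"
  have m: "\<mu> \<in> condenser_measures P N A"
    using \<mu> by (simp add: condenser_finite_energy_def)
  have pP: "p \<in> radon_nonneg ?P" and nN: "n \<in> radon_nonneg ?N"
    using part_radon_nonneg[OF m] by (simp_all add: p_def n_def)
  have p: "p \<in> radon_nonneg UNIV" and n: "n \<in> radon_nonneg UNIV"
    using part_UNIV[OF m] by (simp_all add: p_def n_def)
  have fin: "(\<lambda>f. p f - n f) \<in> finite_energy \<kappa>"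
    using \<mu> resultant_eq_parts[OF m] by (simp add: condenser_finite_energy_def p_def n_def)
  let ?m = "radon_product (\<lambda>f. p f - n f) (\<lambda>f. p f - n f)"
  let ?m1 = "\<lambda>F. radon_product p p F + radon_product n n F"
  let ?m2 = "\<lambda>F. radon_product p n F + radon_product n p F"
  have m1: "pos_functional ?m1" and m2: "pos_functional ?m2"
    using p n by (auto intro!: pos_functional_plus prod_pos)
  have dec2: "pos_functional (\<lambda>F. ?m1 F - radon_pos ?m F)"
    by (rule radon_pos_decomposition(2)[OF m1 m2 prod_diff[OF p n]])
  have dec3: "?m1 F - radon_pos ?m F = ?m2 F - radon_neg ?m F" if "F \<in> Cc" for F
    by (rule radon_pos_decomposition(3)[OF m1 m2 prod_diff[OF p n] that])
  have dec4: "?m G \<le> radon_pos ?m F"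
    if "F \<in> Cc" "G \<in> Cc" "\<And>x. 0 \<le> G x" "\<And>x. G x \<le> F x" for F G
    by (rule radon_pos_decomposition(4)[OF m1 m2 prod_diff[OF p n] that])
  have le: "?m1 F \<le> radon_pos ?m F" if F: "F \<in> Cc" "\<And>z. 0 \<le> F z" for F
  proof -
    let ?S = "closure {z. F z \<noteq> 0}"
    \<comment> \<open>Urysohn's lemma needs a compact set, so the plates are cut down to the two
      projections of the support of \<open>F\<close>; off their product \<open>F\<close> vanishes
      anyway.\<close>
    let ?K = "fst ` ?S \<union> snd ` ?S"
    have K: "compact ?K"
      using Cc_compact_support[OF F(1)]
      by (intro compact_Un compact_continuous_image) (auto intro: continuous_intros)
    have supp: "x \<in> ?K \<and> y \<in> ?K" if "F (x, y) \<noteq> 0" for x y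
      using that closure_subset[of "{z. F z \<noteq> 0}"] by force
    have cPN: "compact (?P \<inter> ?K)" "closed (?N \<inter> ?K)"
      using compact_plates[OF K] compact_imp_closed by (blast, blast)
    have "\<forall>i\<in>P. \<forall>j\<in>N. A i \<inter> A j = {}"
      using cond by (simp add: condenser_def)
    then have "?P \<inter> ?N = {}"
      by blast
    then have "(?P \<inter> ?K) \<inter> (?N \<inter> ?K) = {}"
      by blast
    with urysohn_compact_closed[OF lc cPN] obtain u :: "'a \<Rightarrow> real" where u: "continuous_on UNIV u"
        "\<forall>x. 0 \<le> u x \<and> u x \<le> 1" "\<forall>x\<in>?P \<inter> ?K. u x = 1" "\<forall>x\<in>?N \<inter> ?K. u x = 0"
      by blast
    define v where "v z = u (fst z) * u (snd z) + (1 - u (fst z)) * (1 - u (snd z))" for z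
    have "continuous_on UNIV (\<lambda>z :: 'a \<times> 'a. u (fst z))" "continuous_on UNIV (\<lambda>z :: 'a \<times> 'a. u (snd z))"
      by (rule continuous_on_compose2[OF u(1)]; auto intro: continuous_intros)+
    then have v: "continuous_on UNIV v"
      unfolding v_def by (intro continuous_intros)
    have v01: "0 \<le> v z" "v z \<le> 1" for z
    proof -
      let ?a = "u (fst z)" and ?b = "u (snd z)"
      have ab: "0 \<le> ?a" "?a \<le> 1" "0 \<le> ?b" "?b \<le> 1"
        using u(2) by auto
      then show "0 \<le> v z"
        by (simp add: v_def)
      have "?a * ?b \<le> ?a * 1" "(1 - ?a) * (1 - ?b) \<le> (1 - ?a) * 1"
        using ab by (intro mult_left_mono; simp)+
      then show "v z \<le> 1"
        by (simp add: v_def)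
    qed
    \<comment> \<open>\<open>G\<close> agrees with \<open>F\<close> where the two pure products live
      and vanishes where the mixed ones live, so \<open>?m G = ?m1 F\<close>. As \<open>G\<close>
      lies between 0 and \<open>F\<close>, it competes in the supremum that defines the positive
      part.\<close>
    define G where "G = (\<lambda>z. v z * F z)"
    have G: "G \<in> Cc"
      unfolding G_def by (rule Cc_times[OF F(1) v])
    have FG: "(\<lambda>z. F z - G z) \<in> Cc"
      using F(1) G by simp
    have uP: "u x = 1" if "x \<in> ?P" "x \<in> ?K" for x
      using u(3) that by blast
    have uN: "u x = 0" if "x \<in> ?N" "x \<in> ?K" for x
      using u(4) that by blast
    have "radon_product p p (\<lambda>z. F z - G z) = 0"
    proof (rule radon_product_vanish[OF lc pP pP FG])
      show "F (x, y) - G (x, y) = 0" if "x \<in> ?P" "y \<in> ?P" for x y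
        using supp[of x y] uP[of x] uP[of y] that by (cases "F (x, y) = 0") (auto simp: G_def v_def)
    qed
    moreover have "radon_product n n (\<lambda>z. F z - G z) = 0"
    proof (rule radon_product_vanish[OF lc nN nN FG])
      show "F (x, y) - G (x, y) = 0" if "x \<in> ?N" "y \<in> ?N" for x y
        using supp[of x y] uN[of x] uN[of y] that by (cases "F (x, y) = 0") (auto simp: G_def v_def)
    qed
    moreover have "radon_product p n G = 0"
    proof (rule radon_product_vanish[OF lc pP nN G])
      show "G (x, y) = 0" if "x \<in> ?P" "y \<in> ?N" for x y
        using supp[of x y] uP[of x] uN[of y] that by (cases "F (x, y) = 0") (auto simp: G_def v_def)
    qed
    moreover have "radon_product n p G = 0"
    proof (rule radon_product_vanish[OF lc nN pP G])
      show "G (x, y) = 0" if "x \<in> ?N" "y \<in> ?P" for x y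
        using supp[of x y] uN[of x] uP[of y] that by (cases "F (x, y) = 0") (auto simp: G_def v_def)
    qed
    ultimately have "?m G = ?m1 F"
      using prod_diff[OF p n G] pos_functional_diff[OF prod_pos[OF p p] F(1) G]
        pos_functional_diff[OF prod_pos[OF n n] F(1) G] by simp
    moreover have "?m G \<le> radon_pos ?m F"
    proof (rule dec4[OF F(1) G])
      show "0 \<le> G z" "G z \<le> F z" for z
        using v01[of z] F(2)[of z] mult_right_mono[of "v z" 1 "F z"] by (auto simp: G_def)
    qed
    ultimately show ?thesis
      by simp
  qed
  let ?h = "\<lambda>F. ?m1 F - radon_pos ?m F"
  \<comment> \<open>A positive functional that is at most 0 on nonnegative functions vanishes, by
    comparison with absolute values.\<close>
  have h: "?h F = 0" if F: "F \<in> Cc" for F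
  proof -
    have "?h (\<lambda>z. \<bar>F z\<bar>) \<le> 0"
      using le[OF Cc_abs[OF F]] by simp
    moreover have "?h F \<le> ?h (\<lambda>z. \<bar>F z\<bar>)"
      by (rule pos_functional_mono[OF dec2 F Cc_abs[OF F]]) simp
    moreover have "?h (\<lambda>z. - F z) \<le> ?h (\<lambda>z. \<bar>F z\<bar>)"
      by (rule pos_functional_mono[OF dec2 Cc_uminus[OF F] Cc_abs[OF F]]) simp
    moreover have "?h (\<lambda>z. - F z) = - ?h F"
      using pos_functional_diff[OF dec2 Cc_0 F] pos_functional_0[OF dec2] by simp
    ultimately show ?thesis
      by linarith
  qed
  have "mutual p n + mutual n p = lsc_integral (radon_neg ?m) \<kappa>"
    using dec3 h by (subst lsc_integral_prod_sum[OF p n n p, symmetric]) (auto intro!: lsc_integral_cong)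
  moreover have "lsc_integral (radon_neg ?m) \<kappa> \<noteq> \<infinity>"
    using fin lsc_integral_neq_MInf[OF kernel, of "radon_pos ?m"]
    unfolding finite_energy_def energy_defined_def radon_integral_defined_def energy_def radon_integral_def
    by (cases "lsc_integral (radon_pos ?m) \<kappa>") auto
  ultimately show "part P \<mu> \<in> energy_cone" "part N \<mu> \<in> energy_cone"
    using finite_energy_imp_cone[OF p n fin] by (simp_all add: p_def n_def)
qed

text \<open>Disjointness of all plates lets a test function be cut off so that it is unchanged on
  one plate and zero on the others; the resultant then sees the component on that plate
  alone.\<close>

lemma resultant_inject:
  assumes \<mu>: "\<mu> \<in> condenser_measures P N A" and \<nu>: "\<nu> \<in> condenser_measures P N A"
    and disj: "disjoint_family_on A (P \<union> N)"
    and eq: "condenser_resultant P N \<mu> = condenser_resultant P N \<nu>"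
  shows "\<mu> = \<nu>"
proof (rule PiE_ext)
  show "\<mu> \<in> (\<Pi>\<^sub>E i\<in>P \<union> N. radon_nonneg (A i))" "\<nu> \<in> (\<Pi>\<^sub>E i\<in>P \<union> N. radon_nonneg (A i))"
    using \<mu> \<nu> by (simp_all add: condenser_measures_def)
  fix i assume i: "i \<in> P \<union> N"
  show "\<mu> i = \<nu> i"
  proof
    fix f :: "'a \<Rightarrow> real"
    show "\<mu> i f = \<nu> i f"
    \<comment> \<open>When the plate meets the support, \<open>i\<close> occurs in the finite sum
      for the resultant; otherwise both components vanish at \<open>f\<close>.\<close>
    proof (cases "f \<in> Cc \<and> A i \<inter> closure {x. f x \<noteq> 0} \<noteq> {}")
      case False
      then have "\<rho> i f = 0" if "\<rho> \<in> condenser_measures P N A" for \<rho>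
        using measures_nonneg[OF that i] radon_outside[of "\<rho> i" f]
        by (cases "f \<in> Cc") (auto simp: radon_nonneg_def Int_commute)
      from this[OF \<mu>] this[OF \<nu>] show ?thesis
        by simp
    next
      case True
      then have f: "f \<in> Cc"
        by simp
      let ?K = "closure {x. f x \<noteq> 0}"
      let ?J = "P \<union> N - {i}"
      have K: "compact ?K"
        by (rule Cc_compact_support[OF f])
      have "compact (A i \<inter> ?K)" "closed ((\<Union>j\<in>?J. A j) \<inter> ?K)"
        using compact_plates[OF K, of "{i}"] compact_plates[OF K, of ?J] i compact_imp_closed
        by auto
      moreover have "(A i \<inter> ?K) \<inter> ((\<Union>j\<in>?J. A j) \<inter> ?K) = {}"
        using disj i unfolding disjoint_family_on_def by blast
      ultimately obtain u :: "'a \<Rightarrow> real" where u: "continuous_on UNIV u"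
          "\<forall>x\<in>A i \<inter> ?K. u x = 1" "\<forall>x\<in>(\<Union>j\<in>?J. A j) \<inter> ?K. u x = 0"
        using urysohn_compact_closed[OF lc, of "A i \<inter> ?K" "(\<Union>j\<in>?J. A j) \<inter> ?K"] by auto
      have inK: "x \<in> ?K" if "f x \<noteq> 0" for x
        using that closure_subset[of "{x. f x \<noteq> 0}"] by blast
      let ?h = "\<lambda>x. u x * f x"
      have h: "?h \<in> Cc"
        by (rule Cc_times[OF f u(1)])
      have hK: "closure {x. ?h x \<noteq> 0} \<subseteq> ?K"
        by (intro closure_mono) auto
      have "condenser_resultant P N \<rho> ?h = condenser_sign P i * \<rho> i f"
        if \<rho>: "\<rho> \<in> condenser_measures P N A" for \<rho>
      proof -
        have other: "\<rho> j ?h = 0" if j: "j \<in> P \<union> N" "j \<noteq> i" for j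
        proof (rule radon_nonneg_vanish[OF measures_nonneg[OF \<rho> j(1)] h])
          show "u x * f x = 0" if "x \<in> A j" for x
            using inK[of x] u(3) j that by (cases "f x = 0") auto
        qed
        have "\<rho> i (\<lambda>x. f x - ?h x) = 0"
        proof (rule radon_nonneg_vanish[OF measures_nonneg[OF \<rho> i]])
          show "f x - u x * f x = 0" if "x \<in> A i" for x
            using inK[of x] u(2) that by (cases "f x = 0") auto
        qed (use f h in simp)
        then have "\<rho> i ?h = \<rho> i f"
          using pos_functional_diff[OF radon_nonneg_pos_functional[OF measures_nonneg[OF \<rho> i]] f h] by simp
        have "condenser_resultant P N \<rho> ?h =
            (\<Sum>j | j \<in> P \<union> N \<and> A j \<inter> ?K \<noteq> {}. condenser_sign P j * \<rho> j ?h)"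
          by (rule resultant_eq_sum[OF \<rho> h K hK])
        also have "\<dots> = (\<Sum>j\<in>{i}. condenser_sign P j * \<rho> j ?h)"
          using plates_finite[OF K order_refl] i True other by (intro sum.mono_neutral_right) auto
        finally show ?thesis
          using \<open>\<rho> i ?h = \<rho> i f\<close> by simp
      qed
      from this[OF \<mu>, unfolded eq, symmetric] this[OF \<nu>] have "condenser_sign P i * \<mu> i f = condenser_sign P i * \<nu> i f"
        by (rule trans)
      moreover have "condenser_sign P i \<noteq> 0"
        by (simp add: condenser_sign_def)
      ultimately show ?thesis
        by simp
    qed
  qed
qed

end

section \<open>Completeness\<close>

text \<open>On \<open>E\<close> the function \<open>c * f\<close> is at most \<open>c\<close>, hence
  at most \<open>g\<close>. Its minimum with \<open>g\<close> is thus the same function for the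
  measure, and it is a minorant of \<open>g\<close> everywhere.\<close>

lemma constraint_mass_bound:
  fixes g :: "'a::topological_space \<Rightarrow> real"
  assumes \<nu>: "\<nu> \<in> radon_nonneg E" and g: "continuous_on UNIV g" "\<And>x. 0 < g x"
    and c: "0 < c" "\<And>x. x \<in> E \<Longrightarrow> c \<le> g x" and a: "lsc_integral \<nu> (\<lambda>x. ereal (g x)) \<le> ereal a"
    and f: "f \<in> Cc" "\<And>x. 0 \<le> f x" "\<And>x. f x \<le> 1"
  shows "\<nu> f \<le> a / c"
proof -
  let ?f = "\<lambda>x. c * f x" and ?h = "\<lambda>x. min (c * f x) (g x)"
  have cf: "?f \<in> Cc"
    using f(1) by (rule Cc_cmult)
  have h: "?h \<in> Cc"
  proof (rule Cc_support[OF _ f(1)])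
    show "continuous_on UNIV ?h"
      using Cc_continuous[OF cf] g(1) by (rule continuous_on_min)
    show "?h x = 0" if "f x = 0" for x
      using that g(2)[of x] by simp
  qed
  have "\<nu> (\<lambda>x. ?f x - ?h x) = 0"
  proof (rule radon_nonneg_vanish[OF \<nu> Cc_diff[OF cf h]])
    show "?f x - ?h x = 0" if "x \<in> E" for x
    proof -
      have "c * f x \<le> c * 1"
        using c(1) f(3) by (intro mult_left_mono) auto
      then show ?thesis
        using c(2)[OF that] by simp
    qed
  qed
  then have "\<nu> ?f = \<nu> ?h"
    using pos_functional_diff[OF radon_nonneg_pos_functional[OF \<nu>] cf h] by simp
  moreover have "ereal (\<nu> ?h) \<le> lsc_integral \<nu> (\<lambda>x. ereal (g x))"
    unfolding lsc_integral_def using h by (intro SUP_upper) auto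
  then have "ereal (\<nu> ?h) \<le> ereal a"
    using a by (rule order_trans)
  ultimately have "c * \<nu> f \<le> a"
    using radon_cmult[OF radon_nonneg_radon[OF \<nu>] f(1), of c] by simp
  then show ?thesis
    using c(1) by (simp add: field_simps)
qed

section \<open>Uniform bounds and vague compactness for the admissible families\<close>

locale condenser_problem = condenser_kernel \<kappa> P N A
  for \<kappa> :: "'a::t2_space \<times> 'a \<Rightarrow> ereal" and P N :: "nat set" and A :: "nat \<Rightarrow> 'a set" +
  fixes g :: "nat \<Rightarrow> 'a \<Rightarrow> real" and a :: "nat \<Rightarrow> real"
  assumes cons: "consistent \<kappa>"
    and g_cont: "\<And>i. i \<in> P \<union> N \<Longrightarrow> continuous_on UNIV (g i)"
    and g_pos: "\<And>i x. i \<in> P \<union> N \<Longrightarrow> 0 < g i x"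
    and a_pos: "\<And>i. i \<in> P \<union> N \<Longrightarrow> 0 < a i"
    and bound: "N = {} \<or>
      (\<Sum>\<^sub>\<infinity>i\<in>P \<union> N. ennreal (a i) / ennreal (INF x\<in>A i. g i x)) < \<infinity> \<and>
      (SUP (x, y)\<in>(\<Union>i\<in>P. A i) \<times> (\<Union>i\<in>N. A i). \<kappa> (x, y)) < \<infinity>"
begin

text \<open>The energy condition is kept apart, since a vague cluster point inherits the constraints
  before its energy is known to be finite.\<close>

definition constrained :: "(nat \<Rightarrow> ('a \<Rightarrow> real) \<Rightarrow> real) set" where
  "constrained = {\<mu> \<in> condenser_measures P N A.
     \<forall>i\<in>P \<union> N. lsc_integral (\<mu> i) (\<lambda>x. ereal (g i x)) \<le> ereal (a i)}"

lemma energy_le_iff: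
  "\<mu> \<in> condenser_energy_le \<kappa> P N A a g \<longleftrightarrow>
    \<mu> \<in> constrained \<and> condenser_resultant P N \<mu> \<in> finite_energy \<kappa>"
  by (auto simp: condenser_energy_le_def condenser_finite_energy_def constrained_def)

lemma constrained_measures: "\<mu> \<in> constrained \<Longrightarrow> \<mu> \<in> condenser_measures P N A"
  by (simp add: constrained_def)

text \<open>Adding the mass bounds of the single plates gives a \<open>T\<close> that depends
  neither on the family nor on \<open>J\<close>. A test function meets finitely many plates, so each
  estimate involves a partial sum of the convergent series.\<close>

lemma part_mass_bounded:
  assumes fin: "(\<Sum>\<^sub>\<infinity>i\<in>P \<union> N. ennreal (a i) / ennreal (INF x\<in>A i. g i x)) < \<infinity>"
  obtains T where "\<And>\<mu> J f. \<mu> \<in> constrained \<Longrightarrow> J \<subseteq> P \<union> N \<Longrightarrow> f \<in> Cc \<Longrightarrow> (\<And>x. 0 \<le> f x) \<Longrightarrow>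
    (\<And>x. f x \<le> 1) \<Longrightarrow> part J \<mu> f \<le> T"
proof -
  let ?c = "\<lambda>i. INF x\<in>A i. g i x" and ?t = "\<lambda>i. ennreal (a i) / ennreal (INF x\<in>A i. g i x)"
  let ?S = "\<Sum>\<^sub>\<infinity>i\<in>P \<union> N. ?t i"
  have sum_le: "sum ?t B \<le> ?S" if "finite B" "B \<subseteq> P \<union> N" for B
  proof -
    have "infsum ?t B \<le> infsum ?t (P \<union> N)"
      using that by (intro infsum_mono_neutral nonneg_summable_on_complete) auto
    then show ?thesis
      using that by simp
  qed
  have c: "0 < ?c i" if i: "i \<in> P \<union> N" for i
  proof (rule ccontr)
    assume "\<not> 0 < ?c i"
    \<comment> \<open>\<open>ennreal\<close> sends an infimum that is not positive to 0, and a
      positive \<open>a i\<close> over 0 would make the series infinite.\<close>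
    then have "?t i = \<infinity>"
      using a_pos[OF i] by (simp add: ennreal_neg ennreal_divide_zero)
    then show False
      using sum_le[of "{i}"] i fin by (simp add: top_unique)
  qed
  have c_le: "?c i \<le> g i x" if "i \<in> P \<union> N" "x \<in> A i" for i x
    using that g_pos[OF that(1)] by (intro cINF_lower bdd_belowI2[of _ 0]) (auto intro: less_imp_le)
  have "part J \<mu> f \<le> enn2real ?S"
    if \<mu>: "\<mu> \<in> constrained" and J: "J \<subseteq> P \<union> N" and f: "f \<in> Cc" "\<And>x. 0 \<le> f x" "\<And>x. f x \<le> 1" for \<mu> J f
  proof -
    have m: "\<mu> \<in> condenser_measures P N A"
      using \<mu> by (rule constrained_measures)
    let ?B = "{i \<in> J. A i \<inter> closure {x. f x \<noteq> 0} \<noteq> {}}"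
    have B: "finite ?B" "?B \<subseteq> P \<union> N"
      using plates_finite[OF Cc_compact_support[OF f(1)] J] J by auto
    have "part J \<mu> f = (\<Sum>i\<in>?B. \<mu> i f)"
      by (rule part_eq[OF m J f(1)])
    also have "\<dots> \<le> (\<Sum>i\<in>?B. a i / ?c i)"
    proof (rule sum_mono)
      fix i assume "i \<in> ?B"
      then have i: "i \<in> P \<union> N"
        using B by blast
      then have a: "lsc_integral (\<mu> i) (\<lambda>x. ereal (g i x)) \<le> ereal (a i)"
        using \<mu> by (simp add: constrained_def)
      show "\<mu> i f \<le> a i / ?c i"
        by (rule constraint_mass_bound[OF measures_nonneg[OF m i] g_cont[OF i] g_pos[OF i] c[OF i] c_le[OF i] a f])
    qed
    also have "\<dots> \<le> enn2real ?S"
    proof -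
      have nn: "0 \<le> a i / ?c i" if "i \<in> ?B" for i
        using a_pos[of i] c[of i] B that by (auto intro!: divide_nonneg_nonneg simp: less_imp_le subset_iff)
      have "ennreal (\<Sum>i\<in>?B. a i / ?c i) = (\<Sum>i\<in>?B. ennreal (a i / ?c i))"
        by (rule sum_ennreal[symmetric]) (rule nn)
      also have "\<dots> = sum ?t ?B"
      proof (rule sum.cong)
        fix i assume "i \<in> ?B"
        then show "ennreal (a i / ?c i) = ?t i"
          using divide_ennreal[of "a i" "?c i"] a_pos[of i] c[of i] B(2) by (auto simp: less_imp_le subset_iff)
      qed simp
      also have "\<dots> \<le> ?S"
        by (rule sum_le[OF B])
      finally have "enn2real (ennreal (\<Sum>i\<in>?B. a i / ?c i)) \<le> enn2real ?S"
        using fin by (intro enn2real_mono) (simp_all add: less_top)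
      then show ?thesis
        using sum_nonneg[of ?B "\<lambda>i. a i / ?c i"] nn by simp
    qed
    finally show ?thesis .
  qed
  then show ?thesis
    using that by blast
qed

text \<open>Each minorant of the kernel in \<open>Cc\<close> is at most \<open>M\<close> on
  \<open>E \<times> E'\<close>; the mass bound is used once for the inner and once for the outer
  integral.\<close>

lemma mutual_le:
  assumes p: "p \<in> radon_nonneg E" and n: "n \<in> radon_nonneg E'" and M: "0 \<le> M"
    and \<kappa>: "\<And>x y. x \<in> E \<Longrightarrow> y \<in> E' \<Longrightarrow> \<kappa> (x, y) \<le> ereal M"
    and Tp: "\<And>h. h \<in> Cc \<Longrightarrow> (\<And>x. 0 \<le> h x) \<Longrightarrow> (\<And>x. h x \<le> 1) \<Longrightarrow> p h \<le> T"
    and Tn: "\<And>h. h \<in> Cc \<Longrightarrow> (\<And>x. 0 \<le> h x) \<Longrightarrow> (\<And>x. h x \<le> 1) \<Longrightarrow> n h \<le> T"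
  shows "mutual p n \<le> ereal (M * T * T)"
  unfolding mutual_def lsc_integral_def
proof (rule SUP_least)
  fix F assume "F \<in> {F \<in> Cc. \<forall>z. ereal (F z) \<le> \<kappa> z}"
  then have F: "F \<in> Cc" "\<And>z. ereal (F z) \<le> \<kappa> z"
    by auto
  have T: "0 \<le> T"
    using Tp[of "\<lambda>_. 0"] pos_functional_0[OF radon_nonneg_pos_functional[OF p]] by simp
  have "n (\<lambda>y. F (x, y)) \<le> M * T" if x: "x \<in> E" for x
  proof (rule radon_nonneg_mass_bound[OF n Cc_section[OF F(1)] M _ Tn])
    show "F (x, y) \<le> M" if "y \<in> E'" for y
      using order_trans[OF F(2) \<kappa>[OF x that]] by simp
  qed
  then have "p (\<lambda>x. n (\<lambda>y. F (x, y))) \<le> M * T * T"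
    using M T by (intro radon_nonneg_mass_bound[OF p Cc_integral_section[OF lc n F(1)] _ _ Tp]) auto
  then show "ereal (radon_product p n F) \<le> ereal (M * T * T)"
    using F(1) by (simp add: radon_product_def)
qed

text \<open>The alternative in \<open>bound\<close> enters here: without negative plates the mixed
  energy is 0, otherwise bounded masses and a kernel bounded above between the two groups of plates
  control it.\<close>

lemma mixed_energy_bounded:
  obtains D where "0 \<le> D" "\<And>\<mu>. \<mu> \<in> constrained \<Longrightarrow>
    mutual (part P \<mu>) (part N \<mu>) + mutual (part N \<mu>) (part P \<mu>) \<le> ereal D"
proof (cases "N = {}")
  case True
  have "mutual (part P \<mu>) (part N \<mu>) + mutual (part N \<mu>) (part P \<mu>) \<le> ereal 0" if "\<mu> \<in> constrained" for \<mu>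
  proof -
    have "part N \<mu> = (\<lambda>_. 0)"
      using True by (auto simp: part_def)
    then show ?thesis
      using mutual_0[OF part_UNIV[OF constrained_measures[OF that], of P]] by simp
  qed
  then show ?thesis
    using that[of 0] by simp
next
  case False
  let ?P = "\<Union>i\<in>P. A i" and ?N = "\<Union>i\<in>N. A i"
  let ?S = "SUP (x, y)\<in>?P \<times> ?N. \<kappa> (x, y)"
  \<comment> \<open>The supremum of the kernel may be negative; the maximum with 0 supplies the
    nonnegative bound that the mass estimates require.\<close>
  define M where "M = max 0 (real_of_ereal ?S)"
  have M: "0 \<le> M"
    by (simp add: M_def)
  have \<kappa>: "\<kappa> (x, y) \<le> ereal M" if "x \<in> ?P" "y \<in> ?N" for x y
  proof -
    have "\<kappa> (x, y) \<le> ?S"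
      using that by (intro SUP_upper2[of "(x, y)"]) auto
    also have "?S \<le> ereal M"
      using False bound unfolding M_def by (cases ?S) (auto simp: max_def)
    finally show ?thesis .
  qed
  have \<kappa>': "\<kappa> (y, x) \<le> ereal M" if "y \<in> ?N" "x \<in> ?P" for x y
    using \<kappa>[OF that(2,1)] pd by (simp add: positive_definite_def)
  obtain T where T: "\<And>\<mu> J f. \<mu> \<in> constrained \<Longrightarrow> J \<subseteq> P \<union> N \<Longrightarrow> f \<in> Cc \<Longrightarrow> (\<And>x. 0 \<le> f x) \<Longrightarrow>
      (\<And>x. f x \<le> 1) \<Longrightarrow> part J \<mu> f \<le> T"
    using part_mass_bounded bound False by blast
  have "mutual (part P \<mu>) (part N \<mu>) + mutual (part N \<mu>) (part P \<mu>) \<le> ereal (2 * (M * T * T))"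
    if \<mu>: "\<mu> \<in> constrained" for \<mu>
  proof -
    note m = part_radon_nonneg[OF constrained_measures[OF \<mu>]]
    have "mutual (part P \<mu>) (part N \<mu>) \<le> ereal (M * T * T)"
      by (rule mutual_le[OF m m M \<kappa>]) (auto intro: T[OF \<mu>])
    moreover have "mutual (part N \<mu>) (part P \<mu>) \<le> ereal (M * T * T)"
      by (rule mutual_le[OF m m M \<kappa>']) (auto intro: T[OF \<mu>])
    ultimately have "mutual (part P \<mu>) (part N \<mu>) + mutual (part N \<mu>) (part P \<mu>)
        \<le> ereal (M * T * T) + ereal (M * T * T)"
      by (rule add_mono)
    then show ?thesis
      by (simp add: mult.assoc)
  qed
  moreover have "0 \<le> 2 * (M * T * T)"
    using M by (simp add: mult.assoc)
  ultimately show ?thesis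
    using that by blast
qed

lemma energy_le_parts:
  assumes "\<mu> \<in> condenser_energy_le \<kappa> P N A a g"
  shows "part P \<mu> \<in> energy_cone" "part N \<mu> \<in> energy_cone" "condenser_resultant P N \<mu> \<in> energy_span"
proof -
  have \<mu>: "\<mu> \<in> condenser_finite_energy \<kappa> P N A"
    using assms by (simp add: condenser_energy_le_def)
  show "part P \<mu> \<in> energy_cone" "part N \<mu> \<in> energy_cone"
    by (rule finite_energy_parts[OF \<mu>])+
  then show "condenser_resultant P N \<mu> \<in> energy_span"
    using resultant_eq_parts[of \<mu>] \<mu> by (simp add: condenser_finite_energy_def energy_span_diff_cone)
qed

text \<open>In the expansion of the energy of the resultant the negative part contributes a
  nonnegative term and the mixed terms subtract at most \<open>D\<close>.\<close>

lemma quad_part_bounded: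
  obtains D where "\<And>\<mu>. \<mu> \<in> condenser_energy_le \<kappa> P N A a g \<Longrightarrow>
    quad (part P \<mu>) \<le> quad (condenser_resultant P N \<mu>) + D"
proof -
  obtain D where D: "\<And>\<mu>. \<mu> \<in> constrained \<Longrightarrow>
    mutual (part P \<mu>) (part N \<mu>) + mutual (part N \<mu>) (part P \<mu>) \<le> ereal D"
    using mixed_energy_bounded by blast
  have "quad (part P \<mu>) \<le> quad (condenser_resultant P N \<mu>) + D"
    if \<mu>: "\<mu> \<in> condenser_energy_le \<kappa> P N A a g" for \<mu>
  proof -
    let ?p = "part P \<mu>" and ?n = "part N \<mu>"
    have cone: "?p \<in> energy_cone" "?n \<in> energy_cone"
      using energy_le_parts[OF \<mu>] by auto
    have c: "\<mu> \<in> constrained"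
      using \<mu> by (simp add: energy_le_iff)
    have self: "quad q = mut q q" if "q \<in> energy_cone" for q
      using quad_diff_cone(1)[OF that energy_cone_zero] mutual_0[OF energy_cone_radon[OF that]]
        mutual_0[OF radon_nonneg_zero[OF lc]] by (simp add: mut_def)
    have "quad (condenser_resultant P N \<mu>) = mut ?p ?p + mut ?n ?n - mut ?p ?n - mut ?n ?p"
      unfolding resultant_eq_parts[OF constrained_measures[OF c]] by (rule quad_diff_cone(1)[OF cone])
    moreover have "mut ?p ?n + mut ?n ?p \<le> D"
      using D[OF c] cone by (simp add: mutual_eq_mut)
    moreover have "0 \<le> mut ?n ?n"
      using quad_nonneg[OF energy_cone_subset_span[OF cone(2)]] self[OF cone(2)] by simp
    ultimately show ?thesis
      using self[OF cone(1)] by simp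
  qed
  then show ?thesis
    using that by blast
qed

text \<open>Tychonoff's theorem: the constraints confine the value at each plate and test function
  to a compact interval independent of the family.\<close>

lemma constrained_cluster_limit:
  assumes F: "F \<noteq> bot" and ev: "\<forall>\<^sub>F s in F. x s \<in> constrained"
  obtains z F' where "F' \<le> F" "F' \<noteq> bot" "limitin (condenser_vague_topology P N A) x z F'"
proof -
  let ?I = "P \<union> N"
  have "\<exists>B. \<forall>\<mu>\<in>constrained. i \<in> ?I \<longrightarrow> \<bar>\<mu> i f\<bar> \<le> B" for i f
  proof (cases "i \<in> ?I \<and> f \<in> Cc")
    case True
    then obtain B where B: "\<And>\<nu> E. \<nu> \<in> radon_nonneg E \<Longrightarrow> lsc_integral \<nu> (\<lambda>x. ereal (g i x)) \<le> ereal (a i) \<Longrightarrow> \<bar>\<nu> f\<bar> \<le> B"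
      using constraint_imp_bounded[of f "g i" "a i"] g_cont[of i] g_pos[of i] by blast
    have "\<bar>\<mu> i f\<bar> \<le> B" if "\<mu> \<in> constrained" for \<mu>
    proof (rule B)
      show "\<mu> i \<in> radon_nonneg (A i)"
        using measures_nonneg[OF constrained_measures[OF that]] True by blast
      show "lsc_integral (\<mu> i) (\<lambda>x. ereal (g i x)) \<le> ereal (a i)"
        using that True by (simp add: constrained_def)
    qed
    then show ?thesis
      by blast
  next
    case False
    then show ?thesis
      using measures_nonneg[OF constrained_measures, of _ i] radon_outside[OF radon_nonneg_radon, of _ _ f]
      by (intro exI[of _ 0]) fastforce
  qed
  then obtain B where B: "\<And>i f \<mu>. \<mu> \<in> constrained \<Longrightarrow> i \<in> ?I \<Longrightarrow> \<bar>\<mu> i f\<bar> \<le> B i f"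
    by metis
  \<comment> \<open>The net is read as one function on pairs of an index and a test function, so
    that a single product of intervals contains it. Off the index set 0 replaces the
    \<open>undefined\<close> of extensional families.\<close>
  define y where "y s = (\<lambda>(i, f). if i \<in> ?I then x s i f else 0)" for s
  let ?U = "PiE UNIV (\<lambda>(i, f). {- \<bar>B i f\<bar>..\<bar>B i f\<bar>})"
  have "compactin (product_topology (\<lambda>_. euclidean) UNIV) ?U"
    unfolding compactin_PiE by auto
  then have U: "compact ?U"
    by (simp add: euclidean_product_topology)
  have "\<forall>\<^sub>F s in F. y s \<in> ?U"
    using ev
  proof eventually_elim
    case (elim s)
    have "\<bar>x s i f\<bar> \<le> \<bar>B i f\<bar>" if "i \<in> ?I" for i f
      using B[OF elim that, of f] by simp
    then show ?case
      by (auto simp: y_def abs_le_iff minus_le_iff)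
  qed
  then obtain w F' where F': "F' \<le> F" "F' \<noteq> bot" "(y \<longlongrightarrow> w) F'"
    using compact_imp_cluster_limit[OF U F] by blast
  define z where "z = restrict (\<lambda>i f. w (i, f)) ?I"
  have lim: "((\<lambda>s. x s i f) \<longlongrightarrow> z i f) F'" if "i \<in> ?I" for i f
    using F'(3)[unfolded tendsto_fun_iff, rule_format, of "(i, f)"] that by (simp add: y_def z_def)
  have ev': "\<forall>\<^sub>F s in F'. x s \<in> condenser_measures P N A"
    using filter_leD[OF F'(1) ev] by eventually_elim (rule constrained_measures)
  have "z i \<in> radon_nonneg (A i)" if "i \<in> ?I" for i
  proof (rule radon_nonneg_limit[OF lc F'(2)])
    show "\<forall>\<^sub>F s in F'. x s i \<in> radon_nonneg (A i)"
      using ev' by eventually_elim (rule measures_nonneg[OF _ that])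
  qed (rule lim[OF that])
  then have "z \<in> condenser_measures P N A"
    by (auto simp: condenser_measures_def z_def)
  then have "limitin (condenser_vague_topology P N A) x z F'"
    using lim ev' by (simp add: limitin_condenser_vague_iff)
  then show ?thesis
    using that F' by blast
qed

section \<open>Strong Cauchy nets and their vague cluster points\<close>

lemma condenser_dist_quad:
  "condenser_dist \<kappa> P N \<mu> \<nu> = sqrt (quad (\<lambda>f. condenser_resultant P N \<mu> f - condenser_resultant P N \<nu> f))"
  by (simp add: condenser_dist_def energy_dist_quad)

text \<open>The cluster point is a vague limit along a finer filter, where
  \<open>cluster_point_strong_limit\<close> makes it a strong limit. The Cauchy property carries
  strong convergence back to \<open>F\<close>.\<close>

lemma cauchy_cluster_point_limit:
  assumes F: "F \<noteq> bot" and ev: "\<forall>\<^sub>F s in F. x s \<in> condenser_energy_le \<kappa> P N A a g"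
    and cauchy: "cauchy_along (condenser_dist \<kappa> P N) x F"
    and cluster: "cluster_point_along (condenser_vague_topology P N A) x F z"
  shows "z \<in> condenser_energy_le \<kappa> P N A a g"
    and "((\<lambda>s. condenser_dist \<kappa> P N (x s) z) \<longlongrightarrow> 0) F"
proof -
  define R where "R s = condenser_resultant P N (x s)" for s
  define p where "p s = part P (x s)" for s
  define n where "n s = part N (x s)" for s
  have R_span: "\<forall>\<^sub>F s in F. R s \<in> energy_span"
    using ev by eventually_elim (simp add: R_def energy_le_parts)
  have R_pn: "\<forall>\<^sub>F s in F. R s = (\<lambda>f. p s f - n s f)"
    using ev
    by eventually_elim (simp add: R_def p_def n_def resultant_eq_parts energy_le_iff constrained_measures)
  have cauchy': "\<exists>Q Q'. eventually Q F \<and> eventually Q' F \<and>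
      (\<forall>s t. Q s \<and> Q' t \<longrightarrow> R s \<in> energy_span \<and> R t \<in> energy_span \<and> quad (\<lambda>f. R s f - R t f) < e)"
    if e: "0 < e" for e
  proof -
    obtain Q Q' where Q: "eventually Q F" "eventually Q' F"
        "\<forall>s t. Q s \<longrightarrow> Q' t \<longrightarrow> condenser_dist \<kappa> P N (x s) (x t) < sqrt e"
      using cauchy e unfolding cauchy_along_def eventually_prod_filter
      by (metis (no_types, lifting) case_prod_conv real_sqrt_gt_0_iff)
    then have "\<forall>s t. (Q s \<and> R s \<in> energy_span) \<and> (Q' t \<and> R t \<in> energy_span) \<longrightarrow>
        R s \<in> energy_span \<and> R t \<in> energy_span \<and> quad (\<lambda>f. R s f - R t f) < e"
      by (simp add: condenser_dist_quad R_def)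
    moreover have "\<forall>\<^sub>F s in F. Q s \<and> R s \<in> energy_span" "\<forall>\<^sub>F s in F. Q' s \<and> R s \<in> energy_span"
      using Q R_span by (auto intro: eventually_conj)
    ultimately show ?thesis
      by blast
  qed

  obtain F' where F': "F' \<le> F" "F' \<noteq> bot" "limitin (condenser_vague_topology P N A) x z F'"
    using cluster_point_finer_filter[OF cluster] by blast
  have z: "z \<in> condenser_measures P N A" and ev': "\<forall>\<^sub>F s in F'. x s \<in> condenser_measures P N A"
    and lim: "\<And>i f. i \<in> P \<union> N \<Longrightarrow> ((\<lambda>s. x s i f) \<longlongrightarrow> z i f) F'"
    using F'(3) by (auto simp: limitin_condenser_vague_iff)
  have z_con: "z \<in> constrained"
    unfolding constrained_def
  proof (intro CollectI conjI ballI z)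
    fix i assume i: "i \<in> P \<union> N"
    show "lsc_integral (z i) (\<lambda>x. ereal (g i x)) \<le> ereal (a i)"
    proof (rule lsc_integral_limit[OF F'(2) lim[OF i]])
      show "\<forall>\<^sub>F s in F'. lsc_integral (x s i) (\<lambda>x. ereal (g i x)) \<le> ereal (a i)"
        using filter_leD[OF F'(1) ev] by eventually_elim (use i in \<open>simp add: condenser_energy_le_def\<close>)
    qed
  qed

  obtain D where D: "\<And>\<mu>. \<mu> \<in> condenser_energy_le \<kappa> P N A a g \<Longrightarrow>
      quad (part P \<mu>) \<le> quad (condenser_resultant P N \<mu>) + D"
    using quad_part_bounded by blast
  obtain Q Q' where Q: "eventually Q F" "eventually Q' F"
      "\<And>s t. Q s \<Longrightarrow> Q' t \<Longrightarrow> R s \<in> energy_span \<and> R t \<in> energy_span \<and> quad (\<lambda>f. R s f - R t f) < 1"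
    using cauchy'[of 1] by auto
  obtain t where t: "Q' t"
    using eventually_happens'[OF F Q(2)] by blast
  \<comment> \<open>From some index on, the resultants are at squared distance less than 1 from the
    fixed \<open>R t\<close>; the triangle estimate bounds their energy by
    \<open>2 + 2 * quad (R t)\<close>, and \<open>D\<close> accounts for the mixed terms.\<close>
  have bdd: "\<forall>\<^sub>F s in F. p s \<in> energy_cone \<and> n s \<in> energy_cone \<and> quad (p s) \<le> 2 + 2 * quad (R t) + D"
    using ev Q(1)
  proof eventually_elim
    case (elim s)
    have "quad (R s) \<le> 2 * quad (\<lambda>f. R s f - R t f) + 2 * quad (R t)"
      using quad_add_le[of "\<lambda>f. R s f - R t f" "R t"] Q(3)[OF elim(2) t] energy_span_add_diff(2)[of "R s" "R t"]
      by simp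
    then show ?case
      using D[OF elim(1)] Q(3)[OF elim(2) t] energy_le_parts[OF elim(1)] by (simp add: p_def n_def R_def)
  qed
  have cauchy_F': "\<forall>\<^sub>F (s, t) in F' \<times>\<^sub>F F'. quad (\<lambda>f. (p s f - n s f) - (p t f - n t f)) < e"
    if e: "0 < e" for e
  proof -
    obtain Q Q' where Q: "eventually Q F" "eventually Q' F"
      "\<And>s t. Q s \<Longrightarrow> Q' t \<Longrightarrow> quad (\<lambda>f. R s f - R t f) < e"
      using cauchy'[OF e] by blast
    have "eventually (\<lambda>s. Q s \<and> R s = (\<lambda>f. p s f - n s f)) F'"
        "eventually (\<lambda>s. Q' s \<and> R s = (\<lambda>f. p s f - n s f)) F'"
      using Q(1,2) R_pn F'(1) by (auto intro: eventually_conj filter_leD)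
    moreover have "quad (\<lambda>f. (p s f - n s f) - (p t f - n t f)) < e"
      if "Q s \<and> R s = (\<lambda>f. p s f - n s f)" "Q' t \<and> R t = (\<lambda>f. p t f - n t f)" for s t
      using Q(3)[of s t] that by simp
    ultimately show ?thesis
      unfolding eventually_prod_filter case_prod_conv by (intro exI conjI) blast+
  qed
  have conv: "(p \<longlongrightarrow> part P z) F'" "(n \<longlongrightarrow> part N z) F'"
    unfolding p_def n_def by (rule part_tendsto[OF ev' z lim]; blast)+
  note limit = cluster_point_strong_limit[OF cons F'(2) filter_leD[OF F'(1) bdd] cauchy_F' conv
      part_UNIV[OF z] part_UNIV[OF z]]
  have Rz: "condenser_resultant P N z = (\<lambda>f. part P z f - part N z f)"
    by (rule resultant_eq_parts[OF z])
  have Rz_span: "condenser_resultant P N z \<in> energy_span"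
    unfolding Rz using limit(1,2) by (intro energy_span_diff_cone) auto
  show "z \<in> condenser_energy_le \<kappa> P N A a g"
    using z_con Rz_span energy_span_finite_energy by (simp add: energy_le_iff)
  have "((\<lambda>s. quad (\<lambda>f. (p s f - n s f) - condenser_resultant P N z f)) \<longlongrightarrow> 0) F'"
    using limit(3) Rz by simp
  then have lim_F': "((\<lambda>s. quad (\<lambda>f. R s f - condenser_resultant P N z f)) \<longlongrightarrow> 0) F'"
    by (rule Lim_transform_eventually) (use filter_leD[OF F'(1) R_pn] in eventually_elim, simp)
  have "((\<lambda>s. quad (\<lambda>f. R s f - condenser_resultant P N z f)) \<longlongrightarrow> 0) F"
    unfolding tendsto_iff
  proof (intro allI impI)
    fix e :: real assume e: "0 < e"
    \<comment> \<open>Two terms below \<open>e / 4\<close>, each doubled by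
      \<open>quad_triangle\<close>, add up to less than \<open>e\<close>.\<close>
    then have "0 < e / 4"
      by simp
    from cauchy'[OF this] obtain Q Q' where Q: "eventually Q F" "eventually Q' F"
        "\<And>s t. Q s \<Longrightarrow> Q' t \<Longrightarrow> R s \<in> energy_span \<and> R t \<in> energy_span \<and> quad (\<lambda>f. R s f - R t f) < e / 4"
      by blast
    have "\<forall>\<^sub>F t in F'. dist (quad (\<lambda>f. R t f - condenser_resultant P N z f)) 0 < e / 4"
      using lim_F' \<open>0 < e / 4\<close> by (rule tendstoD)
    then have "\<forall>\<^sub>F t in F'. Q' t \<and> dist (quad (\<lambda>f. R t f - condenser_resultant P N z f)) 0 < e / 4"
      using filter_leD[OF F'(1) Q(2)] by (auto intro: eventually_conj)
    then obtain t where t: "Q' t" "dist (quad (\<lambda>f. R t f - condenser_resultant P N z f)) 0 < e / 4"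
      using eventually_happens'[OF F'(2)] by blast
    show "\<forall>\<^sub>F s in F. dist (quad (\<lambda>f. R s f - condenser_resultant P N z f)) 0 < e"
      using Q(1)
    proof eventually_elim
      case (elim s)
      note st = Q(3)[OF elim t(1)]
      have "quad (\<lambda>f. R s f - condenser_resultant P N z f) < e"
        using quad_triangle[OF st[THEN conjunct1] st[THEN conjunct2, THEN conjunct1] Rz_span]
          st[THEN conjunct2, THEN conjunct2] t(2) by (simp add: dist_real_def)
      moreover have "0 \<le> quad (\<lambda>f. R s f - condenser_resultant P N z f)"
        using st Rz_span by (intro quad_nonneg energy_span_add_diff) auto
      ultimately show ?case
        by (simp add: dist_real_def)
    qed
  qed
  then have "((\<lambda>s. sqrt (quad (\<lambda>f. R s f - condenser_resultant P N z f))) \<longlongrightarrow> sqrt 0) F"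
    by (rule tendsto_real_sqrt)
  then show "((\<lambda>s. condenser_dist \<kappa> P N (x s) z) \<longlongrightarrow> 0) F"
    by (simp add: condenser_dist_quad R_def)
qed

lemma energy_le_cluster_point_exists:
  assumes "F \<noteq> bot" "\<forall>\<^sub>F s in F. x s \<in> condenser_energy_le \<kappa> P N A a g"
  obtains z where "cluster_point_along (condenser_vague_topology P N A) x F z"
proof -
  have "\<forall>\<^sub>F s in F. x s \<in> constrained"
    using assms(2) by eventually_elim (simp add: energy_le_iff)
  then obtain z F' where F': "F' \<le> F" "F' \<noteq> bot" "limitin (condenser_vague_topology P N A) x z F'"
    by (rule constrained_cluster_limit[OF assms(1)])
  show ?thesis
    by (rule that[OF limitin_imp_cluster_point[OF F'(3,1,2)]])
qed

lemma strongly_convergent_imp_cauchy: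
  assumes ev: "\<forall>\<^sub>F s in F. x s \<in> condenser_energy_le \<kappa> P N A a g"
    and \<mu>: "\<mu> \<in> condenser_finite_energy \<kappa> P N A"
    and lim: "((\<lambda>s. condenser_dist \<kappa> P N (x s) \<mu>) \<longlongrightarrow> 0) F"
  shows "cauchy_along (condenser_dist \<kappa> P N) x F"
  unfolding cauchy_along_def
proof (intro allI impI)
  fix e :: real assume e: "0 < e"
  let ?R = "condenser_resultant P N"
  have span: "?R \<mu> \<in> energy_span"
    using finite_energy_parts[OF \<mu>] resultant_eq_parts[of \<mu>] \<mu>
    by (simp add: condenser_finite_energy_def energy_span_diff_cone)
  have "\<forall>\<^sub>F s in F. dist (condenser_dist \<kappa> P N (x s) \<mu>) 0 < e / 2"
    using e by (intro tendstoD[OF lim]) simp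
  \<comment> \<open>Two such squared distances, each doubled by the triangle estimate, stay below
    \<open>e\<^sup>2\<close>.\<close>
  then have near: "\<forall>\<^sub>F s in F. ?R (x s) \<in> energy_span \<and> quad (\<lambda>f. ?R (x s) f - ?R \<mu> f) < e\<^sup>2 / 4"
    using ev
  proof eventually_elim
    case (elim s)
    have s: "?R (x s) \<in> energy_span"
      using elim(2) by (rule energy_le_parts)
    then have nn: "0 \<le> quad (\<lambda>f. ?R (x s) f - ?R \<mu> f)"
      using span by (intro quad_nonneg energy_span_add_diff)
    have "sqrt (quad (\<lambda>f. ?R (x s) f - ?R \<mu> f)) < e / 2"
      using elim(1) nn by (simp add: condenser_dist_quad dist_real_def)
    then have "(sqrt (quad (\<lambda>f. ?R (x s) f - ?R \<mu> f)))\<^sup>2 < (e / 2)\<^sup>2"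
      using nn by (intro power_strict_mono) auto
    then show ?case
      using s nn by (simp add: power_divide)
  qed
  have "condenser_dist \<kappa> P N (x s) (x t) < e"
    if s: "?R (x s) \<in> energy_span" "quad (\<lambda>f. ?R (x s) f - ?R \<mu> f) < e\<^sup>2 / 4"
      and t: "?R (x t) \<in> energy_span" "quad (\<lambda>f. ?R (x t) f - ?R \<mu> f) < e\<^sup>2 / 4" for s t
  proof -
    have "quad (\<lambda>f. ?R (x s) f - ?R (x t) f) < e\<^sup>2"
      using quad_triangle[OF s(1) span t(1)] quad_minus_commute[OF span t(1)] s(2) t(2) by simp
    then show ?thesis
      using e unfolding condenser_dist_quad by (intro real_less_lsqrt) auto
  qed
  then show "\<forall>\<^sub>F (s, t) in F \<times>\<^sub>F F. condenser_dist \<kappa> P N (x s) (x t) < e"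
    unfolding eventually_prod_filter using near by blast
qed

text \<open>Along every finer filter vague cluster points exist and are strong limits. Strict
  positive definiteness identifies their resultants with that of \<open>\<mu>\<close>, and
  disjointness of the plates identifies the families. A net all of whose refinements cluster exactly
  at \<open>\<mu>\<close> converges to it.\<close>

lemma strong_limit_vague_limit:
  assumes F: "F \<noteq> bot" and ev: "\<forall>\<^sub>F s in F. x s \<in> condenser_energy_le \<kappa> P N A a g"
    and \<mu>: "\<mu> \<in> condenser_finite_energy \<kappa> P N A"
    and lim: "((\<lambda>s. condenser_dist \<kappa> P N (x s) \<mu>) \<longlongrightarrow> 0) F"
    and strict: "strictly_positive_definite \<kappa>" and disj: "disjoint_family_on A (P \<union> N)"
  shows "\<mu> \<in> condenser_energy_le \<kappa> P N A a g"
    and "limitin (condenser_vague_topology P N A) x \<mu> F"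
proof -
  let ?R = "condenser_resultant P N" and ?T = "condenser_vague_topology P N A"
  have m: "\<mu> \<in> condenser_measures P N A"
    using \<mu> by (simp add: condenser_finite_energy_def)
  have span: "?R \<mu> \<in> energy_span"
    using finite_energy_parts[OF \<mu>] resultant_eq_parts[OF m] by (simp add: energy_span_diff_cone)
  have unique: "z = \<mu> \<and> z \<in> condenser_energy_le \<kappa> P N A a g"
    if G: "G \<le> F" "G \<noteq> bot" and z: "cluster_point_along ?T x G z" for G z
  proof -
    have evG: "\<forall>\<^sub>F s in G. x s \<in> condenser_energy_le \<kappa> P N A a g"
      by (rule filter_leD[OF G(1) ev])
    have limG: "((\<lambda>s. condenser_dist \<kappa> P N (x s) \<mu>) \<longlongrightarrow> 0) G"
      using lim G(1) by (rule tendsto_mono[rotated])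
    note zlim = cauchy_cluster_point_limit[OF G(2) evG strongly_convergent_imp_cauchy[OF evG \<mu> limG] z]
    have zspan: "?R z \<in> energy_span"
      by (rule energy_le_parts[OF zlim(1)])
    have sq: "((\<lambda>s. 2 * (condenser_dist \<kappa> P N (x s) z)\<^sup>2 + 2 * (condenser_dist \<kappa> P N (x s) \<mu>)\<^sup>2) \<longlongrightarrow> 2 * 0\<^sup>2 + 2 * 0\<^sup>2) G"
      by (intro tendsto_intros zlim limG)
    have "\<forall>\<^sub>F s in G. quad (\<lambda>f. ?R z f - ?R \<mu> f) \<le> 2 * (condenser_dist \<kappa> P N (x s) z)\<^sup>2 + 2 * (condenser_dist \<kappa> P N (x s) \<mu>)\<^sup>2"
      using evG
    proof eventually_elim
      case (elim s)
      have s: "?R (x s) \<in> energy_span"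
        using elim by (rule energy_le_parts)
      have "0 \<le> quad (\<lambda>f. ?R (x s) f - ?R z f)" "0 \<le> quad (\<lambda>f. ?R (x s) f - ?R \<mu> f)"
        using s span zspan by (auto intro!: quad_nonneg energy_span_add_diff)
      then show ?case
        using quad_triangle[OF zspan s span] quad_minus_commute[OF zspan s] by (simp add: condenser_dist_quad)
    qed
    then have "quad (\<lambda>f. ?R z f - ?R \<mu> f) \<le> 0"
      using tendsto_lowerbound[OF sq _ G(2)] by simp
    moreover have d: "(\<lambda>f. ?R z f - ?R \<mu> f) \<in> energy_span"
      using zspan span by (rule energy_span_add_diff)
    ultimately have "quad (\<lambda>f. ?R z f - ?R \<mu> f) = 0"
      using quad_nonneg[OF d] by simp
    then have "energy_norm \<kappa> (\<lambda>f. ?R z f - ?R \<mu> f) = 0"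
      by (simp add: energy_norm_def quad_def)
    then have "(\<lambda>f. ?R z f - ?R \<mu> f) = (\<lambda>_. 0)"
      using strict energy_span_finite_energy[OF d] by (simp add: strictly_positive_definite_def)
    then have "?R z = ?R \<mu>"
      by (simp add: fun_eq_iff)
    moreover have "z \<in> condenser_measures P N A"
      using zlim(1) by (simp add: energy_le_iff constrained_measures)
    ultimately show ?thesis
      using resultant_inject[OF _ m disj] zlim(1) by blast
  qed
  have exists: "cluster_point_along ?T x G \<mu> \<and> \<mu> \<in> condenser_energy_le \<kappa> P N A a g" if G: "G \<le> F" "G \<noteq> bot" for G
    using energy_le_cluster_point_exists[OF G(2) filter_leD[OF G(1) ev]] unique[OF G] by metis
  show "\<mu> \<in> condenser_energy_le \<kappa> P N A a g"
    using exists[OF order_refl F] by blast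
  show "limitin ?T x \<mu> F"
    unfolding limitin_def
  proof (intro conjI allI impI)
    show "\<mu> \<in> topspace ?T"
      using exists[OF order_refl F] by (simp add: cluster_point_along_def)
    fix U assume U: "openin ?T U \<and> \<mu> \<in> U"
    show "\<forall>\<^sub>F s in F. x s \<in> U"
    proof (rule ccontr)
      assume not: "\<not> (\<forall>\<^sub>F s in F. x s \<in> U)"
      \<comment> \<open>Were the net not eventually in \<open>U\<close>, its restriction to the
        complement would be a proper finer filter that avoids the neighbourhood \<open>U\<close> of
        its cluster point \<open>\<mu>\<close>.\<close>
      let ?G = "inf F (principal {s. x s \<notin> U})"
      have "?G \<noteq> bot"
        using not unfolding trivial_limit_def eventually_inf_principal by (auto elim: eventually_mono)
      then have "\<exists>\<^sub>F s in ?G. x s \<in> U"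
        using exists[of ?G] U by (auto simp: cluster_point_along_def)
      moreover have "\<forall>\<^sub>F s in ?G. x s \<notin> U"
        by (simp add: eventually_inf_principal)
      ultimately show False
        by (simp add: frequently_def)
    qed
  qed
qed

end

section \<open>Tail filters of nets and the conclusion\<close>

text \<open>Directedness and transitivity make the tails a filter base, and reflexivity makes each
  tail nonempty.\<close>

lemma net_filter_directed:
  assumes "directed S r"
  shows "net_filter S r \<noteq> bot" "\<forall>\<^sub>F s in net_filter S r. s \<in> S"
proof -
  have S: "S \<noteq> {}" "r \<subseteq> S \<times> S" "refl_on S r" "trans r"
      "\<And>s t. s \<in> S \<Longrightarrow> t \<in> S \<Longrightarrow> \<exists>u\<in>S. (s, u) \<in> r \<and> (t, u) \<in> r"
    using assms by (auto simp: directed_def preorder_on_def)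
  have ev: "eventually Q (net_filter S r) \<longleftrightarrow> (\<exists>s\<in>S. \<forall>t\<in>r `` {s}. Q t)" for Q
    unfolding net_filter_def
  proof (subst eventually_INF_base)
    fix s t assume "s \<in> S" "t \<in> S"
    then obtain u where "u \<in> S" "(s, u) \<in> r" "(t, u) \<in> r"
      using S(5) by blast
    then show "\<exists>u\<in>S. principal (r `` {u}) \<le> inf (principal (r `` {s})) (principal (r `` {t}))"
      using S(4) by (intro bexI[of _ u]) (auto dest: transD)
  qed (use S(1) in \<open>auto simp: eventually_principal\<close>)
  show "net_filter S r \<noteq> bot"
    unfolding trivial_limit_def ev using S(3) by (auto dest: refl_onD)
  show "\<forall>\<^sub>F s in net_filter S r. s \<in> S"
    unfolding ev using S(1,2) by blast
qed

theorem theorem6p1: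
  fixes \<kappa> :: "'a::t2_space \<times> 'a \<Rightarrow> ereal"
    and P N :: "nat set"
    and A :: "nat \<Rightarrow> 'a set"
    and g :: "nat \<Rightarrow> 'a \<Rightarrow> real"
    and a :: "nat \<Rightarrow> real"
  assumes "locally_compact_space (euclidean :: 'a topology)"
    and "\<kappa> \<in> lsc_class"
    and "consistent \<kappa>"
    and "condenser P N A"
    and "\<And>i. i \<in> P \<union> N \<Longrightarrow> continuous_on UNIV (g i)"
    and "\<And>i x. i \<in> P \<union> N \<Longrightarrow> 0 < g i x"
    and "\<And>i. i \<in> P \<union> N \<Longrightarrow> 0 < a i"
    and "0 < condenser_cap \<kappa> P N A a g"
    and "N = {} \<or>
      (\<Sum>\<^sub>\<infinity>i\<in>P \<union> N. ennreal (a i) / ennreal (INF x\<in>A i. g i x)) < \<infinity> \<and>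
      (SUP (x, y)\<in>(\<Union>i\<in>P. A i) \<times> (\<Union>i\<in>N. A i). \<kappa> (x, y)) < \<infinity>"
  shows "semimetric_complete (condenser_dist \<kappa> P N) (condenser_energy_le \<kappa> P N A a g) \<and>
    (\<forall>(S :: 's set) r \<mu>\<^sub>s.
      directed S r \<and> (\<forall>s\<in>S. \<mu>\<^sub>s s \<in> condenser_energy_le \<kappa> P N A a g) \<and>
      cauchy_along (condenser_dist \<kappa> P N) \<mu>\<^sub>s (net_filter S r) \<longrightarrow>
        (\<exists>\<mu>. cluster_point_along (condenser_vague_topology P N A) \<mu>\<^sub>s (net_filter S r) \<mu>) \<and>
        (\<forall>\<mu>. cluster_point_along (condenser_vague_topology P N A) \<mu>\<^sub>s (net_filter S r) \<mu> \<longrightarrow>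
           \<mu> \<in> condenser_energy_le \<kappa> P N A a g \<and>
           ((\<lambda>s. (condenser_dist \<kappa> P N (\<mu>\<^sub>s s) \<mu>)\<^sup>2) \<longlongrightarrow> 0) (net_filter S r))) \<and>
    (strictly_positive_definite \<kappa> \<and> disjoint_family_on A (P \<union> N) \<longrightarrow>
      (\<forall>(S :: 's set) r \<mu>\<^sub>s \<mu>\<^sub>0.
        directed S r \<and> (\<forall>s\<in>S. \<mu>\<^sub>s s \<in> condenser_energy_le \<kappa> P N A a g) \<and>
        \<mu>\<^sub>0 \<in> condenser_finite_energy \<kappa> P N A \<and>
        ((\<lambda>s. condenser_dist \<kappa> P N (\<mu>\<^sub>s s) \<mu>\<^sub>0) \<longlongrightarrow> 0) (net_filter S r) \<longrightarrow>
          \<mu>\<^sub>0 \<in> condenser_energy_le \<kappa> P N A a g \<and>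
          limitin (condenser_vague_topology P N A) \<mu>\<^sub>s \<mu>\<^sub>0 (net_filter S r)))"
proof -
  interpret condenser_problem \<kappa> P N A g a
    using assms by unfold_locales (auto simp: consistent_def)
  \<comment> \<open>The filter results need only these two facts about a net, so its index set plays
    no further part.\<close>
  have net: "net_filter S r \<noteq> bot" "\<forall>\<^sub>F s in net_filter S r. x s \<in> M"
    if "directed S r" "\<forall>s\<in>S. x s \<in> M" for S :: "'s set" and r x and M :: "(nat \<Rightarrow> ('a \<Rightarrow> real) \<Rightarrow> real) set"
    using net_filter_directed[OF that(1)] that(2) by (auto elim: eventually_mono)
  show ?thesis
  proof (intro conjI allI impI; (elim conjE)?)
    show "semimetric_complete (condenser_dist \<kappa> P N) (condenser_energy_le \<kappa> P N A a g)"
      unfolding semimetric_complete_def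
    proof (intro allI impI; elim conjE)
      fix F assume F: "F \<noteq> bot" "F \<le> principal (condenser_energy_le \<kappa> P N A a g)"
        and cauchy: "cauchy_along (condenser_dist \<kappa> P N) (\<lambda>x. x) F"
      have ev: "\<forall>\<^sub>F x in F. x \<in> condenser_energy_le \<kappa> P N A a g"
        using F(2) by (simp add: le_principal)
      obtain z where z: "cluster_point_along (condenser_vague_topology P N A) (\<lambda>x. x) F z"
        using energy_le_cluster_point_exists[OF F(1) ev] .
      then show "\<exists>z\<in>condenser_energy_le \<kappa> P N A a g. ((\<lambda>x. condenser_dist \<kappa> P N x z) \<longlongrightarrow> 0) F"
        using cauchy_cluster_point_limit[OF F(1) ev cauchy z] by blast
    qed
  next
    fix S :: "'s set" and r \<mu>\<^sub>s
    assume S: "directed S r" "\<forall>s\<in>S. \<mu>\<^sub>s s \<in> condenser_energy_le \<kappa> P N A a g"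
    show "\<exists>\<mu>. cluster_point_along (condenser_vague_topology P N A) \<mu>\<^sub>s (net_filter S r) \<mu>"
      using energy_le_cluster_point_exists[OF net[OF S]] by blast
  next
    fix S :: "'s set" and r \<mu>\<^sub>s \<mu>
    assume S: "directed S r" "\<forall>s\<in>S. \<mu>\<^sub>s s \<in> condenser_energy_le \<kappa> P N A a g"
      and cauchy: "cauchy_along (condenser_dist \<kappa> P N) \<mu>\<^sub>s (net_filter S r)"
      and \<mu>: "cluster_point_along (condenser_vague_topology P N A) \<mu>\<^sub>s (net_filter S r) \<mu>"
    note limit = cauchy_cluster_point_limit[OF net[OF S] cauchy \<mu>]
    show "\<mu> \<in> condenser_energy_le \<kappa> P N A a g"
      by (rule limit(1))
    show "((\<lambda>s. (condenser_dist \<kappa> P N (\<mu>\<^sub>s s) \<mu>)\<^sup>2) \<longlongrightarrow> 0) (net_filter S r)"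
      using tendsto_power[OF limit(2), of 2] by simp
  next
    fix S :: "'s set" and r \<mu>\<^sub>s \<mu>\<^sub>0
    assume S: "directed S r" "\<forall>s\<in>S. \<mu>\<^sub>s s \<in> condenser_energy_le \<kappa> P N A a g"
      and \<mu>\<^sub>0: "\<mu>\<^sub>0 \<in> condenser_finite_energy \<kappa> P N A"
        "((\<lambda>s. condenser_dist \<kappa> P N (\<mu>\<^sub>s s) \<mu>\<^sub>0) \<longlongrightarrow> 0) (net_filter S r)"
      and strict: "strictly_positive_definite \<kappa>" "disjoint_family_on A (P \<union> N)"
    show "\<mu>\<^sub>0 \<in> condenser_energy_le \<kappa> P N A a g"
        "limitin (condenser_vague_topology P N A) \<mu>\<^sub>s \<mu>\<^sub>0 (net_filter S r)"
      by (rule strong_limit_vague_limit[OF net[OF S] \<mu>\<^sub>0 strict])+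
  qed
qed

end
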